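(* $\mathrm{HA}^{\omega}$ is closed under the rule of bar induction (without parameters): for any formula $P(a)$ of $\mathrm{HA}^{\omega}$ with $a$ of type $\mathbb{N}^*$ and with no free variables other than $a$, if $$\mathrm{HA}^{\omega} \vdash \forall \alpha^{\mathbb{N}^{\mathbb{N}}} \exists n^{\mathbb{N}} P(\overline{\alpha}n) \wedge \forall a\forall b\,[P(a)\to P(a*b)] \wedge \forall a\,[P(a)\vee\neg P(a)],$$ then for every formula $Q(a)$ (predicate on $\mathbb{N}^*$), $$\mathrm{HA}^{\omega} \vdash \forall a\,[P(a)\to Q(a)] \wedge \forall a^{\mathbb{N}^{*}} \left[ \forall n^{\mathbb{N}} Q(a * \langle n \rangle) \to Q(a) \right] \to Q(\langle\, \rangle).$$
   Context: $\mathrm{HA}^{\omega}$ is extensional Heyting arithmetic in all finite types (terms of Gödel's system $\mathsf{T}$ with constants $0$, $\mathsf{Succ}$, $\mathsf{Rec}_\rho$). Finite sequences of natural numbers (type $\mathbb{N}^*$) are coded as natural numbers; $\langle\,\rangle$ is the empty sequence, $\langle n\rangle$ a singleton, $*$ concatenation, and $\overline{\alpha}n$ the initial segment of $\alpha$ of length $n$. *)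

theory Defs
  imports "HOL-Library.Nat_Bijection"
begin

section \<open>Finite types and the terms of System T\<close>

datatype ty = Nat | Fun ty ty  (infixr "\<Rrightarrow>" 60)

text \<open>Variables are de Bruijn indices; a typing context is a list of types, entry \<open>i\<close> being the
  type of \<open>Var i\<close>.\<close>

datatype tm =
    Var nat
  | Zero
  | Succ
  | Rec ty
  | App tm tm  (infixl "\<cdot>" 90)
  | Lam ty tm

inductive typing :: "ty list \<Rightarrow> tm \<Rightarrow> ty \<Rightarrow> bool" where
  "i < length \<Gamma> \<Longrightarrow> typing \<Gamma> (Var i) (\<Gamma> ! i)"
| "typing \<Gamma> Zero Nat"
| "typing \<Gamma> Succ (Nat \<Rrightarrow> Nat)"
| "typing \<Gamma> (Rec \<rho>) (\<rho> \<Rrightarrow> (Nat \<Rrightarrow> \<rho> \<Rrightarrow> \<rho>) \<Rrightarrow> Nat \<Rrightarrow> \<rho>)"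
| "typing \<Gamma> s (\<rho> \<Rrightarrow> \<tau>) \<Longrightarrow> typing \<Gamma> t \<rho> \<Longrightarrow> typing \<Gamma> (s \<cdot> t) \<tau>"
| "typing (\<rho> # \<Gamma>) t \<tau> \<Longrightarrow> typing \<Gamma> (Lam \<rho> t) (\<rho> \<Rrightarrow> \<tau>)"

primrec ren :: "(nat \<Rightarrow> nat) \<Rightarrow> tm \<Rightarrow> tm" where
  "ren \<xi> (Var i) = Var (\<xi> i)"
| "ren \<xi> Zero = Zero"
| "ren \<xi> Succ = Succ"
| "ren \<xi> (Rec \<rho>) = Rec \<rho>"
| "ren \<xi> (s \<cdot> t) = ren \<xi> s \<cdot> ren \<xi> t"
| "ren \<xi> (Lam \<rho> t) = Lam \<rho> (ren (case_nat 0 (Suc \<circ> \<xi>)) t)"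

definition up :: "(nat \<Rightarrow> tm) \<Rightarrow> nat \<Rightarrow> tm" where
  "up \<sigma> = case_nat (Var 0) (ren Suc \<circ> \<sigma>)"

primrec sub :: "(nat \<Rightarrow> tm) \<Rightarrow> tm \<Rightarrow> tm" where
  "sub \<sigma> (Var i) = \<sigma> i"
| "sub \<sigma> Zero = Zero"
| "sub \<sigma> Succ = Succ"
| "sub \<sigma> (Rec \<rho>) = Rec \<rho>"
| "sub \<sigma> (s \<cdot> t) = sub \<sigma> s \<cdot> sub \<sigma> t"
| "sub \<sigma> (Lam \<rho> t) = Lam \<rho> (sub (up \<sigma>) t)"


section \<open>Formulas\<close>

datatype fm =
    Eq ty tm tm
  | Bot
  | And fm fm  (infixr "\<^bold>\<and>" 65)
  | Or fm fm  (infixr "\<^bold>\<or>" 60)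
  | Imp fm fm  (infixr "\<^bold>\<longrightarrow>" 55)
  | All ty fm
  | Ex ty fm

abbreviation Neg :: "fm \<Rightarrow> fm"  ("\<^bold>\<not> _" [70] 70) where
  "\<^bold>\<not> A \<equiv> A \<^bold>\<longrightarrow> Bot"

primrec wff :: "ty list \<Rightarrow> fm \<Rightarrow> bool" where
  "wff \<Gamma> (Eq \<rho> s t) \<longleftrightarrow> typing \<Gamma> s \<rho> \<and> typing \<Gamma> t \<rho>"
| "wff \<Gamma> Bot \<longleftrightarrow> True"
| "wff \<Gamma> (A \<^bold>\<and> B) \<longleftrightarrow> wff \<Gamma> A \<and> wff \<Gamma> B"
| "wff \<Gamma> (A \<^bold>\<or> B) \<longleftrightarrow> wff \<Gamma> A \<and> wff \<Gamma> B"
| "wff \<Gamma> (A \<^bold>\<longrightarrow> B) \<longleftrightarrow> wff \<Gamma> A \<and> wff \<Gamma> B"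
| "wff \<Gamma> (All \<rho> A) \<longleftrightarrow> wff (\<rho> # \<Gamma>) A"
| "wff \<Gamma> (Ex \<rho> A) \<longleftrightarrow> wff (\<rho> # \<Gamma>) A"

primrec fsub :: "(nat \<Rightarrow> tm) \<Rightarrow> fm \<Rightarrow> fm" where
  "fsub \<sigma> (Eq \<rho> s t) = Eq \<rho> (sub \<sigma> s) (sub \<sigma> t)"
| "fsub \<sigma> Bot = Bot"
| "fsub \<sigma> (A \<^bold>\<and> B) = fsub \<sigma> A \<^bold>\<and> fsub \<sigma> B"
| "fsub \<sigma> (A \<^bold>\<or> B) = fsub \<sigma> A \<^bold>\<or> fsub \<sigma> B"
| "fsub \<sigma> (A \<^bold>\<longrightarrow> B) = fsub \<sigma> A \<^bold>\<longrightarrow> fsub \<sigma> B"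
| "fsub \<sigma> (All \<rho> A) = All \<rho> (fsub (up \<sigma>) A)"
| "fsub \<sigma> (Ex \<rho> A) = Ex \<rho> (fsub (up \<sigma>) A)"

text \<open>For \<open>A\<close> in context \<open>\<rho> # \<Gamma>\<close> and \<open>t\<close> of type \<open>\<rho>\<close> in a context \<open>\<Theta> @ \<Gamma>\<close> with \<open>length \<Theta> = k\<close>,
  \<open>inst k t A\<close> is the formula \<open>A(t)\<close> in context \<open>\<Theta> @ \<Gamma>\<close>: variable \<open>0\<close> of \<open>A\<close> is replaced by \<open>t\<close> and
  the parameters from \<open>\<Gamma>\<close> are moved past the \<open>k\<close> variables of \<open>\<Theta>\<close>.\<close>

definition inst :: "nat \<Rightarrow> tm \<Rightarrow> fm \<Rightarrow> fm" where
  "inst k t = fsub (case_nat t (\<lambda>i. Var (i + k)))"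

definition flift :: "fm \<Rightarrow> fm" where
  "flift = fsub (Var \<circ> Suc)"


section \<open>Derivability in extensional Heyting arithmetic in all finite types\<close>

text \<open>\<open>HA \<Gamma> \<Delta> A\<close>: the formula \<open>A\<close>, whose free variables are declared in \<open>\<Gamma>\<close>, is derivable from the
  assumptions \<open>\<Delta>\<close>. Equality is primitive at every type; \<open>Ext\<close> makes it extensional.\<close>

inductive HA :: "ty list \<Rightarrow> fm set \<Rightarrow> fm \<Rightarrow> bool" where
  Hyp: "A \<in> \<Delta> \<Longrightarrow> wff \<Gamma> A \<Longrightarrow> HA \<Gamma> \<Delta> A"
| AndI: "HA \<Gamma> \<Delta> A \<Longrightarrow> HA \<Gamma> \<Delta> B \<Longrightarrow> HA \<Gamma> \<Delta> (A \<^bold>\<and> B)"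
| AndE1: "HA \<Gamma> \<Delta> (A \<^bold>\<and> B) \<Longrightarrow> HA \<Gamma> \<Delta> A"
| AndE2: "HA \<Gamma> \<Delta> (A \<^bold>\<and> B) \<Longrightarrow> HA \<Gamma> \<Delta> B"
| OrI1: "HA \<Gamma> \<Delta> A \<Longrightarrow> wff \<Gamma> B \<Longrightarrow> HA \<Gamma> \<Delta> (A \<^bold>\<or> B)"
| OrI2: "HA \<Gamma> \<Delta> B \<Longrightarrow> wff \<Gamma> A \<Longrightarrow> HA \<Gamma> \<Delta> (A \<^bold>\<or> B)"
| OrE: "HA \<Gamma> \<Delta> (A \<^bold>\<or> B) \<Longrightarrow> HA \<Gamma> (insert A \<Delta>) C \<Longrightarrow> HA \<Gamma> (insert B \<Delta>) C \<Longrightarrow> HA \<Gamma> \<Delta> C"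
| ImpI: "wff \<Gamma> A \<Longrightarrow> HA \<Gamma> (insert A \<Delta>) B \<Longrightarrow> HA \<Gamma> \<Delta> (A \<^bold>\<longrightarrow> B)"
| ImpE: "HA \<Gamma> \<Delta> (A \<^bold>\<longrightarrow> B) \<Longrightarrow> HA \<Gamma> \<Delta> A \<Longrightarrow> HA \<Gamma> \<Delta> B"
| BotE: "HA \<Gamma> \<Delta> Bot \<Longrightarrow> wff \<Gamma> A \<Longrightarrow> HA \<Gamma> \<Delta> A"
| AllI: "HA (\<rho> # \<Gamma>) (flift ` \<Delta>) A \<Longrightarrow> HA \<Gamma> \<Delta> (All \<rho> A)"
| AllE: "HA \<Gamma> \<Delta> (All \<rho> A) \<Longrightarrow> typing \<Gamma> t \<rho> \<Longrightarrow> HA \<Gamma> \<Delta> (inst 0 t A)"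
| ExI: "wff (\<rho> # \<Gamma>) A \<Longrightarrow> typing \<Gamma> t \<rho> \<Longrightarrow> HA \<Gamma> \<Delta> (inst 0 t A) \<Longrightarrow> HA \<Gamma> \<Delta> (Ex \<rho> A)"
| ExE: "HA \<Gamma> \<Delta> (Ex \<rho> A) \<Longrightarrow> HA (\<rho> # \<Gamma>) (insert A (flift ` \<Delta>)) (flift C) \<Longrightarrow> HA \<Gamma> \<Delta> C"
| Refl: "typing \<Gamma> t \<rho> \<Longrightarrow> HA \<Gamma> \<Delta> (Eq \<rho> t t)"
| Repl: "wff (\<rho> # \<Gamma>) A \<Longrightarrow> HA \<Gamma> \<Delta> (Eq \<rho> s t) \<Longrightarrow> HA \<Gamma> \<Delta> (inst 0 s A) \<Longrightarrow> HA \<Gamma> \<Delta> (inst 0 t A)"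
| Ext: "typing \<Gamma> s (\<rho> \<Rrightarrow> \<tau>) \<Longrightarrow> typing \<Gamma> t (\<rho> \<Rrightarrow> \<tau>) \<Longrightarrow>
    HA \<Gamma> \<Delta> (All \<rho> (Eq \<tau> (ren Suc s \<cdot> Var 0) (ren Suc t \<cdot> Var 0))) \<Longrightarrow> HA \<Gamma> \<Delta> (Eq (\<rho> \<Rrightarrow> \<tau>) s t)"
| Beta: "typing (\<rho> # \<Gamma>) s \<tau> \<Longrightarrow> typing \<Gamma> t \<rho> \<Longrightarrow>
    HA \<Gamma> \<Delta> (Eq \<tau> (Lam \<rho> s \<cdot> t) (sub (case_nat t Var) s))"
| RecZero: "typing \<Gamma> s \<rho> \<Longrightarrow> typing \<Gamma> t (Nat \<Rrightarrow> \<rho> \<Rrightarrow> \<rho>) \<Longrightarrow>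
    HA \<Gamma> \<Delta> (Eq \<rho> (Rec \<rho> \<cdot> s \<cdot> t \<cdot> Zero) s)"
| RecSucc: "typing \<Gamma> s \<rho> \<Longrightarrow> typing \<Gamma> t (Nat \<Rrightarrow> \<rho> \<Rrightarrow> \<rho>) \<Longrightarrow> typing \<Gamma> u Nat \<Longrightarrow>
    HA \<Gamma> \<Delta> (Eq \<rho> (Rec \<rho> \<cdot> s \<cdot> t \<cdot> (Succ \<cdot> u)) (t \<cdot> u \<cdot> (Rec \<rho> \<cdot> s \<cdot> t \<cdot> u)))"
| SuccNotZero: "typing \<Gamma> t Nat \<Longrightarrow> HA \<Gamma> \<Delta> (\<^bold>\<not> Eq Nat (Succ \<cdot> t) Zero)"
| SuccInj: "HA \<Gamma> \<Delta> (Eq Nat (Succ \<cdot> s) (Succ \<cdot> t)) \<Longrightarrow> HA \<Gamma> \<Delta> (Eq Nat s t)"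
| Ind: "HA \<Gamma> \<Delta> (inst 0 Zero A) \<Longrightarrow> HA \<Gamma> \<Delta> (All Nat (A \<^bold>\<longrightarrow> inst 1 (Succ \<cdot> Var 0) A)) \<Longrightarrow>
    HA \<Gamma> \<Delta> (All Nat A)"


section \<open>Codes of finite sequences\<close>

text \<open>The coding is \<^const>\<open>list_encode\<close>, a bijection between finite sequences and natural numbers, so
  quantification over sequences is quantification over type \<open>Nat\<close>. The arithmetic it needs is
  programmed in System T. De Bruijn indices are read from the innermost binder outwards: in the step
  function \<open>Lam Nat (Lam \<rho> _)\<close> of a recursor, \<open>Var 1\<close> is the predecessor and \<open>Var 0\<close> the recursive
  value.\<close>

definition add_tm :: tm where
  "add_tm = Lam Nat (Lam Nat (Rec Nat \<cdot> Var 1 \<cdot> Lam Nat (Lam Nat (Succ \<cdot> Var 0)) \<cdot> Var 0))"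

definition pred_tm :: tm where
  "pred_tm = Lam Nat (Rec Nat \<cdot> Zero \<cdot> Lam Nat (Lam Nat (Var 1)) \<cdot> Var 0)"

definition diff_tm :: tm where
  "diff_tm = Lam Nat (Lam Nat (Rec Nat \<cdot> Var 1 \<cdot> Lam Nat (Lam Nat (pred_tm \<cdot> Var 0)) \<cdot> Var 0))"

text \<open>\<open>if_tm \<cdot> c \<cdot> x \<cdot> y\<close> is \<open>x\<close> if \<open>c\<close> is zero and \<open>y\<close> otherwise.\<close>

definition if_tm :: tm where
  "if_tm = Lam Nat (Lam Nat (Lam Nat (Rec Nat \<cdot> Var 1 \<cdot> Lam Nat (Lam Nat (Var 2)) \<cdot> Var 2)))"

definition triangle_tm :: tm where
  "triangle_tm = Lam Nat
    (Rec Nat \<cdot> Zero \<cdot> Lam Nat (Lam Nat (add_tm \<cdot> Var 0 \<cdot> (Succ \<cdot> Var 1))) \<cdot> Var 0)"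

definition pair_tm :: tm where
  "pair_tm = Lam Nat (Lam Nat
    (add_tm \<cdot> (triangle_tm \<cdot> (add_tm \<cdot> Var 1 \<cdot> Var 0)) \<cdot> Var 1))"

text \<open>\<open>diag_tm \<cdot> n\<close> is the largest \<open>d\<close> with \<open>triangle d \<le> n\<close>, i.e. the sum of the two components of the
  pair coded by \<open>n\<close>.\<close>

definition diag_tm :: tm where
  "diag_tm = Lam Nat
    (Rec Nat \<cdot> Zero
      \<cdot> Lam Nat (Lam Nat (if_tm \<cdot> (diff_tm \<cdot> (triangle_tm \<cdot> (Succ \<cdot> Var 0)) \<cdot> (Succ \<cdot> Var 1))
            \<cdot> (Succ \<cdot> Var 0) \<cdot> Var 0))
      \<cdot> Var 0)"

definition fst_tm :: tm where
  "fst_tm = Lam Nat (diff_tm \<cdot> Var 0 \<cdot> (triangle_tm \<cdot> (diag_tm \<cdot> Var 0)))"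

definition snd_tm :: tm where
  "snd_tm = Lam Nat (diff_tm \<cdot> (diag_tm \<cdot> Var 0) \<cdot> (fst_tm \<cdot> Var 0))"

definition nil_tm :: tm where
  "nil_tm = Zero"

definition cons_tm :: tm where
  "cons_tm = Lam Nat (Lam Nat (Succ \<cdot> (pair_tm \<cdot> Var 1 \<cdot> Var 0)))"

definition hd_tm :: tm where
  "hd_tm = Lam Nat (fst_tm \<cdot> (pred_tm \<cdot> Var 0))"

definition tl_tm :: tm where
  "tl_tm = Lam Nat (snd_tm \<cdot> (pred_tm \<cdot> Var 0))"

definition single_tm :: tm where
  "single_tm = Lam Nat (cons_tm \<cdot> Var 0 \<cdot> nil_tm)"

text \<open>Concatenation \<open>a * b\<close> recurses along \<open>a\<close>. The recursor, at type \<open>Nat \<Rrightarrow> Nat\<close>, computes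
  \<open>\<lambda>c. c * b\<close> with a bound on the number of steps; \<open>a\<close> itself bounds the length of the sequence
  coded by \<open>a\<close>.\<close>

definition append_tm :: tm where
  "append_tm = Lam Nat (Lam Nat
    (Rec (Nat \<Rrightarrow> Nat)
      \<cdot> Lam Nat (Var 1)
      \<cdot> Lam Nat (Lam (Nat \<Rrightarrow> Nat) (Lam Nat
          (if_tm \<cdot> Var 0 \<cdot> Var 3 \<cdot> (cons_tm \<cdot> (hd_tm \<cdot> Var 0) \<cdot> (Var 1 \<cdot> (tl_tm \<cdot> Var 0))))))
      \<cdot> Var 1 \<cdot> Var 1))"

text \<open>\<open>initial_tm \<cdot> \<alpha> \<cdot> n\<close> is the initial segment of \<open>\<alpha>\<close> of length \<open>n\<close>.\<close>

definition initial_tm :: tm where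
  "initial_tm = Lam (Nat \<Rrightarrow> Nat) (Lam Nat
    (Rec Nat \<cdot> nil_tm
      \<cdot> Lam Nat (Lam Nat (append_tm \<cdot> Var 0 \<cdot> (single_tm \<cdot> (Var 3 \<cdot> Var 1))))
      \<cdot> Var 0))"

end

theory Submission
  imports Defs
begin

text \<open>The bar is reached along a generic sequence. Fix \<open>Q\<close> and work inside the theory extended by the
  hypotheses on \<open>P\<close> and \<open>Q\<close>. Formulas are interpreted by forcing over finite sequences, a condition
  being an initial segment of length \<open>n\<close> of some \<open>\<alpha>\<close>, and an object of type \<open>\<rho>\<close> being a term of type
  \<open>BT \<Rrightarrow> \<rho>\<close>, that is, an object depending on the generic sequence. Disjunctions and existential
  quantifiers are read through the nucleus \<open>X \<mapsto> ((X \<rightarrow> Q) \<rightarrow> Q)\<close> on predicates of conditions. Since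
  \<open>\<forall>n. Q(a * \<langle>n\<rangle>)\<close> implies \<open>Q(a)\<close>, every condition is covered, in the sense of this nucleus, by
  arbitrarily long extensions, so the identity is a legitimate generic sequence \<open>g\<close>. Forcing is sound
  for the theory, and the clauses for implication and universal quantification include the truth of
  the formula along the condition, so that forced formulas are, up to the nucleus, true there.
  Hence \<open>\<exists>n. P(g|n)\<close> is forced, which makes \<open>P\<close> true, up to the nucleus, at the empty
  sequence: \<open>(P \<rightarrow> Q) \<rightarrow> Q\<close>, and \<open>P\<close> implies \<open>Q\<close>.\<close>

section \<open>Substitution and derivability\<close>

text \<open>Derivability of the bar premise, not its truth, is what is given, so its derivation has
  to be transformed, and every rule of the calculus, with recursors at all types, must be sound for
  forcing. Forcing is a HOL predicate over worlds (a context with hypotheses) and conditions instead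
  of a translation of formulas: worlds behave like a Kripke model, so implications and universal
  quantifiers can be handled in the metalogic. The price is that induction of the object theory
  applies only to predicates expressed by formulas, whence the separate definability proofs. Two
  obstacles determine the clauses. A number depending on the generic sequence is out of reach of
  induction unless it is constant on a cover; quantifiers therefore range over a logical relation
  whose clause at \<open>Nat\<close> is local constancy. And Q follows from P itself, not from
  forced P, while forcing of an implication alone says nothing about its truth, since a true premise
  need not be forced; carrying truth in the clauses, as in realizability with truth, repairs
  this.\<close>

lemma up_simps [simp]: "up \<sigma> 0 = Var 0" "up \<sigma> (Suc i) = ren Suc (\<sigma> i)"
  by (simp_all add: up_def)

lemma up_Var: "up (Var \<circ> \<xi>) = Var \<circ> case_nat 0 (Suc \<circ> \<xi>)"
  by (auto simp: up_def fun_eq_iff split: nat.split)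

lemma up_id [simp]: "up Var = Var"
  by (auto simp: up_def fun_eq_iff split: nat.split)

lemma ren_eq_sub: "ren \<xi> t = sub (Var \<circ> \<xi>) t"
  by (induction t arbitrary: \<xi>) (simp_all add: up_Var)

lemma sub_ren: "sub \<sigma> (ren \<xi> t) = sub (\<sigma> \<circ> \<xi>) t"
proof (induction t arbitrary: \<sigma> \<xi>)
  case (Lam \<rho> t)
  have "up \<sigma> \<circ> case_nat 0 (Suc \<circ> \<xi>) = up (\<sigma> \<circ> \<xi>)"
    by (auto simp: up_def fun_eq_iff split: nat.split)
  then show ?case by (simp only: ren.simps sub.simps Lam.IH)
qed simp_all

lemma ren_ren: "ren \<xi> (ren \<zeta> t) = ren (\<xi> \<circ> \<zeta>) t"
  by (simp add: ren_eq_sub[of \<xi>] sub_ren) (simp add: ren_eq_sub comp_assoc)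

lemma ren_sub: "ren \<xi> (sub \<sigma> t) = sub (ren \<xi> \<circ> \<sigma>) t"
proof (induction t arbitrary: \<sigma> \<xi>)
  case (Lam \<rho> t)
  have "ren (case_nat 0 (Suc \<circ> \<xi>)) \<circ> up \<sigma> = up (ren \<xi> \<circ> \<sigma>)"
    by (auto simp: up_def fun_eq_iff ren_ren comp_def split: nat.split)
  then show ?case by (simp only: ren.simps sub.simps Lam.IH)
qed simp_all

lemma sub_up_comp: "sub (up \<tau>) \<circ> up \<sigma> = up (sub \<tau> \<circ> \<sigma>)"
proof
  fix i show "(sub (up \<tau>) \<circ> up \<sigma>) i = up (sub \<tau> \<circ> \<sigma>) i"
    by (cases i) (simp_all add: sub_ren ren_sub comp_def)
qed

lemma sub_sub: "sub \<tau> (sub \<sigma> t) = sub (sub \<tau> \<circ> \<sigma>) t"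
  by (induction t arbitrary: \<sigma> \<tau>) (simp_all add: sub_up_comp)

lemma sub_Var [simp]: "sub Var t = t"
  by (induction t) simp_all

lemma fsub_fsub: "fsub \<tau> (fsub \<sigma> A) = fsub (sub \<tau> \<circ> \<sigma>) A"
  by (induction A arbitrary: \<sigma> \<tau>) (simp_all add: sub_up_comp sub_sub)

lemma fsub_Var [simp]: "fsub Var A = A"
  by (induction A) simp_all

lemma sub_cong: "typing \<Gamma> t \<rho> \<Longrightarrow> \<forall>i < length \<Gamma>. \<sigma> i = \<tau> i \<Longrightarrow> sub \<sigma> t = sub \<tau> t"
proof (induction arbitrary: \<sigma> \<tau> rule: typing.induct)
  case (6 \<rho> \<Gamma> t \<tau>')
  have "\<forall>i < length (\<rho> # \<Gamma>). up \<sigma> i = up \<tau> i"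
    using "6.prems" by (auto simp: up_def split: nat.split)
  then show ?case using "6.IH" by (simp only: sub.simps)
next
  case (5 \<Gamma> s \<rho> \<tau>' t)
  show ?case using "5.IH"(1)[OF "5.prems"] "5.IH"(2)[OF "5.prems"] by (simp only: sub.simps)
qed simp_all

lemma fsub_cong: "wff \<Gamma> A \<Longrightarrow> \<forall>i < length \<Gamma>. \<sigma> i = \<tau> i \<Longrightarrow> fsub \<sigma> A = fsub \<tau> A"
proof (induction A arbitrary: \<Gamma> \<sigma> \<tau>)
  case (All \<rho> A)
  have "\<forall>i < length (\<rho> # \<Gamma>). up \<sigma> i = up \<tau> i"
    using All.prems by (auto simp: up_def split: nat.split)
  then show ?case using All.IH[of "\<rho> # \<Gamma>"] All.prems(1) by (simp only: fsub.simps wff.simps)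
next
  case (Ex \<rho> A)
  have "\<forall>i < length (\<rho> # \<Gamma>). up \<sigma> i = up \<tau> i"
    using Ex.prems by (auto simp: up_def split: nat.split)
  then show ?case using Ex.IH[of "\<rho> # \<Gamma>"] Ex.prems(1) by (simp only: fsub.simps wff.simps)
next
  case (Eq \<rho> s t)
  then show ?case using sub_cong by (simp only: fsub.simps wff.simps) blast
next
  case (And A B)
  show ?case using And.prems And.IH[OF _ And.prems(2)] by (simp only: fsub.simps wff.simps)
next
  case (Or A B)
  show ?case using Or.prems Or.IH[OF _ Or.prems(2)] by (simp only: fsub.simps wff.simps)
next
  case (Imp A B)
  show ?case using Imp.prems Imp.IH[OF _ Imp.prems(2)] by (simp only: fsub.simps wff.simps)
qed simp_all

lemma fsub_id: "wff \<Gamma> A \<Longrightarrow> \<forall>i < length \<Gamma>. \<sigma> i = Var i \<Longrightarrow> fsub \<sigma> A = A"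
  using fsub_cong[of \<Gamma> A \<sigma> Var] by simp

text \<open>\<open>senv 0 ss\<close> substitutes the list \<open>ss\<close> for the first variables and leaves the parameters beyond
  them as they are; \<open>senv k ss\<close> moves these parameters past \<open>k\<close> new variables.\<close>

definition senv :: "nat \<Rightarrow> tm list \<Rightarrow> nat \<Rightarrow> tm" where
  "senv k ss i = (if i < length ss then ss ! i else Var (i - length ss + k))"

lemma senv_Cons: "case_nat t (senv k ss) = senv k (t # ss)"
  by (auto simp: senv_def fun_eq_iff split: nat.split)

lemma senv_Nil [simp]: "senv 0 [] = Var"
  by (auto simp: senv_def fun_eq_iff)

lemma senv_simps [simp]: "senv k (t # ss) 0 = t" "senv k (t # ss) (Suc i) = senv k ss i"
  "senv k [] i = Var (i + k)"
  by (auto simp: senv_def)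

lemma inst_senv: "inst k t = fsub (senv k [t])"
proof -
  have "case_nat t (\<lambda>i. Var (i + k)) = senv k [t]"
    by (auto simp: senv_def fun_eq_iff split: nat.split)
  then show ?thesis by (simp add: inst_def)
qed

lemma case_nat_Var: "case_nat t Var = senv 0 [t]"
  using senv_Cons[of t 0 "[]"] by simp

text \<open>Lifting followed by instantiation merely extends the substitution. Hence bodies of
  quantifiers can be carried as simultaneous substitutions \<open>case_nat t \<sigma>\<close>
  instead of nested instances.\<close>

lemma sub_case_up: "sub (case_nat t Var) \<circ> up \<sigma> = case_nat t \<sigma>"
proof
  fix i show "(sub (case_nat t Var) \<circ> up \<sigma>) i = case_nat t \<sigma> i"
    by (cases i) (simp_all add: sub_ren comp_def)
qed

lemma inst0: "inst 0 t = fsub (case_nat t Var)"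
  by (simp add: inst_def)

lemma inst0_up: "inst 0 t (fsub (up \<sigma>) A) = fsub (case_nat t \<sigma>) A"
  by (simp add: inst0 fsub_fsub sub_case_up)

lemma fsub_inst0: "fsub \<sigma> (inst 0 t A) = inst 0 (sub \<sigma> t) (fsub (up \<sigma>) A)"
proof -
  have "sub \<sigma> \<circ> case_nat t Var = case_nat (sub \<sigma> t) \<sigma>"
    by (auto simp: fun_eq_iff split: nat.split)
  then show ?thesis by (simp add: inst0_up) (simp add: inst0 fsub_fsub)
qed

lemma sub_beta: "sub \<sigma> (sub (case_nat t Var) s) = sub (case_nat (sub \<sigma> t) Var) (sub (up \<sigma>) s)"
proof -
  have "sub \<sigma> \<circ> case_nat t Var = case_nat (sub \<sigma> t) \<sigma>"
    by (auto simp: fun_eq_iff split: nat.split)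
  then show ?thesis by (simp add: sub_sub sub_case_up)
qed

lemma up_ren: "sub (up \<sigma>) (ren Suc s) = ren Suc (sub \<sigma> s)"
  by (simp add: sub_ren ren_sub comp_def)

lemma fsub_flift: "fsub (up \<sigma>) (flift A) = flift (fsub \<sigma> A)"
  by (simp add: flift_def fsub_fsub comp_def ren_eq_sub)

lemma fsub_inst1: "fsub (up \<sigma>) (inst 1 (Succ \<cdot> Var 0) A) = inst 1 (Succ \<cdot> Var 0) (fsub (up \<sigma>) A)"
proof -
  have "sub (up \<sigma>) \<circ> case_nat (Succ \<cdot> Var 0) (\<lambda>i. Var (i + 1))
      = sub (case_nat (Succ \<cdot> Var 0) (\<lambda>i. Var (i + 1))) \<circ> up \<sigma>"
    by (auto simp: fun_eq_iff sub_sub sub_ren ren_eq_sub comp_def up_def split: nat.split)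
  then show ?thesis by (simp add: inst_def fsub_fsub)
qed

section \<open>Typing and well-formedness under renaming and substitution\<close>

inductive_cases typing_VarE: "typing \<Gamma> (Var i) \<tau>"
inductive_cases typing_ZeroE: "typing \<Gamma> Zero \<tau>"
inductive_cases typing_SuccE: "typing \<Gamma> Succ \<tau>"
inductive_cases typing_RecE: "typing \<Gamma> (Rec \<rho>) \<tau>"
inductive_cases typing_AppE: "typing \<Gamma> (s \<cdot> t) \<tau>"
inductive_cases typing_LamE: "typing \<Gamma> (Lam \<rho> t) \<tau>"

lemma typing_Var: "i < length \<Gamma> \<Longrightarrow> \<Gamma> ! i = \<tau> \<Longrightarrow> typing \<Gamma> (Var i) \<tau>"
  using typing.intros(1) by blast

lemma typing_ren:
  "typing \<Gamma> t \<tau> \<Longrightarrow> (\<And>i. i < length \<Gamma> \<Longrightarrow> \<xi> i < length \<Gamma>' \<and> \<Gamma>' ! \<xi> i = \<Gamma> ! i)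
    \<Longrightarrow> typing \<Gamma>' (ren \<xi> t) \<tau>"
proof (induction arbitrary: \<Gamma>' \<xi> rule: typing.induct)
  case (6 \<rho> \<Gamma> t \<tau>)
  have "typing (\<rho> # \<Gamma>') (ren (case_nat 0 (Suc \<circ> \<xi>)) t) \<tau>"
    by (rule "6.IH") (use "6.prems" in \<open>auto split: nat.split\<close>)
  then show ?case by (simp add: typing.intros)
next
  case (5 \<Gamma> s \<rho> \<tau> t)
  show ?case using typing.intros(5)[OF "5.IH"(1)[OF "5.prems"] "5.IH"(2)[OF "5.prems"]] by simp
qed (auto intro: typing.intros typing_Var)

lemma typing_ren_Suc: "typing \<Gamma> t \<tau> \<Longrightarrow> typing (\<rho> # \<Gamma>) (ren Suc t) \<tau>"
  by (erule typing_ren) simp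

lemma typing_append: "typing \<Gamma> t \<tau> \<Longrightarrow> typing (\<Gamma> @ \<Theta>) t \<tau>"
proof (induction rule: typing.induct)
  case (1 i \<Gamma>)
  then show ?case by (intro typing_Var) (auto simp: nth_append)
qed (auto intro: typing.intros)

definition typed_sub :: "ty list \<Rightarrow> (nat \<Rightarrow> tm) \<Rightarrow> ty list \<Rightarrow> bool" where
  "typed_sub \<Gamma>' \<sigma> \<Gamma> \<longleftrightarrow> (\<forall>i < length \<Gamma>. typing \<Gamma>' (\<sigma> i) (\<Gamma> ! i))"

lemma typed_sub_up: "typed_sub \<Gamma>' \<sigma> \<Gamma> \<Longrightarrow> typed_sub (\<rho> # \<Gamma>') (up \<sigma>) (\<rho> # \<Gamma>)"
  unfolding typed_sub_def
proof (intro allI impI)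
  fix i assume *: "\<forall>i<length \<Gamma>. typing \<Gamma>' (\<sigma> i) (\<Gamma> ! i)" "i < length (\<rho> # \<Gamma>)"
  then show "typing (\<rho> # \<Gamma>') (up \<sigma> i) ((\<rho> # \<Gamma>) ! i)"
    by (cases i) (auto intro: typing_ren_Suc typing_Var)
qed

lemma typed_sub_case: "typing \<Gamma>' t \<rho> \<Longrightarrow> typed_sub \<Gamma>' \<sigma> \<Gamma> \<Longrightarrow> typed_sub \<Gamma>' (case_nat t \<sigma>) (\<rho> # \<Gamma>)"
  unfolding typed_sub_def by (auto simp: nth_Cons split: nat.split)

lemma typed_sub_Var: "typed_sub \<Gamma> Var \<Gamma>"
  unfolding typed_sub_def by (auto intro: typing.intros)

lemma typing_sub: "typing \<Gamma> t \<tau> \<Longrightarrow> typed_sub \<Gamma>' \<sigma> \<Gamma> \<Longrightarrow> typing \<Gamma>' (sub \<sigma> t) \<tau>"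
proof (induction arbitrary: \<Gamma>' \<sigma> rule: typing.induct)
  case (6 \<rho> \<Gamma> t \<tau>)
  show ?case using "6.IH"[OF typed_sub_up[OF "6.prems"]] by (simp add: typing.intros)
next
  case (5 \<Gamma> s \<rho> \<tau> t)
  show ?case using typing.intros(5)[OF "5.IH"(1)[OF "5.prems"] "5.IH"(2)[OF "5.prems"]] by simp
qed (auto intro: typing.intros simp: typed_sub_def)

lemma wff_sub: "wff \<Gamma> A \<Longrightarrow> typed_sub \<Gamma>' \<sigma> \<Gamma> \<Longrightarrow> wff \<Gamma>' (fsub \<sigma> A)"
  by (induction A arbitrary: \<Gamma> \<Gamma>' \<sigma>) (auto intro: typing_sub typed_sub_up)

lemma wff_append: "wff \<Gamma> A \<Longrightarrow> wff (\<Gamma> @ \<Theta>) A"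
  by (induction A arbitrary: \<Gamma>) (auto intro: typing_append simp flip: append_Cons)

text \<open>The inverse direction is forced by \<open>ExE\<close>: well-formedness of its conclusion
  \<open>C\<close> is known only through \<open>flift C\<close>.\<close>

lemma typing_ren_inv:
  "typing \<Gamma>' (ren \<xi> t) \<tau> \<Longrightarrow> (\<And>i. \<xi> i < length \<Gamma>' \<Longrightarrow> i < length \<Gamma> \<and> \<Gamma>' ! \<xi> i = \<Gamma> ! i)
    \<Longrightarrow> typing \<Gamma> t \<tau>"
proof (induction t arbitrary: \<Gamma>' \<Gamma> \<xi> \<tau>)
  case (Lam \<rho> t)
  from Lam.prems(1) obtain \<tau>' where \<tau>: "\<tau> = \<rho> \<Rrightarrow> \<tau>'"
    and t: "typing (\<rho> # \<Gamma>') (ren (case_nat 0 (Suc \<circ> \<xi>)) t) \<tau>'"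
    by (auto elim: typing_LamE)
  have "typing (\<rho> # \<Gamma>) t \<tau>'"
    by (rule Lam.IH[OF t]) (use Lam.prems in \<open>auto split: nat.splits\<close>)
  then show ?case by (simp add: \<tau> typing.intros)
next
  case (App t1 t2)
  then show ?case by (fastforce elim: typing_AppE intro: typing.intros)
qed (auto elim!: typing_VarE typing_ZeroE typing_SuccE typing_RecE intro: typing.intros typing_Var)

lemma wff_ren_inv:
  "wff \<Gamma>' (fsub (Var \<circ> \<xi>) A) \<Longrightarrow> (\<And>i. \<xi> i < length \<Gamma>' \<Longrightarrow> i < length \<Gamma> \<and> \<Gamma>' ! \<xi> i = \<Gamma> ! i)
    \<Longrightarrow> wff \<Gamma> A"
proof (induction A arbitrary: \<Gamma> \<Gamma>' \<xi>)
  case (All \<rho> A)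
  have "wff (\<rho> # \<Gamma>') (fsub (Var \<circ> case_nat 0 (Suc \<circ> \<xi>)) A)"
    using All.prems(1) by (simp only: fsub.simps wff.simps up_Var)
  then have "wff (\<rho> # \<Gamma>) A"
    by (rule All.IH) (use All.prems(2) in \<open>auto split: nat.splits\<close>)
  then show ?case by simp
next
  case (Ex \<rho> A)
  have "wff (\<rho> # \<Gamma>') (fsub (Var \<circ> case_nat 0 (Suc \<circ> \<xi>)) A)"
    using Ex.prems(1) by (simp only: fsub.simps wff.simps up_Var)
  then have "wff (\<rho> # \<Gamma>) A"
    by (rule Ex.IH) (use Ex.prems(2) in \<open>auto split: nat.splits\<close>)
  then show ?case by simp
next
  case (Eq \<rho> s t)
  then have "typing \<Gamma>' (ren \<xi> s) \<rho>" "typing \<Gamma>' (ren \<xi> t) \<rho>"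
    by (simp_all only: fsub.simps wff.simps ren_eq_sub)
  then show ?case using typing_ren_inv Eq.prems(2) by (metis wff.simps(1))
next
  case (And A B)
  show ?case using And.prems(1) And.IH[OF _ And.prems(2)] by simp
next
  case (Or A B)
  show ?case using Or.prems(1) Or.IH[OF _ Or.prems(2)] by simp
next
  case (Imp A B)
  show ?case using Imp.prems(1) Imp.IH[OF _ Imp.prems(2)] by simp
qed simp_all

lemma wff_flift_inv: "wff (\<rho> # \<Gamma>) (flift A) \<Longrightarrow> wff \<Gamma> A"
  unfolding flift_def by (erule wff_ren_inv) auto

lemma wff_inst0: "wff (\<rho> # \<Gamma>) A \<Longrightarrow> typing \<Gamma> t \<rho> \<Longrightarrow> wff \<Gamma> (inst 0 t A)"
  unfolding inst0 by (erule wff_sub) (auto intro: typed_sub_case typed_sub_Var)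

lemma typing_beta: "typing (\<rho> # \<Gamma>) s \<tau> \<Longrightarrow> typing \<Gamma> t \<rho> \<Longrightarrow> typing \<Gamma> (sub (case_nat t Var) s) \<tau>"
  by (erule typing_sub) (auto intro: typed_sub_case typed_sub_Var)

section \<open>Structural rules of the calculus\<close>

lemma HA_wff: "HA \<Gamma> \<Delta> A \<Longrightarrow> wff \<Gamma> A"
proof (induction rule: HA.induct)
  case (AllE \<Gamma> \<Delta> \<rho> A t)
  then show ?case by (auto intro: wff_inst0)
next
  case (ExE \<Gamma> \<Delta> \<rho> A C)
  then show ?case by (auto intro: wff_flift_inv)
next
  case (Repl \<rho> \<Gamma> A \<Delta> s t)
  then show ?case by (auto intro: wff_inst0)
next
  case (SuccInj \<Gamma> \<Delta> s t)
  then show ?case by (auto elim!: typing_AppE typing_SuccE)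
next
  case (RecSucc \<Gamma> s \<rho> t u \<Delta>)
  then have "typing \<Gamma> (Rec \<rho> \<cdot> s \<cdot> t \<cdot> u) \<rho>" "typing \<Gamma> (t \<cdot> u) (\<rho> \<Rrightarrow> \<rho>)"
      "typing \<Gamma> (Rec \<rho> \<cdot> s \<cdot> t \<cdot> (Succ \<cdot> u)) \<rho>"
    by (blast intro: typing.intros)+
  then show ?case by (auto intro: typing.intros(5))
qed (auto intro: typing.intros typing_beta)

lemma HA_weaken: "HA \<Gamma> \<Delta> A \<Longrightarrow> \<Delta> \<subseteq> \<Delta>' \<Longrightarrow> HA \<Gamma> \<Delta>' A"
proof (induction arbitrary: \<Delta>' rule: HA.induct)
  case (OrE \<Gamma> \<Delta> A B C)
  show ?case using HA.OrE OrE.IH(1)[OF OrE.prems] OrE.IH(2,3)[OF insert_mono[OF OrE.prems]] .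
next
  case (ImpI \<Gamma> A \<Delta> B)
  show ?case using HA.ImpI[OF ImpI.hyps(1) ImpI.IH[OF insert_mono[OF ImpI.prems]]] .
next
  case (ExE \<Gamma> \<Delta> \<rho> A C)
  show ?case using HA.ExE[OF ExE.IH(1)[OF ExE.prems] ExE.IH(2)[OF insert_mono[OF image_mono[OF ExE.prems]]]] .
next
  case (AllI \<rho> \<Gamma> \<Delta> A)
  show ?case by (rule HA.AllI) (use AllI.IH AllI.prems in \<open>simp add: image_mono\<close>)
next
  case (Ind \<Gamma> \<Delta> A)
  then show ?case by (simp add: HA.Ind)
next
  case (Repl \<rho> \<Gamma> A \<Delta> s t)
  show ?case by (rule HA.Repl[OF Repl.hyps(1)]) (use Repl in simp_all)
next
  case (AndE1 \<Gamma> \<Delta> A B)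
  then show ?case by (simp add: HA.AndE1[of _ _ "A" "B"])
next
  case (AndE2 \<Gamma> \<Delta> A B)
  then show ?case by (simp add: HA.AndE2[of _ _ "A" "B"])
next
  case (ImpE \<Gamma> \<Delta> A B)
  then show ?case by (simp add: HA.ImpE[of _ _ "A" "B"])
next
  case (BotE \<Gamma> \<Delta> A)
  then show ?case by (simp add: HA.BotE)
next
  case (SuccInj \<Gamma> \<Delta> s t)
  then show ?case by (simp add: HA.SuccInj)
next
  case (AllE \<Gamma> \<Delta> \<rho> A t)
  show ?case using HA.AllE[OF AllE.IH[OF AllE.prems] AllE.hyps(2)] .
next
  case (ExI \<rho> \<Gamma> A t \<Delta>)
  show ?case using HA.ExI[OF ExI.hyps(1,2) ExI.IH[OF ExI.prems]] .
next
  case (Ext \<Gamma> s \<rho> \<tau> t \<Delta>)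
  then show ?case by (simp add: HA.Ext)
qed (auto intro: HA.Hyp HA.AndI HA.OrI1 HA.OrI2 HA.Refl HA.Beta HA.RecZero HA.RecSucc HA.SuccNotZero)

text \<open>Serves three purposes below: moving derivations to longer contexts, rotating a fresh
  variable to the front, and instantiating an outer derivation inside a world.\<close>

lemma HA_sub:
  "HA \<Gamma> \<Delta> A \<Longrightarrow> typed_sub \<Gamma>' \<sigma> \<Gamma> \<Longrightarrow> HA \<Gamma>' (fsub \<sigma> ` \<Delta>) (fsub \<sigma> A)"
proof (induction arbitrary: \<Gamma>' \<sigma> rule: HA.induct)
  case (Hyp A \<Delta> \<Gamma>)
  then show ?case by (auto intro: HA.Hyp wff_sub)
next
  case (OrE \<Gamma> \<Delta> A B C)
  show ?case by (rule HA.OrE[of _ _ "fsub \<sigma> A" "fsub \<sigma> B"]) (use OrE in auto)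
next
  case (ImpI \<Gamma> A \<Delta> B)
  then show ?case by (auto intro!: HA.ImpI wff_sub)
next
  case (AllI \<rho> \<Gamma> \<Delta> A)
  have "fsub (up \<sigma>) ` flift ` \<Delta> = flift ` fsub \<sigma> ` \<Delta>"
    by (simp add: image_image fsub_flift)
  then show ?case using AllI.IH[OF typed_sub_up[OF AllI.prems]] by (auto intro: HA.AllI)
next
  case (AllE \<Gamma> \<Delta> \<rho> A t)
  then show ?case by (auto simp: fsub_inst0 intro: HA.AllE typing_sub)
next
  case (ExI \<rho> \<Gamma> A t \<Delta>)
  show ?case unfolding fsub.simps
    by (rule HA.ExI) (use ExI in \<open>auto simp: fsub_inst0 intro: typing_sub wff_sub typed_sub_up\<close>)
next
  case (ExE \<Gamma> \<Delta> \<rho> A C)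
  have "fsub (up \<sigma>) ` flift ` \<Delta> = flift ` fsub \<sigma> ` \<Delta>"
    by (simp add: image_image fsub_flift)
  then show ?case using ExE.IH(1)[OF ExE.prems] ExE.IH(2)[OF typed_sub_up[OF ExE.prems]]
    by (auto intro!: HA.ExE[of _ _ \<rho> "fsub (up \<sigma>) A"] simp: fsub_flift)
next
  case (Repl \<rho> \<Gamma> A \<Delta> s t)
  have "HA \<Gamma>' (fsub \<sigma> ` \<Delta>) (inst 0 (sub \<sigma> t) (fsub (up \<sigma>) A))"
    by (rule HA.Repl[of \<rho> _ _ _ "sub \<sigma> s"])
      (use Repl in \<open>auto simp: fsub_inst0[symmetric] intro: wff_sub typed_sub_up\<close>)
  then show ?case by (simp add: fsub_inst0)
next
  case (Ext \<Gamma> s \<rho> \<tau> t \<Delta>)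
  show ?case unfolding fsub.simps
    by (rule HA.Ext) (use Ext in \<open>auto intro: typing_sub simp: up_ren\<close>)
next
  case (Beta \<rho> \<Gamma> s \<tau> t \<Delta>)
  show ?case using HA.Beta[OF typing_sub[OF Beta.hyps(1) typed_sub_up[OF Beta.prems]] typing_sub[OF Beta.hyps(2) Beta.prems]]
    by (simp add: sub_beta)
next
  case (Ind \<Gamma> \<Delta> A)
  show ?case unfolding fsub.simps
    by (rule HA.Ind) (use Ind in \<open>auto simp: fsub_inst0 fsub_inst1[symmetric] simp del: One_nat_def\<close>)
next
  case (SuccInj \<Gamma> \<Delta> s t)
  then show ?case by (simp add: HA.SuccInj)
next
  case (AndE1 \<Gamma> \<Delta> A B)
  then show ?case by (simp add: HA.AndE1[of _ _ "fsub \<sigma> A" "fsub \<sigma> B"])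
next
  case (AndE2 \<Gamma> \<Delta> A B)
  then show ?case by (simp add: HA.AndE2[of _ _ "fsub \<sigma> A" "fsub \<sigma> B"])
next
  case (ImpE \<Gamma> \<Delta> A B)
  then show ?case by (simp add: HA.ImpE[of _ _ "fsub \<sigma> A" "fsub \<sigma> B"])
next
  case (BotE \<Gamma> \<Delta> A)
  then show ?case by (simp add: HA.BotE wff_sub)
qed (auto intro: HA.Hyp HA.AndI HA.OrI1 HA.OrI2 HA.Refl HA.Beta HA.RecZero HA.RecSucc HA.SuccNotZero typing_sub wff_sub)

lemma HA_cut: "HA \<Gamma> (insert A \<Delta>) B \<Longrightarrow> HA \<Gamma> \<Delta> A \<Longrightarrow> HA \<Gamma> \<Delta> B"
  using HA.ImpE HA.ImpI HA_wff by blast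

text \<open>Each cut discharges one hypothesis, whence finiteness; this is one source of the
  finiteness condition in \<open>forced\<close>.\<close>

lemma HA_cut_finite: "finite F \<Longrightarrow> HA \<Gamma> (F \<union> \<Delta>) B \<Longrightarrow> (\<And>A. A \<in> F \<Longrightarrow> HA \<Gamma> \<Delta> A) \<Longrightarrow> HA \<Gamma> \<Delta> B"
proof (induction arbitrary: B rule: finite_induct)
  case (insert A F)
  have "HA \<Gamma> (F \<union> \<Delta>) A" using insert.prems(2)[of A] HA_weaken by blast
  then have "HA \<Gamma> (F \<union> \<Delta>) B" using insert.prems(1) HA_cut by auto
  then show ?case using insert by auto
qed auto

text \<open>Moves the last variable of a context of length \<open>k + 1\<close> to the front. This turns a fresh variable
  at the end of the context into one that the quantifier rules can bind.\<close>

definition rot :: "nat \<Rightarrow> nat \<Rightarrow> tm" where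
  "rot k i = (if i < k then Var (Suc i) else Var 0)"

lemma typed_sub_rot: "typed_sub (\<rho> # \<Gamma>) (rot (length \<Gamma>)) (\<Gamma> @ [\<rho>])"
  unfolding typed_sub_def rot_def by (auto simp: nth_append intro!: typing_Var)

lemma rot_flift: "wff \<Gamma> A \<Longrightarrow> fsub (rot (length \<Gamma>)) A = flift A"
  unfolding flift_def by (rule fsub_cong) (auto simp: rot_def)

lemma rot_inst: "wff (\<rho> # \<Gamma>) A \<Longrightarrow> fsub (rot (length \<Gamma>)) (inst 0 (Var (length \<Gamma>)) A) = A"
  unfolding inst0 fsub_fsub by (rule fsub_id) (auto simp: rot_def split: nat.split)

lemma HA_generalize:
  assumes "\<And>D. D \<in> \<Delta> \<Longrightarrow> wff \<Gamma> D" "wff (\<rho> # \<Gamma>) A"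
    and "HA (\<Gamma> @ [\<rho>]) \<Delta> (inst 0 (Var (length \<Gamma>)) A)"
  shows "HA \<Gamma> \<Delta> (All \<rho> A)"
proof -
  have "fsub (rot (length \<Gamma>)) ` \<Delta> = flift ` \<Delta>"
    using assms(1) rot_flift by (auto intro!: image_cong)
  then show ?thesis using HA_sub[OF assms(3) typed_sub_rot] assms(2)
    by (auto simp: rot_inst intro: HA.AllI)
qed

lemma HA_ExE_fresh:
  assumes "\<And>D. D \<in> \<Delta> \<Longrightarrow> wff \<Gamma> D" "HA \<Gamma> \<Delta> (Ex \<rho> A)" "wff \<Gamma> C"
    and "HA (\<Gamma> @ [\<rho>]) (insert (inst 0 (Var (length \<Gamma>)) A) \<Delta>) C"
  shows "HA \<Gamma> \<Delta> C"
proof -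
  have A: "wff (\<rho> # \<Gamma>) A" using HA_wff[OF assms(2)] by simp
  have "fsub (rot (length \<Gamma>)) ` \<Delta> = flift ` \<Delta>"
    using assms(1) rot_flift by (auto intro!: image_cong)
  then have "HA (\<rho> # \<Gamma>) (insert A (flift ` \<Delta>)) (flift C)"
    using HA_sub[OF assms(4) typed_sub_rot] assms(3) A by (simp add: rot_inst rot_flift)
  then show ?thesis using assms(2) HA.ExE by blast
qed

section \<open>Derivability as truth at worlds\<close>

text \<open>Contexts grow at their end, so that a term of a world is literally a term of every later world.\<close>

datatype world = World (ctx: "ty list") (hyps: "fm set")

definition valid :: "world \<Rightarrow> bool" where
  "valid w \<longleftrightarrow> (\<forall>D \<in> hyps w. wff (ctx w) D)"

definition wle :: "world \<Rightarrow> world \<Rightarrow> bool" (infix "\<sqsubseteq>" 50) where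
  "w \<sqsubseteq> w' \<longleftrightarrow> valid w \<and> valid w' \<and> (\<exists>\<Theta>. ctx w' = ctx w @ \<Theta>) \<and> hyps w \<subseteq> hyps w'"

abbreviation prv :: "world \<Rightarrow> fm \<Rightarrow> bool" where
  "prv w \<equiv> HA (ctx w) (hyps w)"

abbreviation tmw :: "world \<Rightarrow> ty \<Rightarrow> tm \<Rightarrow> bool" where
  "tmw w \<rho> t \<equiv> typing (ctx w) t \<rho>"

abbreviation eqv :: "world \<Rightarrow> ty \<Rightarrow> tm \<Rightarrow> tm \<Rightarrow> bool" where
  "eqv w \<rho> s t \<equiv> prv w (Eq \<rho> s t)"

lemma wle_refl: "valid w \<Longrightarrow> w \<sqsubseteq> w"
  by (auto simp: wle_def)

lemma wle_trans: "w \<sqsubseteq> w' \<Longrightarrow> w' \<sqsubseteq> w'' \<Longrightarrow> w \<sqsubseteq> w''"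
  by (fastforce simp: wle_def)

lemma wle_valid: "w \<sqsubseteq> w' \<Longrightarrow> valid w" "w \<sqsubseteq> w' \<Longrightarrow> valid w'"
  by (auto simp: wle_def)

lemma tmw_mono: "w \<sqsubseteq> w' \<Longrightarrow> tmw w \<rho> t \<Longrightarrow> tmw w' \<rho> t"
  by (auto simp: wle_def typing_append)

lemma typed_sub_mono: "w \<sqsubseteq> w' \<Longrightarrow> typed_sub (ctx w) \<sigma> \<Gamma> \<Longrightarrow> typed_sub (ctx w') \<sigma> \<Gamma>"
  by (auto simp: typed_sub_def tmw_mono)

lemma typed_sub_extend: "typed_sub (\<Gamma> @ \<Theta>) Var \<Gamma>"
  by (auto simp: typed_sub_def nth_append intro!: typing_Var)

lemma prv_mono: "w \<sqsubseteq> w' \<Longrightarrow> prv w A \<Longrightarrow> prv w' A"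
  using HA_weaken HA_sub[OF _ typed_sub_extend] by (fastforce simp: wle_def)

lemma prv_wff: "prv w A \<Longrightarrow> wff (ctx w) A"
  by (rule HA_wff)

lemma wle_insert: "valid w \<Longrightarrow> wff (ctx w) A \<Longrightarrow> w \<sqsubseteq> World (ctx w) (insert A (hyps w))"
  by (auto simp: wle_def valid_def)

lemma wle_fresh: "valid w \<Longrightarrow> w \<sqsubseteq> World (ctx w @ [\<rho>]) (hyps w)"
  by (auto simp: wle_def valid_def wff_append)

lemma tmw_fresh: "tmw (World (ctx w @ [\<rho>]) D) \<rho> (Var (length (ctx w)))"
  by (auto intro!: typing_Var)

text \<open>The world with \<open>A\<close> adjoined is itself an extension, so testing the premise
  there suffices. With the analogous lemmas for the other connectives, derivability is used like
  truth in a Kripke model.\<close>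

lemma prv_ImpI:
  assumes "valid w" "wff (ctx w) A" "\<And>w'. w \<sqsubseteq> w' \<Longrightarrow> prv w' A \<Longrightarrow> prv w' B"
  shows "prv w (A \<^bold>\<longrightarrow> B)"
  using assms(3)[OF wle_insert[OF assms(1,2)]] assms(2) by (auto intro: HA.ImpI HA.Hyp)

text \<open>A fresh variable at the end of the context plays the arbitrary argument.\<close>

lemma prv_AllI:
  assumes "valid w" "wff (\<rho> # ctx w) A" "\<And>w' t. w \<sqsubseteq> w' \<Longrightarrow> tmw w' \<rho> t \<Longrightarrow> prv w' (inst 0 t A)"
  shows "prv w (All \<rho> A)"
  using assms(3)[OF wle_fresh tmw_fresh] assms(1,2) by (auto intro: HA_generalize simp: valid_def)

lemma prv_AllE: "prv w (All \<rho> A) \<Longrightarrow> w \<sqsubseteq> w' \<Longrightarrow> tmw w' \<rho> t \<Longrightarrow> prv w' (inst 0 t A)"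
  using prv_mono HA.AllE by blast

lemma prv_OrE:
  assumes "valid w" "prv w (A \<^bold>\<or> B)"
    and "\<And>w'. w \<sqsubseteq> w' \<Longrightarrow> prv w' A \<Longrightarrow> prv w' C" "\<And>w'. w \<sqsubseteq> w' \<Longrightarrow> prv w' B \<Longrightarrow> prv w' C"
  shows "prv w C"
proof -
  have "wff (ctx w) A" "wff (ctx w) B" using prv_wff[OF assms(2)] by auto
  then show ?thesis
    using assms(3)[OF wle_insert] assms(4)[OF wle_insert] assms(1) HA.OrE[OF assms(2)]
    by (auto intro: HA.Hyp)
qed

lemma prv_ExE:
  assumes "valid w" "prv w (Ex \<rho> A)" "wff (ctx w) C"
    and "\<And>w' t. w \<sqsubseteq> w' \<Longrightarrow> tmw w' \<rho> t \<Longrightarrow> prv w' (inst 0 t A) \<Longrightarrow> prv w' C"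
  shows "prv w C"
proof -
  \<comment> \<open>The witness variable and the hypothesis about it are adjoined in two stages.
    Since \<open>C\<close> is well formed already in \<open>w\<close>, both can be discharged
    afterwards.\<close>
  define v where "v = World (ctx w @ [\<rho>]) (hyps w)"
  define a where "a = inst 0 (Var (length (ctx w))) A"
  have v: "w \<sqsubseteq> v" using assms(1) by (simp add: v_def wle_fresh)
  have x: "tmw v \<rho> (Var (length (ctx w)))" unfolding v_def by (rule tmw_fresh)
  have "wff (\<rho> # ctx w) A" using prv_wff[OF assms(2)] by simp
  then have "wff (\<rho> # ctx v) A" unfolding v_def using wff_append[of "\<rho> # ctx w" A "[\<rho>]"] by simp
  then have a: "wff (ctx v) a" unfolding a_def using x by (rule wff_inst0)
  define u where "u = World (ctx v) (insert a (hyps v))"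
  have u: "v \<sqsubseteq> u" unfolding u_def using a v by (simp add: wle_insert wle_valid)
  have "prv u C"
  proof (rule assms(4))
    show "w \<sqsubseteq> u" using u v wle_trans by blast
    show "tmw u \<rho> (Var (length (ctx w)))" using u x tmw_mono by blast
    show "prv u (inst 0 (Var (length (ctx w))) A)"
      using a unfolding u_def a_def by (auto intro: HA.Hyp)
  qed
  then show ?thesis
    using assms(1) unfolding u_def v_def a_def
    by (auto intro: HA_ExE_fresh[OF _ assms(2,3)] simp: valid_def)
qed

lemma inst_Succ: "inst 0 m (inst 1 (Succ \<cdot> Var 0) A) = inst 0 (Succ \<cdot> m) A"
proof -
  have "sub (case_nat m Var) \<circ> case_nat (Succ \<cdot> Var 0) (\<lambda>i. Var (i + 1)) = case_nat (Succ \<cdot> m) Var"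
    by (auto simp: fun_eq_iff split: nat.split)
  then show ?thesis by (simp only: inst0 fsub_fsub) (simp add: inst_def fsub_fsub)
qed

lemma inst0_simps [simp]:
  "inst 0 t (A \<^bold>\<longrightarrow> B) = (inst 0 t A \<^bold>\<longrightarrow> inst 0 t B)"
  "inst 0 t (Eq \<rho> a b) = Eq \<rho> (sub (case_nat t Var) a) (sub (case_nat t Var) b)"
  by (simp_all add: inst0)

lemma prv_Ind:
  assumes "valid w" "wff (Nat # ctx w) A" "prv w (inst 0 Zero A)"
    and "\<And>w' m. w \<sqsubseteq> w' \<Longrightarrow> tmw w' Nat m \<Longrightarrow> prv w' (inst 0 m A) \<Longrightarrow> prv w' (inst 0 (Succ \<cdot> m) A)"
  shows "prv w (All Nat A)"
proof (rule HA.Ind[OF assms(3)], rule prv_AllI[OF assms(1)])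
  have "wff (Nat # ctx w) (inst 1 (Succ \<cdot> Var 0) A)" unfolding inst_def
    by (rule wff_sub[OF assms(2)])
      (auto simp: typed_sub_def nth_Cons split: nat.split intro!: typing.intros(5)[OF typing.intros(3)] typing_Var)
  then show "wff (Nat # ctx w) (A \<^bold>\<longrightarrow> inst 1 (Succ \<cdot> Var 0) A)" using assms(2) by simp
next
  fix w' m assume w': "w \<sqsubseteq> w'" and m: "tmw w' Nat m"
  have "wff (Nat # ctx w') A" using w' assms(2) wff_append[of "Nat # ctx w" A] by (auto simp: wle_def)
  then have "prv w' (inst 0 m A \<^bold>\<longrightarrow> inst 0 (Succ \<cdot> m) A)"
    using w' m by (intro prv_ImpI) (auto simp: wle_valid intro: wff_inst0 assms(4) wle_trans tmw_mono)
  then show "prv w' (inst 0 m (A \<^bold>\<longrightarrow> inst 1 (Succ \<cdot> Var 0) A))" by (simp only: inst0_simps inst_Succ)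
qed

section \<open>Provable equality as a congruence\<close>

lemma sub_case_ren [simp]: "sub (case_nat t \<sigma>) (ren Suc s) = sub \<sigma> s"
  by (simp add: sub_ren comp_def)

lemma eqv_typed: "eqv w \<rho> s t \<Longrightarrow> tmw w \<rho> s" "eqv w \<rho> s t \<Longrightarrow> tmw w \<rho> t"
  using prv_wff by fastforce+

lemma typing_Var0: "typing (\<rho> # \<Gamma>) (Var 0) \<rho>"
  by (rule typing_Var) simp_all

lemma eqv_sym:
  assumes "eqv w \<rho> s t"
  shows "eqv w \<rho> t s"
proof -
  note ty = eqv_typed[OF assms]
  have "wff (\<rho> # ctx w) (Eq \<rho> (Var 0) (ren Suc s))"
    using ty by (simp add: typing_ren_Suc typing_Var0)
  from HA.Repl[OF this assms] show ?thesis using ty by (simp add: HA.Refl)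
qed

lemma eqv_trans [trans]:
  assumes "eqv w \<rho> s t" "eqv w \<rho> t u"
  shows "eqv w \<rho> s u"
proof -
  have "wff (\<rho> # ctx w) (Eq \<rho> (ren Suc s) (Var 0))"
    using eqv_typed[OF assms(1)] by (simp add: typing_ren_Suc typing_Var0)
  from HA.Repl[OF this assms(2)] show ?thesis using assms(1) by simp
qed

lemma eqv_App: 
  assumes "eqv w (\<rho> \<Rrightarrow> \<tau>) f g" "eqv w \<rho> x y"
  shows "eqv w \<tau> (f \<cdot> x) (g \<cdot> y)"
proof -
  note ty = eqv_typed[OF assms(1)] eqv_typed[OF assms(2)]
  have "eqv w \<tau> (f \<cdot> x) (g \<cdot> x)"
    using HA.Repl[OF _ assms(1), of "Eq \<tau> (ren Suc (f \<cdot> x)) (Var 0 \<cdot> ren Suc x)"] ty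
    by (fastforce intro: HA.Refl typing.intros(5) typing_ren_Suc typing_Var)
  moreover have "eqv w \<tau> (g \<cdot> x) (g \<cdot> y)"
    using HA.Repl[OF _ assms(2), of "Eq \<tau> (ren Suc (g \<cdot> x)) (ren Suc g \<cdot> Var 0)"] ty
    by (fastforce intro: HA.Refl typing.intros(5) typing_ren_Suc typing_Var)
  ultimately show ?thesis by (rule eqv_trans)
qed

lemma eqv_ext:
  assumes "valid w" "tmw w (\<rho> \<Rrightarrow> \<tau>) s" "tmw w (\<rho> \<Rrightarrow> \<tau>) t"
    and "\<And>w' a. w \<sqsubseteq> w' \<Longrightarrow> tmw w' \<rho> a \<Longrightarrow> eqv w' \<tau> (s \<cdot> a) (t \<cdot> a)"
  shows "eqv w (\<rho> \<Rrightarrow> \<tau>) s t"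
proof (rule HA.Ext[OF assms(2,3)], rule prv_AllI[OF assms(1)])
  have "typing (\<rho> # ctx w) (ren Suc s \<cdot> Var 0) \<tau>" "typing (\<rho> # ctx w) (ren Suc t \<cdot> Var 0) \<tau>"
    using assms(2,3) by (blast intro: typing.intros(5) typing_ren_Suc typing_Var0)+
  then show "wff (\<rho> # ctx w) (Eq \<tau> (ren Suc s \<cdot> Var 0) (ren Suc t \<cdot> Var 0))" by simp
qed (simp add: assms(4))

abbreviation env :: "tm list \<Rightarrow> nat \<Rightarrow> tm" where
  "env \<equiv> senv 0"

lemma eqv_Lam:
  assumes "typing (\<rho> # \<Gamma>) s \<tau>" "typed_sub (ctx w) \<sigma> \<Gamma>" "tmw w \<rho> t"
  shows "eqv w \<tau> (sub \<sigma> (Lam \<rho> s) \<cdot> t) (sub (case_nat t \<sigma>) s)"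
  using HA.Beta[OF typing_sub[OF assms(1) typed_sub_up[OF assms(2)]] assms(3)]
  by (simp add: sub_sub sub_case_up)

text \<open>Under \<open>Lam\<close> it is extensionality that gives the congruence: bodies are
  compared at an arbitrary argument of a later world, so the induction hypothesis must hold for all
  worlds.\<close>

lemma sub_eqv:
  "typing \<Gamma> t \<rho> \<Longrightarrow> valid w \<Longrightarrow> \<forall>i < length \<Gamma>. eqv w (\<Gamma> ! i) (\<sigma> i) (\<tau> i)
    \<Longrightarrow> eqv w \<rho> (sub \<sigma> t) (sub \<tau> t)"
proof (induction arbitrary: w \<sigma> \<tau> rule: typing.induct)
  case (5 \<Gamma> s \<rho> \<tau>' t)
  show ?case using eqv_App[OF "5.IH"(1)[OF "5.prems"] "5.IH"(2)[OF "5.prems"]] by simp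
next
  case (6 \<rho> \<Gamma> t \<tau>')
  have ts: "typed_sub (ctx w) \<sigma> \<Gamma>" "typed_sub (ctx w) \<tau> \<Gamma>"
    using "6.prems" eqv_typed unfolding typed_sub_def by blast+
  show ?case
  proof (rule eqv_ext[OF "6.prems"(1)])
    show "tmw w (\<rho> \<Rrightarrow> \<tau>') (sub \<sigma> (Lam \<rho> t))" "tmw w (\<rho> \<Rrightarrow> \<tau>') (sub \<tau> (Lam \<rho> t))"
      using ts "6.hyps" by (blast intro: typing_sub typing.intros)+
  next
    fix w' a assume w': "w \<sqsubseteq> w'" and a: "tmw w' \<rho> a"
    note ts' = typed_sub_mono[OF w' ts(1)] typed_sub_mono[OF w' ts(2)]
    have "eqv w' \<tau>' (sub (case_nat a \<sigma>) t) (sub (case_nat a \<tau>) t)"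
      by (rule "6.IH") (use w' a "6.prems" in
        \<open>auto simp: nth_Cons wle_valid intro: HA.Refl prv_mono split: nat.split\<close>)
    then show "eqv w' \<tau>' (sub \<sigma> (Lam \<rho> t) \<cdot> a) (sub \<tau> (Lam \<rho> t) \<cdot> a)"
      using eqv_Lam[OF "6.hyps" ts'(1) a] eqv_Lam[OF "6.hyps" ts'(2) a] eqv_sym eqv_trans by blast
  qed
qed (auto intro: HA.Refl typing.intros)

lemma prv_fsub_AllD:
  "prv w (All \<rho> (fsub (up \<sigma>) A)) \<Longrightarrow> w \<sqsubseteq> w' \<Longrightarrow> tmw w' \<rho> t \<Longrightarrow> prv w' (fsub (case_nat t \<sigma>) A)"
  using prv_AllE[of w \<rho> "fsub (up \<sigma>) A"] by (simp add: inst0_up)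

lemma prv_fsub_AllI:
  assumes "valid w" "wff (\<rho> # \<Gamma>) A" "typed_sub (ctx w) \<sigma> \<Gamma>"
    and "\<And>w' t. w \<sqsubseteq> w' \<Longrightarrow> tmw w' \<rho> t \<Longrightarrow> prv w' (fsub (case_nat t \<sigma>) A)"
  shows "prv w (All \<rho> (fsub (up \<sigma>) A))"
  using assms by (intro prv_AllI) (auto simp: inst0_up intro: wff_sub typed_sub_up)

text \<open>Replacement for a whole environment at once, where \<open>Repl\<close> treats a single
  variable. In the case of implication the equations are used backwards for the premise.\<close>

lemma fsub_eqv:
  "wff \<Gamma> A \<Longrightarrow> valid w \<Longrightarrow> \<forall>i < length \<Gamma>. eqv w (\<Gamma> ! i) (\<sigma> i) (\<tau> i)
    \<Longrightarrow> prv w (fsub \<sigma> A) \<Longrightarrow> prv w (fsub \<tau> A)"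
proof (induction A arbitrary: \<Gamma> w \<sigma> \<tau>)
  case (Eq \<rho> s t)
  then have "eqv w \<rho> (sub \<sigma> s) (sub \<tau> s)" "eqv w \<rho> (sub \<sigma> t) (sub \<tau> t)"
    by (auto intro: sub_eqv)
  then show ?case using Eq.prems(4) eqv_sym eqv_trans unfolding fsub.simps by blast
next
  case (And A B)
  have "prv w (fsub \<sigma> A)" "prv w (fsub \<sigma> B)"
    using HA.AndE1[OF And.prems(4)[unfolded fsub.simps]] HA.AndE2[OF And.prems(4)[unfolded fsub.simps]] .
  then show ?case using And.prems(1) And.IH[OF _ And.prems(2,3)] by (simp add: HA.AndI)
next
  case (Or A B)
  have ts: "typed_sub (ctx w) \<tau> \<Gamma>" using Or.prems eqv_typed unfolding typed_sub_def by blast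
  have AB: "wff \<Gamma> A" "wff \<Gamma> B" using Or.prems by auto
  show ?case unfolding fsub.simps
  proof (rule prv_OrE[OF Or.prems(2) Or.prems(4)[unfolded fsub.simps]])
    fix w' assume w': "w \<sqsubseteq> w'"
    note * = wle_valid(2)[OF w'] typed_sub_mono[OF w' ts]
    have e: "\<forall>i < length \<Gamma>. eqv w' (\<Gamma> ! i) (\<sigma> i) (\<tau> i)" using Or.prems(3) prv_mono[OF w'] by blast
    show "prv w' (fsub \<tau> A \<^bold>\<or> fsub \<tau> B)" if "prv w' (fsub \<sigma> A)"
      using Or.IH(1)[OF AB(1) *(1) e that] AB * by (auto intro: HA.OrI1 wff_sub)
    show "prv w' (fsub \<tau> A \<^bold>\<or> fsub \<tau> B)" if "prv w' (fsub \<sigma> B)"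
      using Or.IH(2)[OF AB(2) *(1) e that] AB * by (auto intro: HA.OrI2 wff_sub)
  qed
next
  case (Imp A B)
  have ts: "typed_sub (ctx w) \<tau> \<Gamma>" using Imp.prems eqv_typed unfolding typed_sub_def by blast
  have AB: "wff \<Gamma> A" "wff \<Gamma> B" using Imp.prems by auto
  show ?case unfolding fsub.simps
  proof (rule prv_ImpI[OF Imp.prems(2) wff_sub[OF AB(1) ts]])
    fix w' assume w': "w \<sqsubseteq> w'" and A: "prv w' (fsub \<tau> A)"
    have e: "\<forall>i < length \<Gamma>. eqv w' (\<Gamma> ! i) (\<sigma> i) (\<tau> i)" using Imp.prems(3) prv_mono[OF w'] by blast
    have "prv w' (fsub \<sigma> A)"
      using Imp.IH(1)[OF AB(1) wle_valid(2)[OF w'] _ A] e eqv_sym by blast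
    then have "prv w' (fsub \<sigma> B)"
      using HA.ImpE[OF prv_mono[OF w' Imp.prems(4), unfolded fsub.simps]] by blast
    then show "prv w' (fsub \<tau> B)" using Imp.IH(2)[OF AB(2) wle_valid(2)[OF w'] e] by blast
  qed
next
  case (All \<rho> A)
  have ts: "typed_sub (ctx w) \<tau> \<Gamma>" using All.prems eqv_typed unfolding typed_sub_def by blast
  have A: "wff (\<rho> # \<Gamma>) A" using All.prems by simp
  show ?case unfolding fsub.simps
  proof (rule prv_fsub_AllI[OF All.prems(2) A ts])
    fix w' t assume w': "w \<sqsubseteq> w'" and t: "tmw w' \<rho> t"
    have e: "\<forall>i < length (\<rho> # \<Gamma>). eqv w' ((\<rho> # \<Gamma>) ! i) (case_nat t \<sigma> i) (case_nat t \<tau> i)"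
      using All.prems(3) prv_mono[OF w'] t by (auto simp: nth_Cons intro: HA.Refl split: nat.split)
    show "prv w' (fsub (case_nat t \<tau>) A)"
      using All.IH[OF A wle_valid(2)[OF w'] e] prv_fsub_AllD All.prems(4) w' t by simp
  qed
next
  case (Ex \<rho> A)
  have ts: "typed_sub (ctx w) \<tau> \<Gamma>" using Ex.prems eqv_typed unfolding typed_sub_def by blast
  have A: "wff (\<rho> # \<Gamma>) A" using Ex.prems by simp
  have wf: "wff (\<rho> # ctx w') (fsub (up \<tau>) A)" if "w \<sqsubseteq> w'" for w'
    using A typed_sub_mono[OF that ts] by (auto intro: wff_sub typed_sub_up)
  show ?case unfolding fsub.simps
  proof (rule prv_ExE[OF Ex.prems(2) Ex.prems(4)[unfolded fsub.simps]])
    show "wff (ctx w) (Ex \<rho> (fsub (up \<tau>) A))" using wf wle_refl Ex.prems(2) by simp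
    fix w' t assume w': "w \<sqsubseteq> w'" and t: "tmw w' \<rho> t" and "prv w' (inst 0 t (fsub (up \<sigma>) A))"
    then have *: "prv w' (fsub (case_nat t \<sigma>) A)" by (simp add: inst0_up)
    have e: "\<forall>i < length (\<rho> # \<Gamma>). eqv w' ((\<rho> # \<Gamma>) ! i) (case_nat t \<sigma> i) (case_nat t \<tau> i)"
      using Ex.prems(3) prv_mono[OF w'] t by (auto simp: nth_Cons intro: HA.Refl split: nat.split)
    show "prv w' (Ex \<rho> (fsub (up \<tau>) A))"
      by (rule HA.ExI[OF wf[OF w'] t]) (use Ex.IH[OF A wle_valid(2)[OF w'] e *] in \<open>simp add: inst0_up\<close>)
  qed
qed simp

lemma prv_Bot: "prv w Bot \<Longrightarrow> wff (ctx w) A \<Longrightarrow> prv w A"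
  by (rule HA.BotE)

lemma prv_transfer:
  assumes "HA \<Gamma> \<Delta> A" "finite \<Delta>" "typed_sub (ctx w) \<sigma> \<Gamma>" "\<And>D. D \<in> \<Delta> \<Longrightarrow> prv w (fsub \<sigma> D)"
  shows "prv w (fsub \<sigma> A)"
proof (rule HA_cut_finite[of "fsub \<sigma> ` \<Delta>"])
  show "HA (ctx w) (fsub \<sigma> ` \<Delta> \<union> hyps w) (fsub \<sigma> A)"
    using HA_sub[OF assms(1,3)] HA_weaken by blast
qed (use assms in auto)

lemma sub_closed: "typing [] t \<rho> \<Longrightarrow> sub \<sigma> t = t"
  using sub_cong[of "[]" t \<rho> \<sigma> Var] by simp

lemma typing_closed: "typing [] t \<rho> \<Longrightarrow> typing \<Gamma> t \<rho>"
  using typing_append[of "[]" t \<rho> \<Gamma>] by simp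

section \<open>Sequences, environments and satisfaction at a world\<close>

abbreviation BT :: ty where
  "BT \<equiv> Nat \<Rrightarrow> Nat"

lemma typing_add: "typing [] add_tm (Nat \<Rrightarrow> Nat \<Rrightarrow> Nat)"
  unfolding add_tm_def by (rule typing.intros typing_Var | simp)+

lemma sub_add [simp]: "sub \<sigma> add_tm = add_tm"
  using typing_add by (rule sub_closed)

abbreviation sat :: "world \<Rightarrow> tm list \<Rightarrow> fm \<Rightarrow> bool" where
  "sat w ts A \<equiv> prv w (fsub (env ts) A)"

abbreviation tms :: "world \<Rightarrow> tm list \<Rightarrow> ty list \<Rightarrow> bool" where
  "tms w ts \<Theta> \<equiv> list_all2 (typing (ctx w)) ts \<Theta>"

lemma tms_mono: "w \<sqsubseteq> w' \<Longrightarrow> tms w ts \<Theta> \<Longrightarrow> tms w' ts \<Theta>"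
  by (auto elim!: list_all2_mono tmw_mono)

lemma typed_sub_senv:
  "length \<Psi> = k \<Longrightarrow> list_all2 (typing (\<Psi> @ \<Gamma>)) ss \<Xi> \<Longrightarrow> typed_sub (\<Psi> @ \<Gamma>) (senv k ss) (\<Xi> @ \<Gamma>)"
  by (auto simp: typed_sub_def senv_def nth_append list_all2_conv_all_nth intro!: typing_Var)

lemma senv_reindex:
  "sub (env (xs @ ts)) \<circ> senv (length xs) ss = env (map (sub (env (xs @ ts))) ss @ ts)"
proof
  fix i
  have "i - length ss + length xs - length xs = i - length ss" by simp
  then show "(sub (env (xs @ ts)) \<circ> senv (length xs) ss) i = env (map (sub (env (xs @ ts))) ss @ ts) i"
    by (auto simp: senv_def nth_append)
qed

text \<open>Reordering or dropping variables of a formula is always written with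
  \<open>senv k ss\<close>. In an environment beginning with the \<open>k\<close> entries
  \<open>xs\<close> it amounts to the original formula at the values \<open>ys\<close> of
  \<open>ss\<close>.\<close>

lemma fsub_reindex:
  "length xs = k \<Longrightarrow> map (sub (env (xs @ ts))) ss = ys
    \<Longrightarrow> fsub (env (xs @ ts)) (fsub (senv k ss) A) = fsub (env (ys @ ts)) A"
  using senv_reindex[of xs ts ss] by (simp add: fsub_fsub)

lemma sub_env_ren: "length xs = k \<Longrightarrow> sub (env (xs @ ts)) (ren (\<lambda>i. i + k) s) = sub (env ts) s"
proof -
  assume "length xs = k"
  then have "env (xs @ ts) \<circ> (\<lambda>i. i + k) = env ts"
    by (auto simp: senv_def fun_eq_iff nth_append)
  then show ?thesis by (simp add: sub_ren)
qed

section \<open>Formulas with parameters at a world\<close>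

text \<open>Everything happens above a base world. Its context holds the parameters of
  \<open>Q\<close>, and its hypotheses will consist of the premise of the implication to be
  derived.\<close>

locale bar =
  fixes w0 :: world and Q :: fm
  assumes w0: "valid w0" and Q: "wff (Nat # ctx w0) Q"
begin

abbreviation wf :: "ty list \<Rightarrow> fm \<Rightarrow> bool" where
  "wf \<Theta> A \<equiv> wff (\<Theta> @ ctx w0) A"

text \<open>Beyond \<open>ts\<close> the environment sends the parameters to themselves: since
  contexts grow at the end, \<open>Var i\<close> of \<open>w0\<close> is still \<open>Var i\<close>
  in \<open>w\<close>.\<close>

lemma typed_env:
  assumes "w0 \<sqsubseteq> w" "tms w ts \<Theta>"
  shows "typed_sub (ctx w) (env ts) (\<Theta> @ ctx w0)"
proof -
  obtain \<Psi> where \<Psi>: "ctx w = ctx w0 @ \<Psi>" using assms(1) by (auto simp: wle_def)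
  show ?thesis unfolding typed_sub_def
  proof (intro allI impI)
    fix i assume i: "i < length (\<Theta> @ ctx w0)"
    show "tmw w ((\<Theta> @ ctx w0) ! i) (env ts i)"
      using i assms(2) by (auto simp: senv_def nth_append list_all2_conv_all_nth \<Psi> intro!: typing_Var)
  qed
qed

lemma wff_env: "w0 \<sqsubseteq> w \<Longrightarrow> tms w ts \<Theta> \<Longrightarrow> wf \<Theta> A \<Longrightarrow> wff (ctx w) (fsub (env ts) A)"
  using wff_sub typed_env by blast

lemma sat_And: "sat w ts (A \<^bold>\<and> B) \<longleftrightarrow> sat w ts A \<and> sat w ts B"
  unfolding fsub.simps using HA.AndE1 HA.AndE2 HA.AndI by blast

lemma sat_Imp:
  assumes "w0 \<sqsubseteq> w" "tms w ts \<Theta>" "wf \<Theta> A"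
  shows "sat w ts (A \<^bold>\<longrightarrow> B) \<longleftrightarrow> (\<forall>w'. w \<sqsubseteq> w' \<longrightarrow> sat w' ts A \<longrightarrow> sat w' ts B)"
proof
  assume "sat w ts (A \<^bold>\<longrightarrow> B)"
  then show "\<forall>w'. w \<sqsubseteq> w' \<longrightarrow> sat w' ts A \<longrightarrow> sat w' ts B"
    using prv_mono HA.ImpE unfolding fsub.simps by blast
next
  assume "\<forall>w'. w \<sqsubseteq> w' \<longrightarrow> sat w' ts A \<longrightarrow> sat w' ts B"
  then show "sat w ts (A \<^bold>\<longrightarrow> B)"
    using wff_env[OF assms] assms(1) wle_valid unfolding fsub.simps by (intro prv_ImpI) auto
qed

lemma sat_All:
  assumes "w0 \<sqsubseteq> w" "tms w ts \<Theta>" "wf (\<rho> # \<Theta>) A"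
  shows "sat w ts (All \<rho> A) \<longleftrightarrow> (\<forall>w' t. w \<sqsubseteq> w' \<longrightarrow> tmw w' \<rho> t \<longrightarrow> sat w' (t # ts) A)"
proof
  assume "sat w ts (All \<rho> A)"
  then show "\<forall>w' t. w \<sqsubseteq> w' \<longrightarrow> tmw w' \<rho> t \<longrightarrow> sat w' (t # ts) A"
    unfolding fsub.simps senv_Cons[symmetric] by (intro allI impI) (rule prv_fsub_AllD)
next
  assume "\<forall>w' t. w \<sqsubseteq> w' \<longrightarrow> tmw w' \<rho> t \<longrightarrow> sat w' (t # ts) A"
  then show "sat w ts (All \<rho> A)" unfolding fsub.simps
    using assms(3) wle_valid(2)[OF assms(1)] typed_env[OF assms(1,2)]
    by (intro prv_fsub_AllI[where \<Gamma> = "\<Theta> @ ctx w0"]) (auto simp: senv_Cons)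
qed

lemma sat_ExI:
  assumes "w0 \<sqsubseteq> w" "tms w ts \<Theta>" "wf (\<rho> # \<Theta>) A" "tmw w \<rho> t" "sat w (t # ts) A"
  shows "sat w ts (Ex \<rho> A)"
  unfolding fsub.simps
  by (rule HA.ExI[of _ _ _ t])
    (use assms in \<open>auto simp: inst0_up senv_Cons intro!: wff_sub typed_sub_up typed_env\<close>)

lemma sat_ExE:
  assumes "valid w" "sat w ts (Ex \<rho> A)" "wff (ctx w) C"
    and "\<And>w' t. w \<sqsubseteq> w' \<Longrightarrow> tmw w' \<rho> t \<Longrightarrow> sat w' (t # ts) A \<Longrightarrow> prv w' C"
  shows "prv w C"
  using assms(2) unfolding fsub.simps
  by (rule prv_ExE[OF assms(1)]) (use assms in \<open>auto simp: inst0_up senv_Cons\<close>)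

lemma sat_Ind:
  assumes "w0 \<sqsubseteq> w" "tms w ts \<Theta>" "wf (Nat # \<Theta>) A" "sat w (Zero # ts) A"
    and "\<And>w' m. w \<sqsubseteq> w' \<Longrightarrow> tmw w' Nat m \<Longrightarrow> sat w' (m # ts) A \<Longrightarrow> sat w' (Succ \<cdot> m # ts) A"
    and "tmw w Nat m"
  shows "sat w (m # ts) A"
proof -
  have "prv w (All Nat (fsub (up (env ts)) A))"
    using assms by (intro prv_Ind)
      (auto simp: inst0_up senv_Cons wle_valid intro!: wff_sub typed_sub_up typed_env)
  from HA.AllE[OF this assms(6)] show ?thesis by (simp add: inst0_up senv_Cons)
qed

lemma sat_eqv:
  assumes "w0 \<sqsubseteq> w" "tms w ts \<Theta>" "tms w us \<Theta>" "wf \<Theta> A" "\<And>i. i < length \<Theta> \<Longrightarrow> eqv w (\<Theta> ! i) (ts ! i) (us ! i)"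
    and "sat w ts A"
  shows "sat w us A"
proof (rule fsub_eqv[OF assms(4) wle_valid(2)[OF assms(1)] _ assms(6)], intro allI impI)
  fix i assume i: "i < length (\<Theta> @ ctx w0)"
  have l: "length ts = length \<Theta>" "length us = length \<Theta>" using assms by (auto dest: list_all2_lengthD)
  show "eqv w ((\<Theta> @ ctx w0) ! i) (env ts i) (env us i)"
  proof (cases "i < length \<Theta>")
    case True
    then show ?thesis using assms(5) l by (simp add: senv_def nth_append)
  next
    case False
    have "tmw w ((\<Theta> @ ctx w0) ! i) (env ts i)"
      using typed_env[OF assms(1,2)] i by (simp add: typed_sub_def)
    then show ?thesis using False l by (auto simp: senv_def intro: HA.Refl)
  qed
qed

text \<open>\<open>\<beta>\<close> agrees with \<open>\<alpha>\<close> below \<open>n\<close>. Writing \<open>i < n\<close> as \<open>n = k + i + 1\<close> and ordering conditions by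
  inclusion of cones avoids all arithmetic of codes of sequences.\<close>

definition cone :: "world \<Rightarrow> tm \<Rightarrow> tm \<Rightarrow> tm \<Rightarrow> bool" where
  "cone w \<alpha> n \<beta> \<longleftrightarrow> (\<forall>w' i k. w \<sqsubseteq> w' \<longrightarrow> tmw w' Nat i \<longrightarrow> tmw w' Nat k \<longrightarrow>
     eqv w' Nat n (Succ \<cdot> (add_tm \<cdot> k \<cdot> i)) \<longrightarrow> eqv w' Nat (\<beta> \<cdot> i) (\<alpha> \<cdot> i))"

text \<open>The free variables are \<beta>, \<alpha>, n at indices 0, 1, 2; under the two
  quantifiers, k and i take indices 0 and 1 and shift them by two.\<close>

definition cone_fm :: fm where
  "cone_fm = All Nat (All Nat (Eq Nat (Var 4) (Succ \<cdot> (add_tm \<cdot> Var 0 \<cdot> Var 1))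
     \<^bold>\<longrightarrow> Eq Nat (Var 2 \<cdot> Var 1) (Var 3 \<cdot> Var 1)))"

lemma typing_add_closed: "typing \<Gamma> add_tm (Nat \<Rrightarrow> Nat \<Rrightarrow> Nat)"
  using typing_add by (rule typing_closed)

lemma env_num [simp]: "env (a # ts) (numeral k) = env ts (pred_numeral k)"
  by (simp add: numeral_eq_Suc)

lemma wf_cone: "wf (BT # BT # Nat # \<Theta>) cone_fm"
  unfolding cone_fm_def
  by (simp, intro conjI; (rule typing.intros(3,5) typing_add_closed typing_Var | simp)+)

text \<open>Object-level induction needs formulas, so each semantic relation on conditions is
  matched with a formula that expresses it.\<close>

lemma sat_cone:
  assumes "w0 \<sqsubseteq> w" "tmw w BT \<beta>" "tmw w BT \<alpha>" "tmw w Nat n" "tms w ts \<Theta>"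
  shows "sat w (\<beta> # \<alpha> # n # ts) cone_fm \<longleftrightarrow> cone w \<alpha> n \<beta>"
proof -
  define A where "A = (Eq Nat (Var 4) (Succ \<cdot> (add_tm \<cdot> Var 0 \<cdot> Var 1)) \<^bold>\<longrightarrow> Eq Nat (Var 2 \<cdot> Var 1) (Var 3 \<cdot> Var 1))"
  define us where "us = \<beta> # \<alpha> # n # ts"
  have us: "tms w' us (BT # BT # Nat # \<Theta>)" if "w \<sqsubseteq> w'" for w'
    using assms that tms_mono[of w w'] unfolding us_def by auto
  have wfA: "wf (Nat # Nat # BT # BT # Nat # \<Theta>) A" "wf (Nat # BT # BT # Nat # \<Theta>) (All Nat A)"
    using wf_cone[of \<Theta>] by (simp_all add: cone_fm_def A_def)
  have A: "sat w' (k # i # us) A \<longleftrightarrow> (\<forall>w''. w' \<sqsubseteq> w'' \<longrightarrow>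
      eqv w'' Nat n (Succ \<cdot> (add_tm \<cdot> k \<cdot> i)) \<longrightarrow> eqv w'' Nat (\<beta> \<cdot> i) (\<alpha> \<cdot> i))"
    if "w \<sqsubseteq> w'" "tmw w' Nat k" "tmw w' Nat i" for w' k i
    unfolding A_def
    by (subst sat_Imp[where \<Theta> = "Nat # Nat # BT # BT # Nat # \<Theta>"])
      (use that assms(1) us[of w'] wfA(1) wle_trans in \<open>auto simp: A_def us_def numeral_eq_Suc\<close>)
  have vw: "w \<sqsubseteq> w" using assms(1) wle_valid wle_refl by blast
  have 1: "sat w us (All Nat (All Nat A)) \<longleftrightarrow> (\<forall>w' i. w \<sqsubseteq> w' \<longrightarrow> tmw w' Nat i \<longrightarrow> sat w' (i # us) (All Nat A))"
    by (rule sat_All[OF assms(1) us[OF vw] wfA(2)])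
  have 2: "sat w' (i # us) (All Nat A) \<longleftrightarrow> (\<forall>w'' k. w' \<sqsubseteq> w'' \<longrightarrow> tmw w'' Nat k \<longrightarrow> sat w'' (k # i # us) A)"
    if "w \<sqsubseteq> w'" "tmw w' Nat i" for w' i
    by (rule sat_All[OF wle_trans[OF assms(1) that(1)] _ wfA(1)]) (use us[OF that(1)] that(2) in simp)
  have "sat w us (All Nat (All Nat A)) \<longleftrightarrow> (\<forall>w' i. w \<sqsubseteq> w' \<longrightarrow> tmw w' Nat i \<longrightarrow>
      (\<forall>w'' k. w' \<sqsubseteq> w'' \<longrightarrow> tmw w'' Nat k \<longrightarrow> sat w'' (k # i # us) A))"
    unfolding 1 using 2 by blast
  also have "\<dots> \<longleftrightarrow> cone w \<alpha> n \<beta>"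
    unfolding cone_def
  proof (intro iffI allI impI, goal_cases)
    case (1 w' i k)
    have v: "w' \<sqsubseteq> w'" using 1 wle_refl wle_valid by blast
    then have "sat w' (k # i # us) A" using 1 by blast
    then show ?case using A 1 v by blast
  next
    case (2 w' i w'' k)
    then show ?case using A[of w'' k i] wle_trans[of w w' w''] tmw_mono[of w' w'' i Nat]
      wle_trans[of w w''] tmw_mono[of w''] by blast
  qed
  finally show ?thesis by (simp add: us_def A_def cone_fm_def)
qed

lemma cone_mono: "w \<sqsubseteq> w' \<Longrightarrow> cone w \<alpha> n \<beta> \<Longrightarrow> cone w' \<alpha> n \<beta>"
  unfolding cone_def using wle_trans by blast

lemma cone_refl: "tmw w BT \<alpha> \<Longrightarrow> cone w \<alpha> n \<alpha>"
  unfolding cone_def by (blast intro: HA.Refl typing.intros(5) tmw_mono)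

definition ext :: "world \<Rightarrow> tm \<Rightarrow> tm \<Rightarrow> tm \<Rightarrow> tm \<Rightarrow> bool" where
  "ext w \<alpha> n \<alpha>' n' \<longleftrightarrow> (\<forall>w' \<beta>. w \<sqsubseteq> w' \<longrightarrow> tmw w' BT \<beta> \<longrightarrow> cone w' \<alpha>' n' \<beta> \<longrightarrow> cone w' \<alpha> n \<beta>)"

text \<open>The free variables are \<alpha>', n', \<alpha>, n at indices 0 to 3. Under the
  quantifier on \<beta> the first \<open>cone_fm\<close> reads \<beta>, \<alpha>', n' directly,
  while the substitution selects \<beta>, \<alpha>, n for the second.\<close>

definition ext_fm :: fm where
  "ext_fm = All BT (cone_fm \<^bold>\<longrightarrow> fsub (senv 5 [Var 0, Var 3, Var 4]) cone_fm)"

lemma wf_reindex: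
  assumes "wf \<Xi> A" "length \<Psi> = k" "list_all2 (typing (\<Psi> @ \<Theta> @ ctx w0)) ss \<Xi>'" "\<Xi> = \<Xi>' @ \<Theta>"
  shows "wf (\<Psi> @ \<Theta>) (fsub (senv k ss) A)"
  using wff_sub[OF _ typed_sub_senv[OF assms(2), of "\<Theta> @ ctx w0" ss \<Xi>'], of A] assms by simp

lemma wf_ext: "wf (BT # Nat # BT # Nat # \<Theta>) ext_fm"
proof -
  have "wf ([BT, BT, Nat, BT, Nat] @ \<Theta>) (fsub (senv 5 [Var 0, Var 3, Var 4]) cone_fm)"
    by (rule wf_reindex[OF wf_cone[of \<Theta>], where \<Xi>' = "[BT, BT, Nat]"]) (auto intro!: typing_Var)
  then show ?thesis using wf_cone[of "BT # Nat # \<Theta>"] by (simp add: ext_fm_def)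
qed

lemma sat_ext:
  assumes "w0 \<sqsubseteq> w" "tmw w BT \<alpha>'" "tmw w Nat n'" "tmw w BT \<alpha>" "tmw w Nat n" "tms w ts \<Theta>"
  shows "sat w (\<alpha>' # n' # \<alpha> # n # ts) ext_fm \<longleftrightarrow> ext w \<alpha> n \<alpha>' n'"
proof -
  let ?A = "fsub (senv 5 [Var 0, Var 3, Var 4]) cone_fm"
  let ?us = "\<alpha>' # n' # \<alpha> # n # ts"
  let ?\<Theta> = "BT # Nat # BT # Nat # \<Theta>"
  have wfs: "wf (BT # ?\<Theta>) (cone_fm \<^bold>\<longrightarrow> ?A)" "wf (BT # ?\<Theta>) cone_fm"
    using wf_ext[of \<Theta>] by (auto simp: ext_fm_def)
  have us: "tms w' ?us ?\<Theta>" if "w \<sqsubseteq> w'" for w'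
    using assms that tms_mono[of w w'] by auto
  have c2: "fsub (env (\<beta> # ?us)) ?A = fsub (env (\<beta> # \<alpha> # n # ts)) cone_fm" for \<beta>
    using fsub_reindex[of "[\<beta>, \<alpha>', n', \<alpha>, n]" 5 ts "[Var 0, Var 3, Var 4]"] by simp
  have *: "sat w' (\<beta> # ?us) (cone_fm \<^bold>\<longrightarrow> ?A) \<longleftrightarrow>
      (\<forall>w''. w' \<sqsubseteq> w'' \<longrightarrow> cone w'' \<alpha>' n' \<beta> \<longrightarrow> cone w'' \<alpha> n \<beta>)"
    if "w \<sqsubseteq> w'" "tmw w' BT \<beta>" for w' \<beta>
  proof -
    have w0': "w0 \<sqsubseteq> w'" using that assms(1) wle_trans by blast
    have t: "tms w' (\<beta> # ?us) (BT # ?\<Theta>)" using us[OF that(1)] that(2) by simp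
    have c: "sat w'' (\<beta> # ?us) cone_fm \<longleftrightarrow> cone w'' \<alpha>' n' \<beta>"
        "sat w'' (\<beta> # \<alpha> # n # ts) cone_fm \<longleftrightarrow> cone w'' \<alpha> n \<beta>" if w'': "w' \<sqsubseteq> w''" for w''
    proof -
      have t'': "tms w'' (\<beta> # ?us) (BT # ?\<Theta>)" using w'' t by (rule tms_mono)
      have w: "w0 \<sqsubseteq> w''" using w0' w'' by (rule wle_trans)
      show "sat w'' (\<beta> # ?us) cone_fm \<longleftrightarrow> cone w'' \<alpha>' n' \<beta>"
        by (rule sat_cone[OF w, where \<Theta> = "BT # Nat # \<Theta>"]) (use t'' in simp_all)
      show "sat w'' (\<beta> # \<alpha> # n # ts) cone_fm \<longleftrightarrow> cone w'' \<alpha> n \<beta>"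
        by (rule sat_cone[OF w, where \<Theta> = \<Theta>]) (use t'' in simp_all)
    qed
    have "sat w' (\<beta> # ?us) (cone_fm \<^bold>\<longrightarrow> ?A) \<longleftrightarrow>
        (\<forall>w''. w' \<sqsubseteq> w'' \<longrightarrow> sat w'' (\<beta> # ?us) cone_fm \<longrightarrow> sat w'' (\<beta> # ?us) ?A)"
      by (rule sat_Imp[OF w0' t wfs(2)])
    then show ?thesis unfolding c2 using c by simp
  qed
  have w: "w \<sqsubseteq> w" using assms(1) wle_valid wle_refl by blast
  have "sat w ?us ext_fm \<longleftrightarrow>
      (\<forall>w' \<beta>. w \<sqsubseteq> w' \<longrightarrow> tmw w' BT \<beta> \<longrightarrow> sat w' (\<beta> # ?us) (cone_fm \<^bold>\<longrightarrow> ?A))"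
    unfolding ext_fm_def by (rule sat_All[OF assms(1) us[OF w] wfs(1)])
  also have "\<dots> \<longleftrightarrow> (\<forall>w' \<beta>. w \<sqsubseteq> w' \<longrightarrow> tmw w' BT \<beta> \<longrightarrow>
      (\<forall>w''. w' \<sqsubseteq> w'' \<longrightarrow> cone w'' \<alpha>' n' \<beta> \<longrightarrow> cone w'' \<alpha> n \<beta>))"
    using * by simp
  also have "\<dots> \<longleftrightarrow> ext w \<alpha> n \<alpha>' n'"
    unfolding ext_def by (meson wle_trans wle_refl wle_valid(2) tmw_mono)
  finally show ?thesis .
qed

end

section \<open>Conditions and definable predicates\<close>

type_synonym cond = "world \<times> tm \<times> tm"

lemma typing_Var_iff [simp]: "typing \<Gamma> (Var i) \<tau> \<longleftrightarrow> i < length \<Gamma> \<and> \<Gamma> ! i = \<tau>"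
  by (auto elim: typing_VarE intro: typing_Var)

declare split_paired_All [simp del] split_paired_Ex [simp del]

lemma typing_initial: "typing [] initial_tm (BT \<Rrightarrow> Nat \<Rrightarrow> Nat)"
  unfolding initial_tm_def append_tm_def single_tm_def cons_tm_def nil_tm_def pair_tm_def hd_tm_def tl_tm_def
    fst_tm_def snd_tm_def diag_tm_def triangle_tm_def if_tm_def diff_tm_def pred_tm_def add_tm_def
  by (rule typing.intros typing_Var | simp)+

lemma sub_initial [simp]: "sub \<sigma> initial_tm = initial_tm"
  using typing_initial by (rule sub_closed)

context bar begin

fun cond_ok :: "cond \<Rightarrow> bool" where
  "cond_ok (w, \<alpha>, n) \<longleftrightarrow> w0 \<sqsubseteq> w \<and> tmw w BT \<alpha> \<and> tmw w Nat n"

text \<open>Later conditions carry more information: the world grows and the cone shrinks. Inclusion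
  of cones is required from the later world on only, so that it may rest on hypotheses acquired
  there.\<close>

fun cond_le :: "cond \<Rightarrow> cond \<Rightarrow> bool" (infix "\<preceq>" 50) where
  "(w, \<alpha>, n) \<preceq> (w', \<alpha>', n') \<longleftrightarrow>
     cond_ok (w, \<alpha>, n) \<and> cond_ok (w', \<alpha>', n') \<and> w \<sqsubseteq> w' \<and> ext w' \<alpha> n \<alpha>' n'"

lemma cond_le_refl: "cond_ok c \<Longrightarrow> c \<preceq> c"
  by (cases c) (auto simp: ext_def intro: wle_refl wle_valid)

lemma cond_le_trans: "c \<preceq> c' \<Longrightarrow> c' \<preceq> c'' \<Longrightarrow> c \<preceq> c''"
  by (cases c; cases c'; cases c'') (auto simp: ext_def dest: wle_trans)

lemma cond_le_cond_ok: "c \<preceq> c' \<Longrightarrow> cond_ok c" "c \<preceq> c' \<Longrightarrow> cond_ok c'"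
  by (cases c; cases c'; auto)+

lemma cond_le_wle: "c \<preceq> c' \<Longrightarrow> fst c \<sqsubseteq> fst c'"
  by (cases c; cases c'; auto)

lemma cond_le_world: "cond_ok (w, \<alpha>, n) \<Longrightarrow> w \<sqsubseteq> w' \<Longrightarrow> (w, \<alpha>, n) \<preceq> (w', \<alpha>, n)"
  by (auto simp: ext_def intro: wle_trans tmw_mono)

section \<open>The nucleus generated by Q\<close>

fun Qbar :: "cond \<Rightarrow> bool" where
  "Qbar (w, \<alpha>, n) \<longleftrightarrow> sat w [initial_tm \<cdot> \<alpha> \<cdot> n] Q"

text \<open>The nucleus \<open>X \<mapsto> ((X \<rightarrow> Q) \<rightarrow> Q)\<close>. Here \<open>X\<close> may be an arbitrary predicate, in particular a
  disjunction in the metalogic; only \<open>Qbar\<close> has to be a formula.\<close>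

definition j :: "(cond \<Rightarrow> bool) \<Rightarrow> cond \<Rightarrow> bool" where
  "j X c \<longleftrightarrow> (\<forall>c'. c \<preceq> c' \<longrightarrow> (\<forall>c''. c' \<preceq> c'' \<longrightarrow> X c'' \<longrightarrow> Qbar c'') \<longrightarrow> Qbar c')"

text \<open>Arguments under \<open>j\<close> run monadically: to reach \<open>j Y\<close> one may
  assume X after passing to a later condition.\<close>

lemma j_bind:
  assumes "j X c" "\<And>c'. c \<preceq> c' \<Longrightarrow> X c' \<Longrightarrow> j Y c'"
  shows "j Y c"
  unfolding j_def
proof (intro allI impI)
  fix c' assume c': "c \<preceq> c'" and Y: "\<forall>c''. c' \<preceq> c'' \<longrightarrow> Y c'' \<longrightarrow> Qbar c''"
  have "Qbar c''" if "c' \<preceq> c''" "X c''" for c''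
  proof -
    have "j Y c''" using assms(2) that c' cond_le_trans by blast
    then show ?thesis unfolding j_def using Y that(1) cond_le_trans cond_le_refl cond_le_cond_ok(2) by blast
  qed
  then show "Qbar c'" using assms(1) c' unfolding j_def by blast
qed

text \<open>Predicates are not assumed monotone, so X is demanded at all later conditions.\<close>

lemma j_ret: "(\<And>c'. c \<preceq> c' \<Longrightarrow> X c') \<Longrightarrow> j X c"
  unfolding j_def using cond_le_refl cond_le_cond_ok(2) by blast

lemma j_mono: "j X c \<Longrightarrow> (\<And>c'. c \<preceq> c' \<Longrightarrow> X c' \<Longrightarrow> Y c') \<Longrightarrow> j Y c"
  unfolding j_def using cond_le_trans by blast

lemma j_up: "j X c \<Longrightarrow> c \<preceq> c' \<Longrightarrow> j X c'"
  unfolding j_def using cond_le_trans by blast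

lemma j_j: "j (j X) c \<Longrightarrow> j X c"
  by (erule j_bind)

lemma j_D: "j X c \<Longrightarrow> cond_ok c \<Longrightarrow> (\<And>c'. c \<preceq> c' \<Longrightarrow> X c' \<Longrightarrow> Qbar c') \<Longrightarrow> Qbar c"
  unfolding j_def using cond_le_refl by blast

text \<open>A predicate of conditions is definable if it is expressed by a formula. Induction and recursion
  are forced because forcing and \<open>tame\<close> below are definable.\<close>

definition defin :: "ty list \<Rightarrow> (tm list \<Rightarrow> cond \<Rightarrow> bool) \<Rightarrow> bool" where
  "defin \<Theta> X \<longleftrightarrow> (\<exists>A. wf (BT # Nat # \<Theta>) A \<and> (\<forall>w \<alpha> n ts. cond_ok (w, \<alpha>, n) \<longrightarrow> tms w ts \<Theta> \<longrightarrow>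
     (X ts (w, \<alpha>, n) \<longleftrightarrow> sat w (\<alpha> # n # ts) A)))"

lemma definI:
  assumes "wf (BT # Nat # \<Theta>) A"
    and "\<And>w \<alpha> n ts. cond_ok (w, \<alpha>, n) \<Longrightarrow> tms w ts \<Theta> \<Longrightarrow> tms w (\<alpha> # n # ts) (BT # Nat # \<Theta>) \<Longrightarrow> w0 \<sqsubseteq> w
      \<Longrightarrow> X ts (w, \<alpha>, n) \<longleftrightarrow> sat w (\<alpha> # n # ts) A"
  shows "defin \<Theta> X"
  unfolding defin_def using assms by (intro exI[of _ A]) auto

lemma defin_cong:
  assumes "defin \<Theta> X" "\<And>c ts. cond_ok c \<Longrightarrow> tms (fst c) ts \<Theta> \<Longrightarrow> Y ts c \<longleftrightarrow> X ts c"
  shows "defin \<Theta> Y"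
  using assms unfolding defin_def by fastforce

lemma defin_and:
  assumes "defin \<Theta> X" "defin \<Theta> Y"
  shows "defin \<Theta> (\<lambda>ts c. X ts c \<and> Y ts c)"
proof -
  obtain A where A: "wf (BT # Nat # \<Theta>) A" "\<And>w \<alpha> n ts. cond_ok (w, \<alpha>, n) \<Longrightarrow> tms w ts \<Theta> \<Longrightarrow>
    X ts (w, \<alpha>, n) \<longleftrightarrow> sat w (\<alpha> # n # ts) A" using assms(1) unfolding defin_def by blast
  obtain B where B: "wf (BT # Nat # \<Theta>) B" "\<And>w \<alpha> n ts. cond_ok (w, \<alpha>, n) \<Longrightarrow> tms w ts \<Theta> \<Longrightarrow>
    Y ts (w, \<alpha>, n) \<longleftrightarrow> sat w (\<alpha> # n # ts) B" using assms(2) unfolding defin_def by blast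
  show ?thesis
    by (rule definI[of _ "A \<^bold>\<and> B"]) (use A B sat_And in auto)
qed

lemma defin_fm:
  assumes "wf \<Theta> A"
  shows "defin \<Theta> (\<lambda>ts c. sat (fst c) ts A)"
proof (rule definI)
  show "wf (BT # Nat # \<Theta>) (fsub (senv 2 []) A)"
    using wf_reindex[OF assms, of "[BT, Nat]" 2 \<Theta> "[]" "[]"] by simp
  show "sat (fst (w, \<alpha>, n)) ts A \<longleftrightarrow> sat w (\<alpha> # n # ts) (fsub (senv 2 []) A)" for w \<alpha> n ts
    using fsub_reindex[of "[\<alpha>, n]" 2 ts "[]"] by simp
qed

text \<open>The connectives of the object theory move only the world. Movement of the initial
  segment is added by \<open>defin_cext\<close>, and \<open>defin_imp\<close> and
  \<open>defin_all\<close> combine the two.\<close>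

lemma defin_wimp:
  assumes "defin \<Theta> X" "defin \<Theta> Y"
  shows "defin \<Theta> (\<lambda>ts (w, \<alpha>, n). \<forall>w'. w \<sqsubseteq> w' \<longrightarrow> X ts (w', \<alpha>, n) \<longrightarrow> Y ts (w', \<alpha>, n))"
proof -
  obtain A where A: "wf (BT # Nat # \<Theta>) A" "\<And>w \<alpha> n ts. cond_ok (w, \<alpha>, n) \<Longrightarrow> tms w ts \<Theta> \<Longrightarrow>
    X ts (w, \<alpha>, n) \<longleftrightarrow> sat w (\<alpha> # n # ts) A" using assms(1) unfolding defin_def by blast
  obtain B where B: "wf (BT # Nat # \<Theta>) B" "\<And>w \<alpha> n ts. cond_ok (w, \<alpha>, n) \<Longrightarrow> tms w ts \<Theta> \<Longrightarrow>
    Y ts (w, \<alpha>, n) \<longleftrightarrow> sat w (\<alpha> # n # ts) B" using assms(2) unfolding defin_def by blast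
  show ?thesis
  proof (rule definI)
    show "wf (BT # Nat # \<Theta>) (A \<^bold>\<longrightarrow> B)" using A B by simp
    fix w \<alpha> n ts
    assume *: "cond_ok (w, \<alpha>, n)" "tms w ts \<Theta>" "tms w (\<alpha> # n # ts) (BT # Nat # \<Theta>)" "w0 \<sqsubseteq> w"
    have "X ts (w', \<alpha>, n) \<longleftrightarrow> sat w' (\<alpha> # n # ts) A" "Y ts (w', \<alpha>, n) \<longleftrightarrow> sat w' (\<alpha> # n # ts) B"
      if "w \<sqsubseteq> w'" for w'
      using A(2) B(2) cond_le_world[OF *(1) that] tms_mono[OF that *(2)] cond_le_cond_ok(2) by auto
    then show "(case (w, \<alpha>, n) of (w, \<alpha>, n) \<Rightarrow> \<forall>w'. w \<sqsubseteq> w' \<longrightarrow> X ts (w', \<alpha>, n) \<longrightarrow> Y ts (w', \<alpha>, n))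
        \<longleftrightarrow> sat w (\<alpha> # n # ts) (A \<^bold>\<longrightarrow> B)"
      unfolding sat_Imp[OF *(4,3) A(1)] by simp
  qed
qed

lemma defin_wall:
  assumes "defin (\<sigma> # \<Theta>) X"
  shows "defin \<Theta> (\<lambda>ts (w, \<alpha>, n). \<forall>w' x. w \<sqsubseteq> w' \<longrightarrow> tmw w' \<sigma> x \<longrightarrow> X (x # ts) (w', \<alpha>, n))"
proof -
  obtain A where A: "wf (BT # Nat # \<sigma> # \<Theta>) A" "\<And>w \<alpha> n ts. cond_ok (w, \<alpha>, n) \<Longrightarrow> tms w ts (\<sigma> # \<Theta>) \<Longrightarrow>
    X ts (w, \<alpha>, n) \<longleftrightarrow> sat w (\<alpha> # n # ts) A" using assms(1) unfolding defin_def by blast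
  \<comment> \<open>\<open>A\<close> expects \<alpha> and n before x, whereas the new quantifier
    puts x first.\<close>
  let ?A = "fsub (senv 3 [Var 1, Var 2, Var 0]) A"
  have wfA: "wf (\<sigma> # BT # Nat # \<Theta>) ?A"
    using wf_reindex[OF A(1), of "[\<sigma>, BT, Nat]" 3 \<Theta> "[Var 1, Var 2, Var 0]" "[BT, Nat, \<sigma>]"]
    by simp
  show ?thesis
  proof (rule definI)
    show "wf (BT # Nat # \<Theta>) (All \<sigma> ?A)" using wfA by simp
    fix w \<alpha> n ts
    assume *: "cond_ok (w, \<alpha>, n)" "tms w ts \<Theta>" "tms w (\<alpha> # n # ts) (BT # Nat # \<Theta>)" "w0 \<sqsubseteq> w"
    have "X (x # ts) (w', \<alpha>, n) \<longleftrightarrow> sat w' (x # \<alpha> # n # ts) ?A"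
      if "w \<sqsubseteq> w'" "tmw w' \<sigma> x" for w' x
    proof -
      have "fsub (env (x # \<alpha> # n # ts)) ?A = fsub (env (\<alpha> # n # x # ts)) A"
        using fsub_reindex[of "[x, \<alpha>, n]" 3 ts "[Var 1, Var 2, Var 0]"] by simp
      then show ?thesis
        using A(2)[of w' \<alpha> n "x # ts"] cond_le_world[OF *(1) that(1)] tms_mono[OF that(1) *(2)] that(2) cond_le_cond_ok(2) by auto
    qed
    then show "(case (w, \<alpha>, n) of (w, \<alpha>, n) \<Rightarrow> \<forall>w' x. w \<sqsubseteq> w' \<longrightarrow> tmw w' \<sigma> x \<longrightarrow> X (x # ts) (w', \<alpha>, n))
        \<longleftrightarrow> sat w (\<alpha> # n # ts) (All \<sigma> ?A)"
      unfolding sat_All[OF *(4,3) wfA] by simp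
  qed
qed

text \<open>The shape shared by \<open>agree\<close> and \<open>holds\<close> below: a formula
  derivable throughout the cone.\<close>

lemma defin_cone:
  assumes "wf (BT # \<Theta>) A"
  shows "defin \<Theta> (\<lambda>ts (w, \<alpha>, n). \<forall>w' \<beta>. w \<sqsubseteq> w' \<longrightarrow> tmw w' BT \<beta> \<longrightarrow> cone w' \<alpha> n \<beta> \<longrightarrow> sat w' (\<beta> # ts) A)"
proof -
  have 1: "defin (BT # \<Theta>) (\<lambda>ts c. sat (fst c) ts A)"
    using assms by (rule defin_fm)
  have 2: "defin (BT # \<Theta>) (\<lambda>ts (w, \<alpha>, n). cone w \<alpha> n (hd ts))"
  proof (rule definI)
    let ?A = "fsub (senv 3 [Var 2, Var 0, Var 1]) cone_fm"
    show "wf (BT # Nat # BT # \<Theta>) ?A"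
      using wf_reindex[OF wf_cone[of \<Theta>], of "[BT, Nat, BT]" 3 \<Theta> "[Var 2, Var 0, Var 1]" "[BT, BT, Nat]"]
      by simp
    fix w \<alpha> n ts
    assume *: "cond_ok (w, \<alpha>, n)" "tms w ts (BT # \<Theta>)" "tms w (\<alpha> # n # ts) (BT # Nat # BT # \<Theta>)" "w0 \<sqsubseteq> w"
    then obtain \<beta> us where ts: "ts = \<beta> # us" by (cases ts) auto
    have "fsub (env (\<alpha> # n # ts)) ?A = fsub (env (\<beta> # \<alpha> # n # us)) cone_fm"
      using fsub_reindex[of "[\<alpha>, n, \<beta>]" 3 us "[Var 2, Var 0, Var 1]"] ts by simp
    then show "(case (w, \<alpha>, n) of (w, \<alpha>, n) \<Rightarrow> cone w \<alpha> n (hd ts)) \<longleftrightarrow> sat w (\<alpha> # n # ts) ?A"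
      using sat_cone[of w \<beta> \<alpha> n us \<Theta>] * ts by simp
  qed
  show ?thesis
  proof (rule defin_cong[OF defin_wall[OF defin_wimp[OF 2 1]]], goal_cases)
    case (1 c ts)
    obtain w \<alpha> n where c: "c = (w, \<alpha>, n)" by (cases c)
    show ?case unfolding c prod.case list.sel fst_conv
    proof (intro iffI allI impI, goal_cases)
      case (1 w' \<beta> w'')
      then show ?case using wle_trans[OF 1(2,4)] tmw_mono[OF 1(4,3)] by blast
    next
      case (2 w' \<beta>)
      then show ?case using wle_refl[OF wle_valid(2)[OF 2(2)]] by blast
    qed
  qed
qed

text \<open>A condition in the object theory is a sequence with a length, guarded by
  \<open>ext_fm\<close>. The new pair takes indices 0 and 1; the substitution
  \<open>[Var 0, Var 1]\<close> drops the old pair behind it.\<close>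

lemma defin_cext:
  assumes "defin \<Theta> X"
  shows "defin \<Theta> (\<lambda>ts c. \<forall>c'. c \<preceq> c' \<longrightarrow> X ts c')"
proof -
  obtain A where A: "wf (BT # Nat # \<Theta>) A" "\<And>w \<alpha> n ts. cond_ok (w, \<alpha>, n) \<Longrightarrow> tms w ts \<Theta> \<Longrightarrow>
    X ts (w, \<alpha>, n) \<longleftrightarrow> sat w (\<alpha> # n # ts) A" using assms(1) unfolding defin_def by blast
  let ?A = "fsub (senv 4 [Var 0, Var 1]) A"
  let ?\<Theta> = "BT # Nat # \<Theta>"
  have wfA: "wf (BT # Nat # ?\<Theta>) ?A"
    using wf_reindex[OF A(1), of "[BT, Nat, BT, Nat]" 4 \<Theta> "[Var 0, Var 1]" "[BT, Nat]"]
    by simp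
  note wfs = wf_ext[of \<Theta>] wfA
  have wfs2: "wf (BT # Nat # ?\<Theta>) (ext_fm \<^bold>\<longrightarrow> ?A)" "wf (Nat # ?\<Theta>) (All BT (ext_fm \<^bold>\<longrightarrow> ?A))"
    using wfs by simp_all
  show ?thesis
  proof (rule definI)
    show "wf ?\<Theta> (All Nat (All BT (ext_fm \<^bold>\<longrightarrow> ?A)))" using wfs2 by simp
    fix w \<alpha> n ts
    assume *: "cond_ok (w, \<alpha>, n)" "tms w ts \<Theta>" "tms w (\<alpha> # n # ts) ?\<Theta>" "w0 \<sqsubseteq> w"
    let ?ts = "\<alpha> # n # ts"
    have s1: "sat w' (n' # ?ts) (All BT (ext_fm \<^bold>\<longrightarrow> ?A)) \<longleftrightarrow>
        (\<forall>w'' \<alpha>'. w' \<sqsubseteq> w'' \<longrightarrow> tmw w'' BT \<alpha>' \<longrightarrow> sat w'' (\<alpha>' # n' # ?ts) (ext_fm \<^bold>\<longrightarrow> ?A))"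
      if "w \<sqsubseteq> w'" "tmw w' Nat n'" for w' n'
      by (rule sat_All[OF wle_trans[OF *(4) that(1)] _ wfs2(1)])
        (use tms_mono[OF that(1) *(3)] that(2) in simp)
    have s2: "sat w' (\<alpha>' # n' # ?ts) (ext_fm \<^bold>\<longrightarrow> ?A) \<longleftrightarrow>
        (\<forall>w''. w' \<sqsubseteq> w'' \<longrightarrow> ext w'' \<alpha> n \<alpha>' n' \<longrightarrow> X ts (w'', \<alpha>', n'))"
      if "w \<sqsubseteq> w'" "tmw w' Nat n'" "tmw w' BT \<alpha>'" for w' n' \<alpha>'
    proof -
      have w0': "w0 \<sqsubseteq> w'" using *(4) that(1) by (rule wle_trans)
      have t: "tms w' (\<alpha>' # n' # ?ts) (BT # Nat # ?\<Theta>)" using tms_mono[OF that(1) *(3)] that(2,3) by simp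
      have "sat w' (\<alpha>' # n' # ?ts) (ext_fm \<^bold>\<longrightarrow> ?A) \<longleftrightarrow>
          (\<forall>w''. w' \<sqsubseteq> w'' \<longrightarrow> sat w'' (\<alpha>' # n' # ?ts) ext_fm \<longrightarrow> sat w'' (\<alpha>' # n' # ?ts) ?A)"
        by (rule sat_Imp[OF w0' t wfs(1)])
      moreover have "sat w'' (\<alpha>' # n' # ?ts) ext_fm \<longleftrightarrow> ext w'' \<alpha> n \<alpha>' n'"
          "sat w'' (\<alpha>' # n' # ?ts) ?A \<longleftrightarrow> X ts (w'', \<alpha>', n')" if w'': "w' \<sqsubseteq> w''" for w''
      proof -
        have t'': "tms w'' (\<alpha>' # n' # ?ts) (BT # Nat # ?\<Theta>)" using w'' t by (rule tms_mono)
        have w: "w0 \<sqsubseteq> w''" using w0' w'' by (rule wle_trans)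
        show "sat w'' (\<alpha>' # n' # ?ts) ext_fm \<longleftrightarrow> ext w'' \<alpha> n \<alpha>' n'"
          by (rule sat_ext[OF w, where \<Theta> = \<Theta>]) (use t'' in simp_all)
        have "fsub (env (\<alpha>' # n' # ?ts)) ?A = fsub (env (\<alpha>' # n' # ts)) A"
          using fsub_reindex[of "[\<alpha>', n', \<alpha>, n]" 4 ts "[Var 0, Var 1]"] by simp
        then show "sat w'' (\<alpha>' # n' # ?ts) ?A \<longleftrightarrow> X ts (w'', \<alpha>', n')"
          using A(2)[of w'' \<alpha>' n' ts] t'' w by simp
      qed
      ultimately show ?thesis by simp
    qed
    have "sat w ?ts (All Nat (All BT (ext_fm \<^bold>\<longrightarrow> ?A))) \<longleftrightarrow> (\<forall>w' n'. w \<sqsubseteq> w' \<longrightarrow> tmw w' Nat n' \<longrightarrow>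
        sat w' (n' # ?ts) (All BT (ext_fm \<^bold>\<longrightarrow> ?A)))"
      by (rule sat_All[OF *(4,3) wfs2(2)])
    also have "\<dots> \<longleftrightarrow> (\<forall>c'. (w, \<alpha>, n) \<preceq> c' \<longrightarrow> X ts c')"
    proof (intro iffI allI impI, goal_cases)
      case (1 c')
      obtain w' \<alpha>' n' where c': "c' = (w', \<alpha>', n')" by (cases c')
      then have c: "w \<sqsubseteq> w'" "tmw w' Nat n'" "tmw w' BT \<alpha>'" "ext w' \<alpha> n \<alpha>' n'" "w' \<sqsubseteq> w'"
        using 1(2) wle_refl wle_valid(2) by auto
      have "sat w' (n' # ?ts) (All BT (ext_fm \<^bold>\<longrightarrow> ?A))" using 1(1) c by blast
      then have "sat w' (\<alpha>' # n' # ?ts) (ext_fm \<^bold>\<longrightarrow> ?A)" unfolding s1[OF c(1,2)] using c by blast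
      then show ?case unfolding s2[OF c(1-3)] c' using c by blast
    next
      case (2 w1 n')
      show ?case unfolding s1[OF 2(2,3)]
      proof (intro allI impI)
        fix w2 \<alpha>' assume w2: "w1 \<sqsubseteq> w2" "tmw w2 BT \<alpha>'"
        note w2' = wle_trans[OF 2(2) w2(1)] tmw_mono[OF w2(1) 2(3)] w2(2)
        show "sat w2 (\<alpha>' # n' # ?ts) (ext_fm \<^bold>\<longrightarrow> ?A)" unfolding s2[OF w2']
        proof (intro allI impI)
          fix w3 assume w3: "w2 \<sqsubseteq> w3" "ext w3 \<alpha> n \<alpha>' n'"
          note w = wle_trans[OF w2'(1) w3(1)]
          have "(w, \<alpha>, n) \<preceq> (w3, \<alpha>', n')"
            using w3 w tmw_mono[OF w3(1) w2'(2)] tmw_mono[OF w3(1) w2'(3)] *(1) wle_trans[OF *(4) w] by simp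
          then show "X ts (w3, \<alpha>', n')" using 2(1) by blast
        qed
      qed
    qed
    finally show "(\<forall>c'. (w, \<alpha>, n) \<preceq> c' \<longrightarrow> X ts c') \<longleftrightarrow> sat w ?ts (All Nat (All BT (ext_fm \<^bold>\<longrightarrow> ?A)))"
      by simp
  qed
qed

lemma defin_imp:
  assumes "defin \<Theta> X" "defin \<Theta> Y"
  shows "defin \<Theta> (\<lambda>ts c. \<forall>c'. c \<preceq> c' \<longrightarrow> X ts c' \<longrightarrow> Y ts c')"
proof (rule defin_cong[OF defin_cext[OF defin_wimp[OF assms]]], goal_cases)
  case (1 c ts)
  show ?case
  proof (intro iffI allI impI, goal_cases)
    case (1 c')
    obtain w \<alpha> n where c': "c' = (w, \<alpha>, n)" by (cases c')
    show ?case using 1 cond_le_world[of w \<alpha> n] cond_le_trans[of c c'] cond_le_cond_ok(2)[of c c'] unfolding c' by blast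
  next
    case (2 c')
    obtain w \<alpha> n where c': "c' = (w, \<alpha>, n)" by (cases c')
    have "w \<sqsubseteq> w" using cond_le_cond_ok(2)[OF 2(2)] unfolding c' by (auto intro: wle_refl wle_valid)
    then show ?case using 2 unfolding c' by blast
  qed
qed

lemma defin_all:
  assumes "defin (\<sigma> # \<Theta>) X"
  shows "defin \<Theta> (\<lambda>ts c. \<forall>c'. c \<preceq> c' \<longrightarrow> (\<forall>x. tmw (fst c') \<sigma> x \<longrightarrow> X (x # ts) c'))"
proof (rule defin_cong[OF defin_cext[OF defin_wall[OF assms]]], goal_cases)
  case (1 c ts)
  show ?case
  proof (intro iffI allI impI, goal_cases)
    case (1 c')
    obtain w \<alpha> n where c': "c' = (w, \<alpha>, n)" by (cases c')
    show ?case unfolding c' prod.case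
    proof (intro allI impI)
      fix w' x assume w': "w \<sqsubseteq> w'" "tmw w' \<sigma> x"
      have "c \<preceq> (w', \<alpha>, n)"
        using 1(2) cond_le_world[OF _ w'(1), of \<alpha> n] cond_le_cond_ok(2)[OF 1(2)] cond_le_trans unfolding c' by blast
      then show "X (x # ts) (w', \<alpha>, n)" using 1(1) w'(2) by simp
    qed
  next
    case (2 c' x)
    obtain w \<alpha> n where c': "c' = (w, \<alpha>, n)" by (cases c')
    have "w \<sqsubseteq> w" using cond_le_cond_ok(2)[OF 2(2)] unfolding c' by (auto intro: wle_refl wle_valid)
    moreover have "\<forall>w' x. w \<sqsubseteq> w' \<longrightarrow> tmw w' \<sigma> x \<longrightarrow> X (x # ts) (w', \<alpha>, n)"
      using 2(1,2) unfolding c' by auto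
    ultimately show ?case using 2(3) unfolding c' by simp
  qed
qed

lemma defin_Q: "defin \<Theta> (\<lambda>ts. Qbar)"
proof (rule definI)
  let ?s = "initial_tm \<cdot> Var 0 \<cdot> Var 1"
  let ?A = "fsub (senv (length (BT # Nat # \<Theta>)) [?s]) Q"
  have "typing ((BT # Nat # \<Theta>) @ ctx w0) ?s Nat"
    by (rule typing.intros typing_closed[OF typing_initial] typing_Var | simp)+
  then show "wf (BT # Nat # \<Theta>) ?A"
    using wf_reindex[of "[Nat]" Q "BT # Nat # \<Theta>" _ "[]" "[?s]" "[Nat]"] Q by simp
  fix w \<alpha> n ts
  assume *: "tms w (\<alpha> # n # ts) (BT # Nat # \<Theta>)"
  have "fsub (env (\<alpha> # n # ts)) ?A = fsub (env [initial_tm \<cdot> \<alpha> \<cdot> n]) Q"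
    using fsub_reindex[of "\<alpha> # n # ts" "length (BT # Nat # \<Theta>)" "[]" "[?s]"] list_all2_lengthD[OF *] by simp
  then show "Qbar (w, \<alpha>, n) \<longleftrightarrow> sat w (\<alpha> # n # ts) ?A" by simp
qed

lemma defin_j: "defin \<Theta> X \<Longrightarrow> defin \<Theta> (\<lambda>ts. j (X ts))"
  unfolding j_def by (intro defin_imp defin_Q)

text \<open>A disjunction of HOL is not the derivability of a disjunction and need not be definable.
  Under \<open>j\<close> it occurs only as the premise of an implication into Q, where it splits
  into a conjunction of two implications.\<close>

lemma defin_jor:
  assumes "defin \<Theta> X" "defin \<Theta> Y"
  shows "defin \<Theta> (\<lambda>ts. j (\<lambda>c. X ts c \<or> Y ts c))"
  by (rule defin_cong[OF defin_imp[OF defin_and[OF defin_imp[OF assms(1) defin_Q] defin_imp[OF assms(2) defin_Q]] defin_Q]])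
    (auto simp: j_def)

text \<open>As for disjunction: an existential choice of a term in front of Q turns into a universal
  quantifier over terms.\<close>

lemma defin_jex:
  assumes "defin (\<sigma> # \<Theta>) X"
  shows "defin \<Theta> (\<lambda>ts. j (\<lambda>c. \<exists>x. tmw (fst c) \<sigma> x \<and> X (x # ts) c))"
proof (rule defin_cong[OF defin_imp[OF defin_all[OF defin_imp[OF assms defin_Q]] defin_Q]], goal_cases)
  case (1 c ts)
  have "(\<forall>c''. c' \<preceq> c'' \<longrightarrow> (\<exists>x. tmw (fst c'') \<sigma> x \<and> X (x # ts) c'') \<longrightarrow> Qbar c'') \<longleftrightarrow>
    (\<forall>c''. c' \<preceq> c'' \<longrightarrow> (\<forall>x. tmw (fst c'') \<sigma> x \<longrightarrow> (\<forall>c'''. c'' \<preceq> c''' \<longrightarrow> X (x # ts) c''' \<longrightarrow> Qbar c''')))" for c'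
    using cond_le_refl cond_le_cond_ok(2) cond_le_trans cond_le_wle tmw_mono by meson
  then show ?case unfolding j_def by simp
qed

text \<open>This lets forcing at the element \<open>konst m\<close> be regarded as a predicate of
  the number m.\<close>

lemma defin_sub:
  assumes "defin \<Theta>' X" "list_all2 (typing (\<Theta> @ ctx w0)) ss \<Theta>'"
  shows "defin \<Theta> (\<lambda>ts. X (map (sub (env ts)) ss))"
proof -
  obtain A where A: "wf (BT # Nat # \<Theta>') A" "\<And>w \<alpha> n ts. cond_ok (w, \<alpha>, n) \<Longrightarrow> tms w ts \<Theta>' \<Longrightarrow>
    X ts (w, \<alpha>, n) \<longleftrightarrow> sat w (\<alpha> # n # ts) A" using assms(1) unfolding defin_def by blast
  let ?ss = "Var 0 # Var 1 # map (ren (\<lambda>i. i + 2)) ss"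
  let ?A = "fsub (senv (length (BT # Nat # \<Theta>)) ?ss) A"
  have "list_all2 (typing ((BT # Nat # \<Theta>) @ ctx w0)) (map (ren (\<lambda>i. i + 2)) ss) \<Theta>'"
    using assms(2) by (auto simp: list_all2_conv_all_nth intro!: typing_ren)
  then have "list_all2 (typing ((BT # Nat # \<Theta>) @ ctx w0)) ?ss (BT # Nat # \<Theta>')"
    by simp
  then have wfA: "wf (BT # Nat # \<Theta>) ?A"
    using wf_reindex[OF A(1), of "BT # Nat # \<Theta>" _ "[]" ?ss "BT # Nat # \<Theta>'"] by simp
  show ?thesis
  proof (rule definI[OF wfA])
    fix w \<alpha> n ts
    assume *: "cond_ok (w, \<alpha>, n)" "tms w ts \<Theta>" "tms w (\<alpha> # n # ts) (BT # Nat # \<Theta>)" "w0 \<sqsubseteq> w"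
    have "tms w (map (sub (env ts)) ss) \<Theta>'"
      using assms(2) typing_sub[OF _ typed_env[OF *(4,2)]] by (auto simp: list_all2_conv_all_nth)
    moreover have "fsub (env (\<alpha> # n # ts)) ?A = fsub (env (\<alpha> # n # map (sub (env ts)) ss)) A"
      using fsub_reindex[of "\<alpha> # n # ts" "length (BT # Nat # \<Theta>)" "[]" ?ss] list_all2_lengthD[OF *(3)]
        sub_env_ren[of "[\<alpha>, n]" 2 ts] by (simp add: comp_def)
    ultimately show "X (map (sub (env ts)) ss) (w, \<alpha>, n) \<longleftrightarrow> sat w (\<alpha> # n # ts) ?A"
      using A(2) *(1) by simp
  qed
qed

text \<open>Induction of the object theory at a fixed initial segment; only the world moves in the
  step. Since \<open>m\<close> is any term of type \<open>Nat\<close>, possibly with free variables,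
  induction in HOL over numerals would not reach it, hence the demand for definability.\<close>

lemma defin_Ind:
  assumes "defin (Nat # \<Theta>) X" "cond_ok (w, \<alpha>, n)" "tms w ts \<Theta>" "X (Zero # ts) (w, \<alpha>, n)"
    and "\<And>w' m. w \<sqsubseteq> w' \<Longrightarrow> tmw w' Nat m \<Longrightarrow> X (m # ts) (w', \<alpha>, n) \<Longrightarrow> X (Succ \<cdot> m # ts) (w', \<alpha>, n)"
    and "tmw w Nat m"
  shows "X (m # ts) (w, \<alpha>, n)"
proof -
  obtain A where A: "wf (BT # Nat # Nat # \<Theta>) A" "\<And>w \<alpha> n ts. cond_ok (w, \<alpha>, n) \<Longrightarrow> tms w ts (Nat # \<Theta>) \<Longrightarrow>
    X ts (w, \<alpha>, n) \<longleftrightarrow> sat w (\<alpha> # n # ts) A" using assms(1) unfolding defin_def by blast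
  let ?A = "fsub (senv 3 [Var 1, Var 2, Var 0]) A"
  have wfA: "wf (Nat # BT # Nat # \<Theta>) ?A"
    using wf_reindex[OF A(1), of "[Nat, BT, Nat]" 3 \<Theta> "[Var 1, Var 2, Var 0]" "[BT, Nat, Nat]"]
    by simp
  have X: "X (x # ts) (w', \<alpha>, n) \<longleftrightarrow> sat w' (x # \<alpha> # n # ts) ?A" if "w \<sqsubseteq> w'" "tmw w' Nat x" for w' x
  proof -
    have "fsub (env (x # \<alpha> # n # ts)) ?A = fsub (env (\<alpha> # n # x # ts)) A"
      using fsub_reindex[of "[x, \<alpha>, n]" 3 ts "[Var 1, Var 2, Var 0]"] by simp
    then show ?thesis
      using A(2)[of w' \<alpha> n "x # ts"] cond_le_world[OF assms(2) that(1)] tms_mono[OF that(1) assms(3)] that(2) cond_le_cond_ok(2) by auto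
  qed
  have w: "w0 \<sqsubseteq> w" "w \<sqsubseteq> w" "tms w (\<alpha> # n # ts) (BT # Nat # \<Theta>)"
    using assms(2,3) by (auto intro: wle_refl wle_valid)
  have "sat w (m # \<alpha> # n # ts) ?A"
  proof (rule sat_Ind[OF w(1,3) wfA _ _ assms(6)])
    show "sat w (Zero # \<alpha> # n # ts) ?A" using X[OF w(2)] assms(4) typing.intros(2) by blast
    fix w' k assume k: "w \<sqsubseteq> w'" "tmw w' Nat k" "sat w' (k # \<alpha> # n # ts) ?A"
    then show "sat w' (Succ \<cdot> k # \<alpha> # n # ts) ?A"
      using X[OF k(1)] assms(5) typing.intros(5)[OF typing.intros(3)] by blast
  qed
  then show ?thesis using X[OF w(2) assms(6)] by blast
qed

end

section \<open>Forcing\<close>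

text \<open>\<open>interp e t\<close> is the value of \<open>t\<close> as a function of the generic sequence, the variables having
  the values \<open>e\<close>; \<open>sapp\<close> is pointwise application.\<close>

definition interp :: "tm list \<Rightarrow> tm \<Rightarrow> tm" where
  "interp e t = Lam BT (sub (senv 1 (map (\<lambda>x. ren Suc x \<cdot> Var 0) e)) t)"

definition konst :: "tm \<Rightarrow> tm" where
  "konst m = Lam BT (ren Suc m)"

definition sapp :: "tm \<Rightarrow> tm \<Rightarrow> tm" where
  "sapp f x = Lam BT (ren Suc f \<cdot> Var 0 \<cdot> (ren Suc x \<cdot> Var 0))"

abbreviation elts :: "ty list \<Rightarrow> ty list" where
  "elts \<equiv> map ((\<Rrightarrow>) BT)"

abbreviation app :: "tm list \<Rightarrow> tm \<Rightarrow> tm list" where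
  "app e \<beta> \<equiv> map (\<lambda>x. x \<cdot> \<beta>) e"

lemma interp_typing:
  assumes "typing \<Gamma> t \<tau>" "tms w e (elts \<Gamma>)"
  shows "tmw w (BT \<Rrightarrow> \<tau>) (interp e t)"
  unfolding interp_def
proof (rule typing.intros(6), rule typing_sub[OF assms(1)], unfold typed_sub_def, intro allI impI)
  fix i assume i: "i < length \<Gamma>"
  then have "i < length e" "tmw w (BT \<Rrightarrow> \<Gamma> ! i) (e ! i)"
    using assms(2) by (auto simp: list_all2_conv_all_nth)
  then show "typing (BT # ctx w) (senv 1 (map (\<lambda>x. ren Suc x \<cdot> Var 0) e) i) (\<Gamma> ! i)"
    by (auto simp: senv_def intro: typing.intros(5)[OF typing_ren_Suc typing_Var0])
qed

lemma sub_interp_body: "sub (env [\<beta>]) (sub (senv 1 (map (\<lambda>x. ren Suc x \<cdot> Var 0) e)) t) = sub (env (app e \<beta>)) t"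
  using senv_reindex[of "[\<beta>]" "[]" "map (\<lambda>x. ren Suc x \<cdot> Var 0) e"]
  by (simp add: sub_sub comp_def flip: senv_Cons)

lemma interp_beta:
  assumes "typing \<Gamma> t \<tau>" "tms w e (elts \<Gamma>)" "tmw w BT \<beta>"
  shows "eqv w \<tau> (interp e t \<cdot> \<beta>) (sub (env (app e \<beta>)) t)"
proof -
  have "typing (BT # ctx w) (sub (senv 1 (map (\<lambda>x. ren Suc x \<cdot> Var 0) e)) t) \<tau>"
    using interp_typing[OF assms(1,2)] unfolding interp_def by (auto elim: typing_LamE)
  from HA.Beta[OF this assms(3)] show ?thesis
    using sub_interp_body[of \<beta> e t] by (simp add: interp_def case_nat_Var)
qed

lemma konst_typing: "tmw w \<rho> m \<Longrightarrow> tmw w (BT \<Rrightarrow> \<rho>) (konst m)"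
  unfolding konst_def by (intro typing.intros typing_ren_Suc)

lemma konst_beta: "tmw w \<rho> m \<Longrightarrow> tmw w BT \<beta> \<Longrightarrow> eqv w \<rho> (konst m \<cdot> \<beta>) m"
  using HA.Beta[OF typing_ren_Suc, of "ctx w" m \<rho> \<beta> BT "hyps w"] by (simp add: konst_def)

lemma sapp_body:
  "typing \<Gamma> f (BT \<Rrightarrow> \<rho> \<Rrightarrow> \<tau>) \<Longrightarrow> typing \<Gamma> x (BT \<Rrightarrow> \<rho>)
    \<Longrightarrow> typing (BT # \<Gamma>) (ren Suc f \<cdot> Var 0 \<cdot> (ren Suc x \<cdot> Var 0)) \<tau>"
  by (blast intro: typing.intros(5) typing_ren_Suc typing_Var0)

lemma sapp_typing: "typing \<Gamma> f (BT \<Rrightarrow> \<rho> \<Rrightarrow> \<tau>) \<Longrightarrow> typing \<Gamma> x (BT \<Rrightarrow> \<rho>) \<Longrightarrow> typing \<Gamma> (sapp f x) (BT \<Rrightarrow> \<tau>)"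
  unfolding sapp_def by (intro typing.intros(6) sapp_body)

lemma sapp_beta:
  "tmw w (BT \<Rrightarrow> \<rho> \<Rrightarrow> \<tau>) f \<Longrightarrow> tmw w (BT \<Rrightarrow> \<rho>) x \<Longrightarrow> tmw w BT \<beta>
    \<Longrightarrow> eqv w \<tau> (sapp f x \<cdot> \<beta>) (f \<cdot> \<beta> \<cdot> (x \<cdot> \<beta>))"
  using HA.Beta[OF sapp_body, of "ctx w" f \<rho> \<tau> x \<beta> "hyps w"] by (simp add: sapp_def)

lemma sub_sapp [simp]: "sub \<sigma> (sapp f x) = sapp (sub \<sigma> f) (sub \<sigma> x)"
  by (simp add: sapp_def up_ren)

lemma sub_konst [simp]: "sub \<sigma> (konst m) = konst (sub \<sigma> m)"
  by (simp add: konst_def up_ren)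

lemma sub_env_ren_Suc [simp]: "sub (env (x # ts)) (ren Suc s) = sub (env ts) s"
  using sub_case_ren[of x "env ts" s] by (simp add: senv_Cons)

context bar begin

text \<open>Elements are functions of an arbitrary \<beta>, yet a condition confines \<beta> to its
  cone, so this relation and not provable equality is the identity of elements there.
  \<open>tame_agree\<close> and \<open>forces_agree\<close> show that it is respected.\<close>

fun agree :: "ty \<Rightarrow> cond \<Rightarrow> tm \<Rightarrow> tm \<Rightarrow> bool" where
  "agree \<rho> (w, \<alpha>, n) x y \<longleftrightarrow> (\<forall>w' \<beta>. w \<sqsubseteq> w' \<longrightarrow> tmw w' BT \<beta> \<longrightarrow> cone w' \<alpha> n \<beta> \<longrightarrow> eqv w' \<rho> (x \<cdot> \<beta>) (y \<cdot> \<beta>))"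

fun holds :: "fm \<Rightarrow> tm list \<Rightarrow> cond \<Rightarrow> bool" where
  "holds A e (w, \<alpha>, n) \<longleftrightarrow> (\<forall>w' \<beta>. w \<sqsubseteq> w' \<longrightarrow> tmw w' BT \<beta> \<longrightarrow> cone w' \<alpha> n \<beta> \<longrightarrow> sat w' (app e \<beta>) A)"

lemma agreeI:
  assumes "\<And>w' \<beta>. fst c \<sqsubseteq> w' \<Longrightarrow> tmw w' BT \<beta> \<Longrightarrow> eqv w' \<rho> (x \<cdot> \<beta>) (y \<cdot> \<beta>)"
  shows "agree \<rho> c x y"
  using assms by (cases c) simp

lemma agree_mono: "agree \<rho> c x y \<Longrightarrow> c \<preceq> c' \<Longrightarrow> agree \<rho> c' x y"
proof (cases c, cases c')
  fix w \<alpha> n w' \<alpha>' n' assume c: "c = (w, \<alpha>, n)" "c' = (w', \<alpha>', n')" and a: "agree \<rho> c x y" "c \<preceq> c'"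
  then have "w \<sqsubseteq> w'" "ext w' \<alpha> n \<alpha>' n'" by simp_all
  then show "agree \<rho> c' x y" using a(1) unfolding c agree.simps ext_def using wle_trans by blast
qed

lemma holds_mono: "holds A e c \<Longrightarrow> c \<preceq> c' \<Longrightarrow> holds A e c'"
proof (cases c, cases c')
  fix w \<alpha> n w' \<alpha>' n' assume c: "c = (w, \<alpha>, n)" "c' = (w', \<alpha>', n')" and a: "holds A e c" "c \<preceq> c'"
  then have "w \<sqsubseteq> w'" "ext w' \<alpha> n \<alpha>' n'" by simp_all
  then show "holds A e c'" using a(1) unfolding c holds.simps ext_def using wle_trans by blast
qed

lemma agree_sym: "agree \<rho> c x y \<Longrightarrow> agree \<rho> c y x"
  using eqv_sym by (cases c) simp

lemma agree_trans: "agree \<rho> c x y \<Longrightarrow> agree \<rho> c y z \<Longrightarrow> agree \<rho> c x z"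
  unfolding atomize_imp by (cases c, simp only: agree.simps) (use eqv_trans in blast)

lemma agree_refl: "tmw (fst c) (BT \<Rrightarrow> \<rho>) x \<Longrightarrow> agree \<rho> c x x"
  by (rule agreeI) (blast intro: HA.Refl typing.intros(5) tmw_mono)

lemma tmw_app: "tmw w (BT \<Rrightarrow> \<rho>) x \<Longrightarrow> w \<sqsubseteq> w' \<Longrightarrow> tmw w' BT \<beta> \<Longrightarrow> tmw w' \<rho> (x \<cdot> \<beta>)"
  by (blast intro: typing.intros(5) tmw_mono)

lemma tms_app:
  assumes "tms w e (elts \<Gamma>)" "w \<sqsubseteq> w'" "tmw w' BT \<beta>"
  shows "tms w' (app e \<beta>) \<Gamma>"
  using assms(1) tmw_app[OF _ assms(2,3)] by (auto simp: list_all2_conv_all_nth)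

lemma agree_sapp:
  assumes "agree (\<rho> \<Rrightarrow> \<tau>) c f g" "agree \<rho> c x y"
    and "tmw (fst c) (BT \<Rrightarrow> \<rho> \<Rrightarrow> \<tau>) f" "tmw (fst c) (BT \<Rrightarrow> \<rho> \<Rrightarrow> \<tau>) g"
    and "tmw (fst c) (BT \<Rrightarrow> \<rho>) x" "tmw (fst c) (BT \<Rrightarrow> \<rho>) y"
  shows "agree \<tau> c (sapp f x) (sapp g y)"
proof -
  obtain w \<alpha> n where c: "c = (w, \<alpha>, n)" by (cases c)
  show ?thesis unfolding c agree.simps
  proof (intro allI impI)
    fix w' \<beta> assume *: "w \<sqsubseteq> w'" "tmw w' BT \<beta>" "cone w' \<alpha> n \<beta>"
    have "eqv w' (\<rho> \<Rrightarrow> \<tau>) (f \<cdot> \<beta>) (g \<cdot> \<beta>)" "eqv w' \<rho> (x \<cdot> \<beta>) (y \<cdot> \<beta>)"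
      using assms(1,2) * unfolding c by auto
    then have "eqv w' \<tau> (f \<cdot> \<beta> \<cdot> (x \<cdot> \<beta>)) (g \<cdot> \<beta> \<cdot> (y \<cdot> \<beta>))" by (rule eqv_App)
    then show "eqv w' \<tau> (sapp f x \<cdot> \<beta>) (sapp g y \<cdot> \<beta>)"
      using sapp_beta[OF _ _ *(2)] assms(3-6) tmw_mono[OF *(1)] unfolding c fst_conv
      by (meson eqv_trans eqv_sym)
  qed
qed

text \<open>The objects over which the forced quantifiers range. Of type \<open>Nat\<close> they are the locally constant
  ones, which is what continuity in the generic sequence amounts to.\<close>

primrec tame :: "ty \<Rightarrow> tm \<Rightarrow> cond \<Rightarrow> bool" where
  "tame Nat x = j (\<lambda>c. \<exists>m. tmw (fst c) Nat m \<and> agree Nat c x (konst m))"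
| "tame (\<rho> \<Rrightarrow> \<tau>) f = (\<lambda>c. \<forall>c'. c \<preceq> c' \<longrightarrow>
     (\<forall>x. tmw (fst c') (BT \<Rrightarrow> \<rho>) x \<longrightarrow> tame \<rho> x c' \<longrightarrow> tame \<tau> (sapp f x) c'))"

text \<open>Conjunction, implication and universal quantification inherit closure under
  \<open>j\<close> from their parts, so only the remaining clauses begin with it. Falsity comes to
  mean that Q holds at all later conditions.\<close>

primrec forces :: "fm \<Rightarrow> tm list \<Rightarrow> cond \<Rightarrow> bool" where
  "forces (Eq \<rho> s t) e = j (holds (Eq \<rho> s t) e)"
| "forces Bot e = j (\<lambda>c. False)"
| "forces (A \<^bold>\<and> B) e = (\<lambda>c. forces A e c \<and> forces B e c)"
| "forces (A \<^bold>\<or> B) e = j (\<lambda>c. forces A e c \<or> forces B e c)"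
| "forces (A \<^bold>\<longrightarrow> B) e = (\<lambda>c. (\<forall>c'. c \<preceq> c' \<longrightarrow> forces A e c' \<longrightarrow> forces B e c') \<and> j (holds (A \<^bold>\<longrightarrow> B) e) c)"
| "forces (All \<rho> A) e = (\<lambda>c. (\<forall>c'. c \<preceq> c' \<longrightarrow> (\<forall>x. tmw (fst c') (BT \<Rrightarrow> \<rho>) x \<longrightarrow> tame \<rho> x c' \<longrightarrow>
     forces A (x # e) c')) \<and> j (holds (All \<rho> A) e) c)"
| "forces (Ex \<rho> A) e = j (\<lambda>c. \<exists>x. tmw (fst c) (BT \<Rrightarrow> \<rho>) x \<and> tame \<rho> x c \<and> forces A (x # e) c)"

lemma tame_mono: "tame \<rho> x c \<Longrightarrow> c \<preceq> c' \<Longrightarrow> tame \<rho> x c'"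
  by (cases \<rho>) (auto intro: j_up cond_le_trans)

lemma forces_mono: "forces A e c \<Longrightarrow> c \<preceq> c' \<Longrightarrow> forces A e c'"
  by (induction A arbitrary: e) (auto intro: j_up cond_le_trans)

lemma tmw_cond_le: "c \<preceq> c' \<Longrightarrow> tmw (fst c) \<rho> x \<Longrightarrow> tmw (fst c') \<rho> x"
  using cond_le_wle tmw_mono by blast

lemma tms_cond_le: "c \<preceq> c' \<Longrightarrow> tms (fst c) e \<Theta> \<Longrightarrow> tms (fst c') e \<Theta>"
  using cond_le_wle tms_mono by blast

lemma tame_local: "j (tame \<rho> x) c \<Longrightarrow> tame \<rho> x c"
proof (induction \<rho> arbitrary: x c)
  case (Fun \<rho> \<tau>)
  show ?case unfolding tame.simps
  proof (intro allI impI)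
    fix c' y assume *: "c \<preceq> c'" "tmw (fst c') (BT \<Rrightarrow> \<rho>) y" "tame \<rho> y c'"
    have "j (tame \<tau> (sapp x y)) c'"
      by (rule j_mono[OF j_up[OF Fun.prems *(1)]])
        (use *(2,3) tame_mono tmw_cond_le cond_le_refl cond_le_cond_ok(2) in auto)
    then show "tame \<tau> (sapp x y) c'" by (rule Fun.IH(2))
  qed
qed (simp add: j_j)

text \<open>Closure under \<open>j\<close> is what permits elimination of disjunctions and
  existential quantifiers into arbitrary formulas, and reasoning on a cover where an element is
  constant.\<close>

lemma forces_local: "j (forces A e) c \<Longrightarrow> forces A e c"
proof (induction A arbitrary: e c)
  case (And A B)
  show ?case using And.IH[OF j_mono[OF And.prems]] by simp
next
  case (Imp A B)
  have "forces B e c'" if *: "c \<preceq> c'" "forces A e c'" for c'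
    by (rule Imp.IH(2), rule j_mono[OF j_up[OF Imp.prems *(1)]])
      (use *(2) forces_mono cond_le_refl cond_le_cond_ok(2) in auto)
  moreover have "j (holds (A \<^bold>\<longrightarrow> B) e) c" by (rule j_bind[OF Imp.prems]) simp
  ultimately show ?case by simp
next
  case (All \<rho> A)
  have "forces A (x # e) c'" if *: "c \<preceq> c'" "tmw (fst c') (BT \<Rrightarrow> \<rho>) x" "tame \<rho> x c'" for c' x
    by (rule All.IH, rule j_mono[OF j_up[OF All.prems *(1)]])
      (use *(2,3) tame_mono tmw_cond_le cond_le_refl cond_le_cond_ok(2) in auto)
  moreover have "j (holds (All \<rho> A) e) c" by (rule j_bind[OF All.prems]) simp
  ultimately show ?case by simp
qed (simp_all add: j_j)

lemma tame_agree:
  "agree \<rho> c x y \<Longrightarrow> tmw (fst c) (BT \<Rrightarrow> \<rho>) x \<Longrightarrow> tmw (fst c) (BT \<Rrightarrow> \<rho>) y \<Longrightarrow> tame \<rho> x c \<Longrightarrow> tame \<rho> y c"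
proof (induction \<rho> arbitrary: x y c)
  case Nat
  then show ?case using agree_mono agree_sym agree_trans unfolding tame.simps by (blast intro: j_mono)
next
  case (Fun \<rho> \<tau>)
  show ?case unfolding tame.simps
  proof (intro allI impI)
    fix c' z assume *: "c \<preceq> c'" "tmw (fst c') (BT \<Rrightarrow> \<rho>) z" "tame \<rho> z c'"
    note t = tmw_cond_le[OF *(1) Fun.prems(2)] tmw_cond_le[OF *(1) Fun.prems(3)]
    show "tame \<tau> (sapp y z) c'"
    proof (rule Fun.IH(2))
      show "agree \<tau> c' (sapp x z) (sapp y z)"
        by (rule agree_sapp[OF agree_mono[OF Fun.prems(1) *(1)] agree_refl[OF *(2)] t *(2) *(2)])
      show "tame \<tau> (sapp x z) c'" using Fun.prems(4) * by simp
    qed (use t *(2) sapp_typing in blast)+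
  qed
qed

text \<open>Up to agreement on the condition, \<open>e'\<close> is the composite of \<sigma> with
  \<open>e\<close>. Agreement is the right notion because beta reduction is only a provable
  equation, and this one relation covers weakening, instantiation, the successor instance and the
  exchange of agreeing environments.\<close>

definition subst_ok :: "cond \<Rightarrow> ty list \<Rightarrow> ty list \<Rightarrow> (nat \<Rightarrow> tm) \<Rightarrow> tm list \<Rightarrow> tm list \<Rightarrow> bool" where
  "subst_ok c \<Gamma>' \<Gamma> \<sigma> e e' \<longleftrightarrow> cond_ok c \<and> typed_sub \<Gamma>' \<sigma> \<Gamma> \<and> tms (fst c) e (elts \<Gamma>') \<and> tms (fst c) e' (elts \<Gamma>) \<and>
     (\<forall>i < length \<Gamma>. agree (\<Gamma> ! i) c (e' ! i) (interp e (\<sigma> i)))"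

lemma subst_ok_mono: "subst_ok c \<Gamma>' \<Gamma> \<sigma> e e' \<Longrightarrow> c \<preceq> c' \<Longrightarrow> subst_ok c' \<Gamma>' \<Gamma> \<sigma> e e'"
  unfolding subst_ok_def using cond_le_cond_ok(2) tms_cond_le agree_mono by blast

lemma interp_ren: "interp (x # e) (ren Suc t) = interp e t"
proof -
  have "senv 1 (a # as) \<circ> Suc = senv 1 as" for a as by (auto simp: fun_eq_iff)
  then show ?thesis by (simp add: interp_def sub_ren)
qed

lemma agree_interp_Var:
  assumes "tms (fst c) e (elts \<Gamma>)" "i < length \<Gamma>"
  shows "agree (\<Gamma> ! i) c (e ! i) (interp e (Var i))"
proof (rule agreeI, rule eqv_sym)
  fix w' \<beta> assume *: "fst c \<sqsubseteq> w'" "tmw w' BT \<beta>"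
  have "i < length e" using assms list_all2_lengthD by fastforce
  then show "eqv w' (\<Gamma> ! i) (interp e (Var i) \<cdot> \<beta>) (e ! i \<cdot> \<beta>)"
    using interp_beta[of \<Gamma> "Var i" "\<Gamma> ! i" w' e \<beta>] tms_mono[OF *(1) assms(1)] *(2) assms(2)
    by (simp add: senv_def)
qed

lemma subst_ok_up:
  assumes "subst_ok c \<Gamma>' \<Gamma> \<sigma> e e'" "tmw (fst c) (BT \<Rrightarrow> \<rho>) x"
  shows "subst_ok c (\<rho> # \<Gamma>') (\<rho> # \<Gamma>) (up \<sigma>) (x # e) (x # e')"
proof -
  have "agree ((\<rho> # \<Gamma>) ! i) c ((x # e') ! i) (interp (x # e) (up \<sigma> i))" if "i < length (\<rho> # \<Gamma>)" for i
    using that assms agree_interp_Var[of c "x # e" "\<rho> # \<Gamma>'" 0]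
    by (cases i) (auto simp: subst_ok_def interp_ren)
  then show ?thesis using assms typed_sub_up unfolding subst_ok_def by auto
qed

lemma holds_subst:
  assumes "wff \<Gamma> A" "subst_ok c \<Gamma>' \<Gamma> \<sigma> e e'"
  shows "holds (fsub \<sigma> A) e c \<longleftrightarrow> holds A e' c"
proof -
  obtain w \<alpha> n where c: "c = (w, \<alpha>, n)" by (cases c)
  have "sat w' (app e \<beta>) (fsub \<sigma> A) \<longleftrightarrow> sat w' (app e' \<beta>) A"
    if *: "w \<sqsubseteq> w'" "tmw w' BT \<beta>" "cone w' \<alpha> n \<beta>" for w' \<beta>
  proof -
    have "eqv w' (\<Gamma> ! i) (env (app e' \<beta>) i) ((sub (env (app e \<beta>)) \<circ> \<sigma>) i)" if i: "i < length \<Gamma>" for i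
    proof -
      have l: "i < length e'" using assms(2) i list_all2_lengthD unfolding subst_ok_def by fastforce
      have "eqv w' (\<Gamma> ! i) (e' ! i \<cdot> \<beta>) (interp e (\<sigma> i) \<cdot> \<beta>)"
        using assms(2) i * unfolding subst_ok_def c by simp
      also have "eqv w' (\<Gamma> ! i) (interp e (\<sigma> i) \<cdot> \<beta>) (sub (env (app e \<beta>)) (\<sigma> i))"
        using assms(2) i tms_mono[OF *(1)] unfolding subst_ok_def typed_sub_def c
        by (intro interp_beta[OF _ _ *(2), of \<Gamma>']) auto
      finally show ?thesis using l by (simp add: senv_def)
    qed
    then show ?thesis
      using fsub_eqv[OF assms(1) wle_valid(2)[OF *(1)]] eqv_sym unfolding fsub_fsub by blast
  qed
  then show ?thesis unfolding c holds.simps by blast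
qed

lemma j_cong: "(\<And>c'. c \<preceq> c' \<Longrightarrow> X c' \<longleftrightarrow> Y c') \<Longrightarrow> j X c \<longleftrightarrow> j Y c"
  using j_mono[of X c Y] j_mono[of Y c X] by blast

lemma j_holds_subst:
  assumes "wff \<Gamma> A" "subst_ok c \<Gamma>' \<Gamma> \<sigma> e e'"
  shows "j (holds (fsub \<sigma> A) e) c \<longleftrightarrow> j (holds A e') c"
  by (rule j_cong, rule holds_subst[OF assms(1) subst_ok_mono[OF assms(2)]])

lemma forces_subst:
  "wff \<Gamma> A \<Longrightarrow> subst_ok c \<Gamma>' \<Gamma> \<sigma> e e' \<Longrightarrow> forces (fsub \<sigma> A) e c \<longleftrightarrow> forces A e' c"
proof (induction A arbitrary: \<Gamma> \<Gamma>' \<sigma> e e' c)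
  case (Eq \<rho> s t)
  show ?case using j_holds_subst[OF Eq.prems] by simp
next
  case (And A B)
  have "wff \<Gamma> A" "wff \<Gamma> B" using And.prems(1) by simp_all
  then show ?case using And.IH[OF _ And.prems(2)] by simp
next
  case (Or A B)
  have wf: "wff \<Gamma> A" "wff \<Gamma> B" using Or.prems(1) by simp_all
  show ?case unfolding fsub.simps forces.simps
    proof (rule j_cong)
    fix c' assume "c \<preceq> c'"
    note ok = subst_ok_mono[OF Or.prems(2) this]
    show "forces (fsub \<sigma> A) e c' \<or> forces (fsub \<sigma> B) e c' \<longleftrightarrow> forces A e' c' \<or> forces B e' c'"
      unfolding Or.IH(1)[OF wf(1) ok] Or.IH(2)[OF wf(2) ok] ..
  qed
next
  case (Imp A B)
  have wf: "wff \<Gamma> A" "wff \<Gamma> B" using Imp.prems(1) by simp_all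
  have "forces (fsub \<sigma> A) e c' \<longleftrightarrow> forces A e' c'" "forces (fsub \<sigma> B) e c' \<longleftrightarrow> forces B e' c'"
    if "c \<preceq> c'" for c'
    using Imp.IH(1)[OF wf(1) subst_ok_mono[OF Imp.prems(2) that]]
      Imp.IH(2)[OF wf(2) subst_ok_mono[OF Imp.prems(2) that]] .
  moreover have "j (holds (fsub \<sigma> A \<^bold>\<longrightarrow> fsub \<sigma> B) e) c \<longleftrightarrow> j (holds (A \<^bold>\<longrightarrow> B) e') c"
    using j_holds_subst[OF Imp.prems] by simp
  ultimately show ?case unfolding fsub.simps forces.simps by simp
next
  case (All \<rho> A)
  have wf: "wff (\<rho> # \<Gamma>) A" using All.prems(1) by simp
  have "forces (fsub (up \<sigma>) A) (x # e) c' \<longleftrightarrow> forces A (x # e') c'" 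
    if "c \<preceq> c'" "tmw (fst c') (BT \<Rrightarrow> \<rho>) x" for c' x
    by (rule All.IH[OF wf subst_ok_up[OF subst_ok_mono[OF All.prems(2) that(1)] that(2)]])
  moreover have "j (holds (All \<rho> (fsub (up \<sigma>) A)) e) c \<longleftrightarrow> j (holds (All \<rho> A) e') c"
    using j_holds_subst[OF All.prems] by simp
  ultimately show ?case unfolding fsub.simps forces.simps by simp
next
  case (Ex \<rho> A)
  have wf: "wff (\<rho> # \<Gamma>) A" using Ex.prems(1) by simp
  have "forces (fsub (up \<sigma>) A) (x # e) c' \<longleftrightarrow> forces A (x # e') c'" 
    if "c \<preceq> c'" "tmw (fst c') (BT \<Rrightarrow> \<rho>) x" for c' x
    by (rule Ex.IH[OF wf subst_ok_up[OF subst_ok_mono[OF Ex.prems(2) that(1)] that(2)]])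
  then show ?case unfolding fsub.simps forces.simps by (intro j_cong ex_cong1) blast
qed simp

text \<open>The case of the identity substitution: an element and the interpretation of its variable
  agree by beta.\<close>

lemma forces_agree:
  assumes "wff \<Gamma> A" "cond_ok c" "tms (fst c) e (elts \<Gamma>)" "tms (fst c) e' (elts \<Gamma>)"
    and "\<And>i. i < length \<Gamma> \<Longrightarrow> agree (\<Gamma> ! i) c (e' ! i) (e ! i)"
  shows "forces A e c \<longleftrightarrow> forces A e' c"
proof -
  have "subst_ok c \<Gamma> \<Gamma> Var e e'"
    using assms agree_interp_Var agree_trans unfolding subst_ok_def by (blast intro: typed_sub_Var)
  from forces_subst[OF assms(1) this] show ?thesis by simp
qed

section \<open>Definability of tameness and of forcing\<close>

lemma defin_allimp:
  assumes "defin (\<sigma> # \<Theta>) X" "defin (\<sigma> # \<Theta>) Y"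
  shows "defin \<Theta> (\<lambda>ts c. \<forall>c'. c \<preceq> c' \<longrightarrow> (\<forall>x. tmw (fst c') \<sigma> x \<longrightarrow> X (x # ts) c' \<longrightarrow> Y (x # ts) c'))"
proof (rule defin_cong[OF defin_all[OF defin_imp[OF assms]]], goal_cases)
  case (1 c ts)
  show ?case
  proof (intro iffI allI impI, goal_cases)
    case (1 c' x c'')
    then show ?case using cond_le_trans[OF 1(2,4)] tmw_cond_le[OF 1(4,3)] by simp
  next
    case (2 c' x)
    then show ?case using cond_le_refl[OF cond_le_cond_ok(2)[OF 2(2)]] by simp
  qed
qed

lemma defin_agree:
  assumes "typing (\<Theta> @ ctx w0) s (BT \<Rrightarrow> \<rho>)" "typing (\<Theta> @ ctx w0) t (BT \<Rrightarrow> \<rho>)"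
  shows "defin \<Theta> (\<lambda>ts c. agree \<rho> c (sub (env ts) s) (sub (env ts) t))"
proof -
  have "typing (BT # \<Theta> @ ctx w0) (ren Suc s \<cdot> Var 0) \<rho>" "typing (BT # \<Theta> @ ctx w0) (ren Suc t \<cdot> Var 0) \<rho>"
    using assms by (blast intro: typing.intros(5) typing_ren_Suc typing_Var0)+
  then have "wf (BT # \<Theta>) (Eq \<rho> (ren Suc s \<cdot> Var 0) (ren Suc t \<cdot> Var 0))" by simp
  from defin_cone[OF this] show ?thesis
  proof (rule defin_cong, goal_cases)
    case (1 c ts)
    show ?case by (cases c) (simp only: agree.simps prod.case fsub.simps sub.simps sub_env_ren_Suc senv_simps)
  qed
qed

text \<open>Stated for a term \<open>s\<close> rather than a variable, since at function types the
  induction meets \<open>sapp\<close> of two terms.\<close>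

lemma defin_tame: "typing (\<Theta> @ ctx w0) s (BT \<Rrightarrow> \<rho>) \<Longrightarrow> defin \<Theta> (\<lambda>ts. tame \<rho> (sub (env ts) s))"
proof (induction \<rho> arbitrary: \<Theta> s)
  case Nat
  have "typing ((Nat # \<Theta>) @ ctx w0) (ren Suc s) (BT \<Rrightarrow> Nat)" "typing ((Nat # \<Theta>) @ ctx w0) (konst (Var 0)) (BT \<Rrightarrow> Nat)"
    using Nat by (auto simp: konst_def intro: typing_ren_Suc typing.intros)
  from defin_jex[OF defin_agree[OF this]] show ?case by simp
next
  case (Fun \<rho> \<tau>)
  have s: "typing (((BT \<Rrightarrow> \<rho>) # \<Theta>) @ ctx w0) (ren Suc s) (BT \<Rrightarrow> \<rho> \<Rrightarrow> \<tau>)"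
      and x: "typing (((BT \<Rrightarrow> \<rho>) # \<Theta>) @ ctx w0) (Var 0) (BT \<Rrightarrow> \<rho>)"
    using Fun.prems by (auto intro: typing_ren_Suc)
  show ?case
    using defin_allimp[OF Fun.IH(1)[OF x] Fun.IH(2)[OF sapp_typing[OF s x]]] by simp
qed

lemma defin_holds:
  assumes "wff \<Gamma> A"
  shows "defin (elts \<Gamma>) (holds A)"
proof -
  \<comment> \<open>Index 0 is \<beta> and index i + 1 the i-th element, so these are the values of
    the elements at \<beta>.\<close>
  let ?ss = "map (\<lambda>i. Var (Suc i) \<cdot> Var 0) [0..<length \<Gamma>]"
  let ?k = "length (BT # elts \<Gamma>)"
  have "list_all2 (typing ((BT # elts \<Gamma>) @ [] @ ctx w0)) ?ss \<Gamma>"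
    by (auto simp: list_all2_conv_all_nth nth_append intro!: typing.intros(5)[of _ _ BT])
  then have wfA: "wf (BT # elts \<Gamma>) (fsub (senv ?k ?ss) A)"
    using wf_reindex[OF wff_append[OF assms], of "BT # elts \<Gamma>" ?k "[]" ?ss \<Gamma>] by simp
  have ss: "fsub (env (\<beta> # ts)) (fsub (senv ?k ?ss) A) = fsub (env (app ts \<beta>)) A"
    if "length ts = length \<Gamma>" for \<beta> ts
  proof -
    have "map (sub (env (\<beta> # ts))) ?ss = app ts \<beta>"
      using that by (auto simp: senv_def intro!: nth_equalityI)
    then show ?thesis using fsub_reindex[of "\<beta> # ts" ?k "[]" ?ss] that by simp
  qed
  show ?thesis
  proof (rule defin_cong[OF defin_cone[OF wfA]], goal_cases)
    case (1 c ts)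
    then have "length ts = length \<Gamma>" using list_all2_lengthD by fastforce
    then show ?case by (cases c) (simp only: ss holds.simps prod.case)
  qed
qed

lemma defin_forces: "wff \<Gamma> A \<Longrightarrow> defin (elts \<Gamma>) (forces A)"
proof (induction A arbitrary: \<Gamma>)
  case (Eq \<rho> s t)
  show ?case using defin_j[OF defin_holds[OF Eq.prems]] by (rule defin_cong) simp
next
  case Bot
  show ?case using defin_cext[OF defin_Q] by (rule defin_cong) (simp add: j_def)
next
  case (And A B)
  have "defin (elts \<Gamma>) (forces A)" "defin (elts \<Gamma>) (forces B)" using And by simp_all
  from defin_and[OF this] show ?case by (rule defin_cong) simp
next
  case (Or A B)
  have "defin (elts \<Gamma>) (forces A)" "defin (elts \<Gamma>) (forces B)" using Or by simp_all
  from defin_jor[OF this] show ?case by (rule defin_cong) simp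
next
  case (Imp A B)
  have "defin (elts \<Gamma>) (forces A)" "defin (elts \<Gamma>) (forces B)" using Imp by simp_all
  from defin_and[OF defin_imp[OF this] defin_j[OF defin_holds[OF Imp.prems]]] show ?case
    by (rule defin_cong) simp
next
  case (All \<rho> A)
  have A: "defin ((BT \<Rrightarrow> \<rho>) # elts \<Gamma>) (forces A)" using All.IH[of "\<rho> # \<Gamma>"] All.prems by simp
  have x: "typing (((BT \<Rrightarrow> \<rho>) # elts \<Gamma>) @ ctx w0) (Var 0) (BT \<Rrightarrow> \<rho>)" by simp
  from defin_and[OF defin_allimp[OF defin_tame[OF x] A] defin_j[OF defin_holds[OF All.prems]]] show ?case
    by (rule defin_cong) simp
next
  case (Ex \<rho> A)
  have A: "defin ((BT \<Rrightarrow> \<rho>) # elts \<Gamma>) (forces A)" using Ex.IH[of "\<rho> # \<Gamma>"] Ex.prems by simp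
  have x: "typing (((BT \<Rrightarrow> \<rho>) # elts \<Gamma>) @ ctx w0) (Var 0) (BT \<Rrightarrow> \<rho>)" by simp
  from defin_jex[OF defin_and[OF defin_tame[OF x] A]] show ?case
    by (rule defin_cong) simp
qed


section \<open>Soundness\<close>

definition good :: "ty list \<Rightarrow> tm list \<Rightarrow> cond \<Rightarrow> bool" where
  "good \<Gamma> e c \<longleftrightarrow> cond_ok c \<and> tms (fst c) e (elts \<Gamma>) \<and> (\<forall>i < length \<Gamma>. tame (\<Gamma> ! i) (e ! i) c)"

lemma good_mono: "good \<Gamma> e c \<Longrightarrow> c \<preceq> c' \<Longrightarrow> good \<Gamma> e c'"
  unfolding good_def using cond_le_cond_ok(2) tms_cond_le tame_mono by blast

lemma good_Cons: "good \<Gamma> e c \<Longrightarrow> tmw (fst c) (BT \<Rrightarrow> \<rho>) x \<Longrightarrow> tame \<rho> x c \<Longrightarrow> good (\<rho> # \<Gamma>) (x # e) c"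
  unfolding good_def by (auto simp: nth_Cons split: nat.split)

lemma good_typed: "good \<Gamma> e c \<Longrightarrow> typing \<Gamma> t \<tau> \<Longrightarrow> tmw (fst c) (BT \<Rrightarrow> \<tau>) (interp e t)"
  unfolding good_def using interp_typing by blast

lemma agree_val:
  assumes "\<And>w' \<beta>. fst c \<sqsubseteq> w' \<Longrightarrow> tmw w' BT \<beta> \<Longrightarrow> eqv w' \<rho> (x \<cdot> \<beta>) (v \<beta>)"
    and "\<And>w' \<beta>. fst c \<sqsubseteq> w' \<Longrightarrow> tmw w' BT \<beta> \<Longrightarrow> eqv w' \<rho> (y \<cdot> \<beta>) (v \<beta>)"
  shows "agree \<rho> c x y"
  by (rule agreeI) (rule eqv_trans[OF assms(1) eqv_sym[OF assms(2)]])

lemma tame_konst: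
  assumes "cond_ok c" "tmw (fst c) Nat m"
  shows "tame Nat (konst m) c"
  unfolding tame.simps
proof (rule j_ret)
  fix c' assume "c \<preceq> c'"
  then have m: "tmw (fst c') Nat m" using assms(2) by (rule tmw_cond_le)
  then show "\<exists>k. tmw (fst c') Nat k \<and> agree Nat c' (konst m) (konst k)"
    using agree_refl[OF konst_typing[OF m]] by blast
qed

section \<open>Recursors and the fundamental lemma of the logical relation\<close>

definition rec_el :: "ty \<Rightarrow> tm \<Rightarrow> tm \<Rightarrow> tm \<Rightarrow> tm" where
  "rec_el \<rho> a f n = sapp (sapp (sapp (Lam BT (Rec \<rho>)) a) f) n"

abbreviation stepty :: "ty \<Rightarrow> ty" where
  "stepty \<rho> \<equiv> Nat \<Rrightarrow> \<rho> \<Rrightarrow> \<rho>"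

lemma Rec_typing: "typing \<Gamma> (Lam BT (Rec \<rho>)) (BT \<Rrightarrow> \<rho> \<Rrightarrow> stepty \<rho> \<Rrightarrow> Nat \<Rrightarrow> \<rho>)"
  by (intro typing.intros)

lemma rec_el_typing:
  "typing \<Gamma> a (BT \<Rrightarrow> \<rho>) \<Longrightarrow> typing \<Gamma> f (BT \<Rrightarrow> stepty \<rho>) \<Longrightarrow> typing \<Gamma> n (BT \<Rrightarrow> Nat)
    \<Longrightarrow> typing \<Gamma> (rec_el \<rho> a f n) (BT \<Rrightarrow> \<rho>)"
  unfolding rec_el_def by (blast intro: sapp_typing Rec_typing)

lemma rec_el_beta:
  assumes "tmw w (BT \<Rrightarrow> \<rho>) a" "tmw w (BT \<Rrightarrow> stepty \<rho>) f" "tmw w (BT \<Rrightarrow> Nat) n" "tmw w BT \<beta>"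
  shows "eqv w \<rho> (rec_el \<rho> a f n \<cdot> \<beta>) (Rec \<rho> \<cdot> (a \<cdot> \<beta>) \<cdot> (f \<cdot> \<beta>) \<cdot> (n \<cdot> \<beta>))"
proof -
  let ?R = "Lam BT (Rec \<rho>)"
  note R = Rec_typing[of "ctx w" \<rho>]
  note Ra = sapp_typing[OF R assms(1)]
  note Raf = sapp_typing[OF Ra assms(2)]
  have v: "eqv w (BT \<Rrightarrow> Nat) n n" "eqv w (BT \<Rrightarrow> stepty \<rho>) f f" "eqv w (BT \<Rrightarrow> \<rho>) a a" "eqv w BT \<beta> \<beta>"
    using assms by (auto intro: HA.Refl)
  have 1: "eqv w (\<rho> \<Rrightarrow> stepty \<rho> \<Rrightarrow> Nat \<Rrightarrow> \<rho>) (?R \<cdot> \<beta>) (Rec \<rho>)"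
    using HA.Beta[OF typing.intros(4)[of "BT # ctx w" \<rho>] assms(4), of "hyps w"] by simp
  have 2: "eqv w (stepty \<rho> \<Rrightarrow> Nat \<Rrightarrow> \<rho>) (sapp ?R a \<cdot> \<beta>) (Rec \<rho> \<cdot> (a \<cdot> \<beta>))"
    using sapp_beta[OF R assms(1,4)] eqv_App[OF 1 eqv_App[OF v(3,4)]] by (rule eqv_trans)
  have 3: "eqv w (Nat \<Rrightarrow> \<rho>) (sapp (sapp ?R a) f \<cdot> \<beta>) (Rec \<rho> \<cdot> (a \<cdot> \<beta>) \<cdot> (f \<cdot> \<beta>))"
    using sapp_beta[OF Ra assms(2,4)] eqv_App[OF 2 eqv_App[OF v(2,4)]] by (rule eqv_trans)
  show ?thesis unfolding rec_el_def
    using sapp_beta[OF Raf assms(3,4)] eqv_App[OF 3 eqv_App[OF v(1,4)]] by (rule eqv_trans)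
qed

text \<open>Induction inside the theory on m, available because tameness is definable. At a
  successor the recursor agrees with f applied to the constant k and the previous value, which is
  tame because f is.\<close>

lemma tame_rec_el_numeral:
  assumes "cond_ok c" "tmw (fst c) (BT \<Rrightarrow> \<rho>) a" "tmw (fst c) (BT \<Rrightarrow> stepty \<rho>) f" "tame \<rho> a c" "tame (stepty \<rho>) f c"
    and "tmw (fst c) Nat m"
  shows "tame \<rho> (rec_el \<rho> a f (konst m)) c"
proof -
  obtain w \<alpha> n where c: "c = (w, \<alpha>, n)" by (cases c)
  let ?\<Theta> = "[BT \<Rrightarrow> stepty \<rho>, BT \<Rrightarrow> \<rho>]"
  let ?s = "rec_el \<rho> (Var 2) (Var 1) (konst (Var 0))"
  have K0: "typing ((Nat # ?\<Theta>) @ ctx w0) (konst (Var 0)) (BT \<Rrightarrow> Nat)"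
    by (simp add: konst_def typing.intros)
  have s: "typing ((Nat # ?\<Theta>) @ ctx w0) ?s (BT \<Rrightarrow> \<rho>)"
    by (rule rec_el_typing[OF _ _ K0]) simp_all
  have sub: "sub (env [k, f, a]) ?s = rec_el \<rho> a f (konst k)" for k
    by (simp add: rec_el_def)
  have "tame \<rho> (sub (env (m # [f, a])) ?s) (w, \<alpha>, n)"
  proof (rule defin_Ind[OF defin_tame[OF s]])
    show "cond_ok (w, \<alpha>, n)" "tmw w Nat m" "tms w [f, a] ?\<Theta>" using assms c by auto
    have t: "tmw w (BT \<Rrightarrow> \<rho>) a" "tmw w (BT \<Rrightarrow> stepty \<rho>) f" using assms c by auto
    have "agree \<rho> (w, \<alpha>, n) a (rec_el \<rho> a f (konst Zero))"
    proof (rule agreeI, rule eqv_sym)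
      fix w' \<beta> assume *: "fst (w, \<alpha>, n) \<sqsubseteq> w'" "tmw w' BT \<beta>"
      then have w': "w \<sqsubseteq> w'" by simp
      note t' = tmw_mono[OF w' t(1)] tmw_mono[OF w' t(2)]
      have z: "tmw w' Nat Zero" by (rule typing.intros)
      have v: "tmw w' \<rho> (a \<cdot> \<beta>)" "tmw w' (stepty \<rho>) (f \<cdot> \<beta>)"
        using t' *(2) by (blast intro: typing.intros(5))+
      have "eqv w' \<rho> (rec_el \<rho> a f (konst Zero) \<cdot> \<beta>) (Rec \<rho> \<cdot> (a \<cdot> \<beta>) \<cdot> (f \<cdot> \<beta>) \<cdot> (konst Zero \<cdot> \<beta>))"
        by (rule rec_el_beta[OF t' konst_typing[OF z] *(2)])
      also have "eqv w' \<rho> (Rec \<rho> \<cdot> (a \<cdot> \<beta>) \<cdot> (f \<cdot> \<beta>) \<cdot> (konst Zero \<cdot> \<beta>)) (Rec \<rho> \<cdot> (a \<cdot> \<beta>) \<cdot> (f \<cdot> \<beta>) \<cdot> Zero)"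
        by (rule eqv_App[OF HA.Refl konst_beta[OF z *(2)]]) (use v in \<open>blast intro: typing.intros\<close>)
      also have "eqv w' \<rho> (Rec \<rho> \<cdot> (a \<cdot> \<beta>) \<cdot> (f \<cdot> \<beta>) \<cdot> Zero) (a \<cdot> \<beta>)"
        using v by (rule HA.RecZero)
      finally show "eqv w' \<rho> (rec_el \<rho> a f (konst Zero) \<cdot> \<beta>) (a \<cdot> \<beta>)" .
    qed
    then have "tame \<rho> (rec_el \<rho> a f (konst Zero)) (w, \<alpha>, n)"
      by (rule tame_agree) (use assms c t in \<open>auto intro: rec_el_typing konst_typing typing.intros(2)\<close>)
    then show "tame \<rho> (sub (env (Zero # [f, a])) ?s) (w, \<alpha>, n)" unfolding sub .
  next
    fix w1 k assume *: "w \<sqsubseteq> w1" "tmw w1 Nat k" "tame \<rho> (sub (env (k # [f, a])) ?s) (w1, \<alpha>, n)"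
    let ?c = "(w1, \<alpha>, n)"
    have le: "c \<preceq> ?c" unfolding c by (rule cond_le_world) (use assms(1) c *(1) in auto)
    note ok = cond_le_cond_ok(2)[OF le]
    have t: "tmw w1 (BT \<Rrightarrow> \<rho>) a" "tmw w1 (BT \<Rrightarrow> stepty \<rho>) f"
      using tmw_cond_le[OF le assms(2)] tmw_cond_le[OF le assms(3)] by simp_all
    note K = konst_typing[OF *(2)]
    note tR = rec_el_typing[OF t K]
    have Gk: "tame \<rho> (rec_el \<rho> a f (konst k)) ?c" using *(3) unfolding sub .
    have "tame (\<rho> \<Rrightarrow> \<rho>) (sapp f (konst k)) ?c"
      using assms(5) le tame_konst[OF ok] *(2) K by simp
    then have tame': "tame \<rho> (sapp (sapp f (konst k)) (rec_el \<rho> a f (konst k))) ?c"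
      using cond_le_refl[OF ok] Gk tR by simp
    have tS: "tmw w1 Nat (Succ \<cdot> k)" using *(2) by (blast intro: typing.intros)
    have "agree \<rho> ?c (sapp (sapp f (konst k)) (rec_el \<rho> a f (konst k))) (rec_el \<rho> a f (konst (Succ \<cdot> k)))"
    \<comment> \<open>Both elements reduce to this common value at \<beta>, the second one by
      \<open>RecSucc\<close>.\<close>
    proof (rule agree_val[where v = "\<lambda>\<beta>. f \<cdot> \<beta> \<cdot> k \<cdot> (Rec \<rho> \<cdot> (a \<cdot> \<beta>) \<cdot> (f \<cdot> \<beta>) \<cdot> k)"])
      fix w2 \<beta> assume "fst ?c \<sqsubseteq> w2" and b: "tmw w2 BT \<beta>"
      then have w2: "w1 \<sqsubseteq> w2" by simp
      note t2 = tmw_mono[OF w2 t(1)] tmw_mono[OF w2 t(2)]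
      note k = tmw_mono[OF w2 *(2)] and K2 = tmw_mono[OF w2 K] and tR2 = tmw_mono[OF w2 tR]
      have v: "tmw w2 \<rho> (a \<cdot> \<beta>)" "tmw w2 (stepty \<rho>) (f \<cdot> \<beta>)"
        using t2 b by (blast intro: typing.intros(5))+
      have vR: "tmw w2 (Nat \<Rrightarrow> \<rho>) (Rec \<rho> \<cdot> (a \<cdot> \<beta>) \<cdot> (f \<cdot> \<beta>))"
        using v by (blast intro: typing.intros)
      note r = rec_el_beta[OF t2 K2 b]
      have r': "eqv w2 \<rho> (rec_el \<rho> a f (konst k) \<cdot> \<beta>) (Rec \<rho> \<cdot> (a \<cdot> \<beta>) \<cdot> (f \<cdot> \<beta>) \<cdot> k)"
        using r eqv_App[OF HA.Refl[OF vR] konst_beta[OF k b]] by (rule eqv_trans)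
      have fk: "eqv w2 (\<rho> \<Rrightarrow> \<rho>) (sapp f (konst k) \<cdot> \<beta>) (f \<cdot> \<beta> \<cdot> k)"
        using sapp_beta[OF t2(2) K2 b] eqv_App[OF HA.Refl[OF v(2)] konst_beta[OF k b]] by (rule eqv_trans)
      show "eqv w2 \<rho> (sapp (sapp f (konst k)) (rec_el \<rho> a f (konst k)) \<cdot> \<beta>) (f \<cdot> \<beta> \<cdot> k \<cdot> (Rec \<rho> \<cdot> (a \<cdot> \<beta>) \<cdot> (f \<cdot> \<beta>) \<cdot> k))"
        using sapp_beta[OF sapp_typing[OF t2(2) K2] tR2 b] eqv_App[OF fk r'] by (rule eqv_trans)
      note S2 = tmw_mono[OF w2 tS]
      have "eqv w2 \<rho> (rec_el \<rho> a f (konst (Succ \<cdot> k)) \<cdot> \<beta>) (Rec \<rho> \<cdot> (a \<cdot> \<beta>) \<cdot> (f \<cdot> \<beta>) \<cdot> (Succ \<cdot> k))"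
        using rec_el_beta[OF t2 konst_typing[OF S2] b] eqv_App[OF HA.Refl[OF vR] konst_beta[OF S2 b]] by (rule eqv_trans)
      then show "eqv w2 \<rho> (rec_el \<rho> a f (konst (Succ \<cdot> k)) \<cdot> \<beta>) (f \<cdot> \<beta> \<cdot> k \<cdot> (Rec \<rho> \<cdot> (a \<cdot> \<beta>) \<cdot> (f \<cdot> \<beta>) \<cdot> k))"
        using HA.RecSucc[OF v k] by (rule eqv_trans)
    qed
    then have "tame \<rho> (rec_el \<rho> a f (konst (Succ \<cdot> k))) ?c"
      by (rule tame_agree[OF _ _ _ tame'])
        (simp_all add: rec_el_typing[OF t konst_typing[OF tS]] sapp_typing[OF sapp_typing[OF t(2) K] tR])
    then show "tame \<rho> (sub (env (Succ \<cdot> k # [f, a])) ?s) ?c" unfolding sub .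
  qed
  then show ?thesis unfolding c sub .
qed

lemma agree_Zero: "tms (fst c) e (elts \<Gamma>) \<Longrightarrow> agree Nat c (interp e Zero) (konst Zero)"
proof (rule agree_val[where v = "\<lambda>_. Zero"])
  fix w' \<beta> assume *: "tms (fst c) e (elts \<Gamma>)" "fst c \<sqsubseteq> w'" "tmw w' BT \<beta>"
  show "eqv w' Nat (interp e Zero \<cdot> \<beta>) Zero"
    using interp_beta[OF typing.intros(2) tms_mono[OF *(2,1)] *(3)] by simp
  show "eqv w' Nat (konst Zero \<cdot> \<beta>) Zero"
    by (rule konst_beta[OF typing.intros(2) *(3)])
qed

text \<open>The usual logical relations argument. In the case of \<open>Rec\<close> the recursion
  argument is merely constant on a cover; there \<open>tame_rec_el_numeral\<close> applies, and
  \<open>tame_local\<close> then removes the cover.\<close>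

lemma fundamental: "typing \<Gamma> t \<tau> \<Longrightarrow> good \<Gamma> e c \<Longrightarrow> tame \<tau> (interp e t) c"
proof (induction arbitrary: e c rule: typing.induct)
  case (1 i \<Gamma>)
  show ?case
  proof (rule tame_agree)
    show "agree (\<Gamma> ! i) c (e ! i) (interp e (Var i))"
      using 1 agree_interp_Var unfolding good_def by blast
    show "tmw (fst c) (BT \<Rrightarrow> \<Gamma> ! i) (interp e (Var i))"
      using good_typed[OF 1(2)] 1(1) by simp
    show "tmw (fst c) (BT \<Rrightarrow> \<Gamma> ! i) (e ! i)" "tame (\<Gamma> ! i) (e ! i) c"
      using 1 unfolding good_def by (auto simp: list_all2_conv_all_nth)
  qed
next
  case (2 \<Gamma>)
  have ty: "tms (fst c) e (elts \<Gamma>)" "cond_ok c" using 2 unfolding good_def by auto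
  show ?case
    by (rule tame_agree[OF agree_sym[OF agree_Zero[OF ty(1)]] konst_typing good_typed[OF 2] tame_konst[OF ty(2)]])
      (rule typing.intros)+
next
  case (3 \<Gamma>)
  show ?case unfolding tame.simps
  proof (intro allI impI)
    fix c' x assume c': "c \<preceq> c'" and x: "tmw (fst c') (BT \<Rrightarrow> Nat) x"
      and "j (\<lambda>c. \<exists>m. tmw (fst c) Nat m \<and> agree Nat c x (konst m)) c'"
    from this(3) show "j (\<lambda>c. \<exists>m. tmw (fst c) Nat m \<and> agree Nat c (sapp (interp e Succ) x) (konst m)) c'"
    proof (rule j_mono)
      fix c'' assume c'': "c' \<preceq> c''" and "\<exists>m. tmw (fst c'') Nat m \<and> agree Nat c'' x (konst m)"
      then obtain m where m: "tmw (fst c'') Nat m" "agree Nat c'' x (konst m)" by blast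
      obtain w \<alpha> n where c3: "c'' = (w, \<alpha>, n)" by (cases c'')
      have g: "good \<Gamma> e c''" using good_mono 3 c' c'' cond_le_trans by blast
      have tS: "tmw w (BT \<Rrightarrow> Nat \<Rrightarrow> Nat) (interp e Succ)" 
        using good_typed[OF g typing.intros(3)] by (simp add: c3)
      have e: "tms w e (elts \<Gamma>)" using g by (simp add: good_def c3)
      have tx: "tmw w (BT \<Rrightarrow> Nat) x" using tmw_cond_le[OF c'' x] by (simp add: c3)
      have tm: "tmw w Nat (Succ \<cdot> m)" using m(1) by (auto simp: c3 intro: typing.intros)
      have "agree Nat c'' (sapp (interp e Succ) x) (konst (Succ \<cdot> m))"
        unfolding c3 agree.simps
      proof (intro allI impI)
        fix w' \<beta> assume *: "w \<sqsubseteq> w'" "tmw w' BT \<beta>" "cone w' \<alpha> n \<beta>"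
        have S: "eqv w' (Nat \<Rrightarrow> Nat) (interp e Succ \<cdot> \<beta>) Succ"
          using interp_beta[OF typing.intros(3) tms_mono[OF *(1) e] *(2)] by simp
        have "eqv w' Nat (x \<cdot> \<beta>) (konst m \<cdot> \<beta>)" using m(2) * by (simp add: c3)
        also have "eqv w' Nat (konst m \<cdot> \<beta>) m" 
          using konst_beta[OF tmw_mono[OF *(1)] *(2)] m(1) by (simp add: c3)
        finally have x: "eqv w' Nat (x \<cdot> \<beta>) m" .
        have "eqv w' Nat (sapp (interp e Succ) x \<cdot> \<beta>) (Succ \<cdot> m)"
          using sapp_beta[OF tmw_mono[OF *(1) tS] tmw_mono[OF *(1) tx] *(2)] eqv_App[OF S x] by (rule eqv_trans)
        then show "eqv w' Nat (sapp (interp e Succ) x \<cdot> \<beta>) (konst (Succ \<cdot> m) \<cdot> \<beta>)"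
          using eqv_sym[OF konst_beta[OF tmw_mono[OF *(1) tm] *(2)]] by (rule eqv_trans)
      qed
      then show "\<exists>m. tmw (fst c'') Nat m \<and> agree Nat c'' (sapp (interp e Succ) x) (konst m)"
        using tm by (auto simp: c3)
    qed
  qed
next
  case (4 \<Gamma> \<rho>)
  have R: "interp e (Rec \<rho>) = Lam BT (Rec \<rho>)" by (simp add: interp_def)
  \<comment> \<open>The instance unfolds only function types whose result is again a function type:
    twice for the recursor itself and once for its step function among the premises.\<close>
  show ?case unfolding R tame.simps(2)[of _ "_ \<Rrightarrow> _"]
  proof (intro allI impI)
    fix c1 a c2 f assume 1: "c \<preceq> c1" "tmw (fst c1) (BT \<Rrightarrow> \<rho>) a" "tame \<rho> a c1"
      and 2: "c1 \<preceq> c2" "tmw (fst c2) (BT \<Rrightarrow> stepty \<rho>) f"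
        "\<forall>c'. c2 \<preceq> c' \<longrightarrow> (\<forall>x. tmw (fst c') (BT \<Rrightarrow> Nat) x \<longrightarrow> tame Nat x c' \<longrightarrow> tame (\<rho> \<Rrightarrow> \<rho>) (sapp f x) c')"
    have f: "tame (stepty \<rho>) f c2" unfolding tame.simps(2)[of _ "_ \<Rrightarrow> _"] by (rule 2(3))
    show "tame (Nat \<Rrightarrow> \<rho>) (sapp (sapp (Lam BT (Rec \<rho>)) a) f) c2" unfolding tame.simps(2)
    proof (intro allI impI)
      fix c3 x assume 3: "c2 \<preceq> c3" "tmw (fst c3) (BT \<Rrightarrow> Nat) x" "tame Nat x c3"
      have "j (tame \<rho> (rec_el \<rho> a f x)) c3"
      proof (rule j_mono[OF 3(3)[unfolded tame.simps]])
        fix c4 assume c4: "c3 \<preceq> c4" and "\<exists>m. tmw (fst c4) Nat m \<and> agree Nat c4 x (konst m)"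
        then obtain m where m: "tmw (fst c4) Nat m" "agree Nat c4 x (konst m)" by blast
        have le: "c1 \<preceq> c4" "c2 \<preceq> c4" using cond_le_trans 2(1) 3(1) c4 by blast+
        note t = tmw_cond_le[OF le(1) 1(2)] tmw_cond_le[OF le(2) 2(2)]
        note x = tmw_cond_le[OF c4 3(2)] and K = konst_typing[OF m(1)]
        have tame: "tame \<rho> (rec_el \<rho> a f (konst m)) c4"
          by (rule tame_rec_el_numeral[OF cond_le_cond_ok(2)[OF c4] t tame_mono[OF 1(3) le(1)] tame_mono[OF f le(2)] m(1)])
        have "agree \<rho> c4 (rec_el \<rho> a f (konst m)) (rec_el \<rho> a f x)" unfolding rec_el_def
          by (rule agree_sapp[OF agree_refl agree_sym[OF m(2)]])
            (use t x K in \<open>blast intro: sapp_typing Rec_typing\<close>)+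
        then show "tame \<rho> (rec_el \<rho> a f x) c4"
          by (rule tame_agree[OF _ rec_el_typing[OF t K] rec_el_typing[OF t x] tame])
      qed
      then show "tame \<rho> (sapp (sapp (sapp (Lam BT (Rec \<rho>)) a) f) x) c3" using tame_local unfolding rec_el_def by blast
    qed
  qed
next
  case (5 \<Gamma> s \<rho> \<tau> t)
  note t = good_typed[OF "5.prems"]
  have ok: "cond_ok c" and e: "tms (fst c) e (elts \<Gamma>)" using "5.prems" unfolding good_def by auto
  have "tame \<tau> (sapp (interp e s) (interp e t)) c"
    using "5.IH"(1)[OF "5.prems"] "5.IH"(2)[OF "5.prems"] cond_le_refl[OF ok] t[OF "5.hyps"(2)] by simp
  moreover have "agree \<tau> c (sapp (interp e s) (interp e t)) (interp e (s \<cdot> t))"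
  proof (rule agree_val)
    fix w' \<beta> assume *: "fst c \<sqsubseteq> w'" "tmw w' BT \<beta>"
    note e' = tms_mono[OF *(1) e]
    show "eqv w' \<tau> (sapp (interp e s) (interp e t) \<cdot> \<beta>) (sub (env (app e \<beta>)) (s \<cdot> t))"
      using sapp_beta[OF interp_typing[OF "5.hyps"(1) e'] interp_typing[OF "5.hyps"(2) e'] *(2)]
        eqv_App[OF interp_beta[OF "5.hyps"(1) e' *(2)] interp_beta[OF "5.hyps"(2) e' *(2)]]
      unfolding sub.simps by (rule eqv_trans)
    show "eqv w' \<tau> (interp e (s \<cdot> t) \<cdot> \<beta>) (sub (env (app e \<beta>)) (s \<cdot> t))"
      by (rule interp_beta[OF typing.intros(5)[OF "5.hyps"] e' *(2)])
  qed
  ultimately show ?case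
    using tame_agree sapp_typing[OF t[OF "5.hyps"(1)] t[OF "5.hyps"(2)]] t[OF typing.intros(5)[OF "5.hyps"]] by blast
next
  case (6 \<rho> \<Gamma> t \<tau>)
  show ?case unfolding tame.simps(2)
  proof (intro allI impI)
    fix c' x assume c': "c \<preceq> c'" and x: "tmw (fst c') (BT \<Rrightarrow> \<rho>) x" "tame \<rho> x c'"
    note g = good_mono[OF "6.prems" c']
    note g' = good_Cons[OF g x]
    have e: "tms (fst c') e (elts \<Gamma>)" using g unfolding good_def by auto
    note L = typing.intros(6)[OF "6.hyps"]
    show "tame \<tau> (sapp (interp e (Lam \<rho> t)) x) c'"
    proof (rule tame_agree[OF _ good_typed[OF g' "6.hyps"] sapp_typing[OF good_typed[OF g L] x(1)] "6.IH"[OF g']],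
        rule agree_val)
      fix w' \<beta> assume *: "fst c' \<sqsubseteq> w'" "tmw w' BT \<beta>"
      note e' = tms_mono[OF *(1) e] and x' = tmw_mono[OF *(1) x(1)]
      have xe: "tms w' (x # e) (elts (\<rho> # \<Gamma>))" using e' x' by simp
      show "eqv w' \<tau> (interp (x # e) t \<cdot> \<beta>) (sub (env (x \<cdot> \<beta> # app e \<beta>)) t)"
        using interp_beta[OF "6.hyps" xe *(2)] by simp
      have xb: "tmw w' \<rho> (x \<cdot> \<beta>)" using x' *(2) by (rule typing.intros)
      have "tms w' (app e \<beta>) \<Gamma>" by (rule tms_app[OF e _ *(2)]) (rule *(1))
      then have ts: "typed_sub (ctx w') (env (app e \<beta>)) \<Gamma>"
        by (auto simp: typed_sub_def senv_def list_all2_conv_all_nth)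
      have "eqv w' \<tau> (sapp (interp e (Lam \<rho> t)) x \<cdot> \<beta>) (sub (env (app e \<beta>)) (Lam \<rho> t) \<cdot> (x \<cdot> \<beta>))"
        using sapp_beta[OF interp_typing[OF L e'] x' *(2)] eqv_App[OF interp_beta[OF L e' *(2)] HA.Refl[OF xb]]
        by (rule eqv_trans)
      then show "eqv w' \<tau> (sapp (interp e (Lam \<rho> t)) x \<cdot> \<beta>) (sub (env (x \<cdot> \<beta> # app e \<beta>)) t)"
        using eqv_Lam[OF "6.hyps" ts xb] unfolding senv_Cons by (rule eqv_trans)
    qed
  qed
qed


section \<open>Forced formulas hold up to the nucleus\<close>

lemma Qbar_wff: "cond_ok (w, \<alpha>, n) \<Longrightarrow> wff (ctx w) (fsub (env [initial_tm \<cdot> \<alpha> \<cdot> n]) Q)"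
proof (rule wff_env[where \<Theta> = "[Nat]"])
  assume c: "cond_ok (w, \<alpha>, n)"
  then show "w0 \<sqsubseteq> w" by simp
  have "tmw w Nat (initial_tm \<cdot> \<alpha> \<cdot> n)"
    using c typing_closed[OF typing_initial] by (auto intro: typing.intros(5))
  then show "tms w [initial_tm \<cdot> \<alpha> \<cdot> n] [Nat]" by simp
  show "wf [Nat] Q" using Q by simp
qed

text \<open>An inconsistent world proves Q of every initial segment, so there every predicate is
  covered.\<close>

lemma j_Bot: "prv (fst c) Bot \<Longrightarrow> j X c"
  unfolding j_def
proof (intro allI impI)
  fix c' assume "prv (fst c) Bot" "c \<preceq> c'"
  moreover obtain w \<alpha> n where c': "c' = (w, \<alpha>, n)" by (cases c')
  ultimately have "prv w Bot" using cond_le_wle prv_mono by fastforce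
  then show "Qbar c'"
    using Qbar_wff cond_le_cond_ok(2)[OF \<open>c \<preceq> c'\<close>] unfolding c' by (auto intro: prv_Bot)
qed

lemma holds_and: "holds A e c \<Longrightarrow> holds B e c \<Longrightarrow> holds (A \<^bold>\<and> B) e c"
  by (cases c) (simp add: HA.AndI)

text \<open>X has to survive the passage to the cover for Y, hence its monotonicity.\<close>

lemma j_conj:
  assumes "j X c" "j Y c" "\<And>c' c''. X c' \<Longrightarrow> c' \<preceq> c'' \<Longrightarrow> X c''"
  shows "j (\<lambda>c. X c \<and> Y c) c"
proof (rule j_bind[OF assms(1)])
  fix c' assume c': "c \<preceq> c'" "X c'"
  show "j (\<lambda>c. X c \<and> Y c) c'"
    by (rule j_mono[OF j_up[OF assms(2) c'(1)]]) (simp add: assms(3)[OF c'(2)])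
qed

text \<open>For implication and universal quantification the claim is a conjunct of the forcing
  clause, so no passage from truth back to forcing is ever required. The other connectives are
  positive and carry truth through \<open>j\<close>.\<close>

lemma truth: "wff \<Gamma> A \<Longrightarrow> cond_ok c \<Longrightarrow> tms (fst c) e (elts \<Gamma>) \<Longrightarrow> forces A e c \<Longrightarrow> j (holds A e) c"
proof (induction A arbitrary: \<Gamma> e c)
  case Bot
  show ?case by (rule j_mono[OF Bot.prems(4)[unfolded forces.simps]]) simp
next
  case (And A B)
  have "j (holds A e) c" "j (holds B e) c"
    using And.IH(1)[OF _ And.prems(2,3)] And.IH(2)[OF _ And.prems(2,3)] And.prems(1,4) by simp_all
  then have "j (\<lambda>c. holds A e c \<and> holds B e c) c" by (rule j_conj) (rule holds_mono)
  then show ?case by (rule j_mono) (blast intro: holds_and)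
next
  case (Or A B)
  show ?case
  proof (rule j_bind[OF Or.prems(4)[unfolded forces.simps]])
    fix c' assume c': "c \<preceq> c'" "forces A e c' \<or> forces B e c'"
    note ok = cond_le_cond_ok(2)[OF c'(1)] tms_cond_le[OF c'(1) Or.prems(3)]
    have wf: "wff \<Gamma> A" "wff \<Gamma> B" using Or.prems(1) by simp_all
    have "j (holds A e) c' \<or> j (holds B e) c'"
      using c'(2) Or.IH(1)[OF wf(1) ok] Or.IH(2)[OF wf(2) ok] by blast
    then show "j (holds (A \<^bold>\<or> B) e) c'"
    proof
      show "j (holds (A \<^bold>\<or> B) e) c'" if "j (holds A e) c'" 
      proof (rule j_mono[OF that])
        fix c'' assume c'': "c' \<preceq> c''" "holds A e c''"
        obtain w \<alpha> n where c: "c'' = (w, \<alpha>, n)" by (cases c'')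
        have w: "w0 \<sqsubseteq> w" using cond_le_cond_ok(2)[OF c''(1)] by (simp add: c)
        have e: "tms w e (elts \<Gamma>)" using tms_cond_le[OF c''(1) ok(2)] by (simp add: c)
        show "holds (A \<^bold>\<or> B) e c''" unfolding c holds.simps fsub.simps
          using c''(2) wff_env[OF wle_trans[OF w] tms_app[OF e] wff_append[OF wf(2)]]
          unfolding c by (auto intro: HA.OrI1)
      qed
      show "j (holds (A \<^bold>\<or> B) e) c'" if "j (holds B e) c'" 
      proof (rule j_mono[OF that])
        fix c'' assume c'': "c' \<preceq> c''" "holds B e c''"
        obtain w \<alpha> n where c: "c'' = (w, \<alpha>, n)" by (cases c'')
        have w: "w0 \<sqsubseteq> w" using cond_le_cond_ok(2)[OF c''(1)] by (simp add: c)
        have e: "tms w e (elts \<Gamma>)" using tms_cond_le[OF c''(1) ok(2)] by (simp add: c)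
        show "holds (A \<^bold>\<or> B) e c''" unfolding c holds.simps fsub.simps
          using c''(2) wff_env[OF wle_trans[OF w] tms_app[OF e] wff_append[OF wf(1)]]
          unfolding c by (auto intro: HA.OrI2)
      qed
    qed
  qed
next
  case (Ex \<rho> A)
  have wf: "wff (\<rho> # \<Gamma>) A" using Ex.prems(1) by simp
  show ?case
  proof (rule j_bind[OF Ex.prems(4)[unfolded forces.simps]])
    fix c' assume c': "c \<preceq> c'" "\<exists>x. tmw (fst c') (BT \<Rrightarrow> \<rho>) x \<and> tame \<rho> x c' \<and> forces A (x # e) c'"
    then obtain x where x: "tmw (fst c') (BT \<Rrightarrow> \<rho>) x" "forces A (x # e) c'" by blast
    note ok = cond_le_cond_ok(2)[OF c'(1)] tms_cond_le[OF c'(1) Ex.prems(3)]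
    have xe: "tms (fst c') (x # e) (elts (\<rho> # \<Gamma>))" using x(1) ok(2) by simp
    show "j (holds (Ex \<rho> A) e) c'"
    proof (rule j_mono[OF Ex.IH[OF wf ok(1) xe x(2)]])
      fix c'' assume c'': "c' \<preceq> c''" "holds A (x # e) c''"
      obtain w \<alpha> n where c: "c'' = (w, \<alpha>, n)" by (cases c'')
      have w: "w0 \<sqsubseteq> w" using cond_le_cond_ok(2)[OF c''(1)] by (simp add: c)
      have e: "tms w (x # e) (elts (\<rho> # \<Gamma>))" using tms_cond_le[OF c''(1) xe] by (simp add: c)
      show "holds (Ex \<rho> A) e c''" unfolding c holds.simps
      proof (intro allI impI)
        fix w' \<beta> assume *: "w \<sqsubseteq> w'" "tmw w' BT \<beta>" "cone w' \<alpha> n \<beta>"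
        have t: "tms w' (x \<cdot> \<beta> # app e \<beta>) (\<rho> # \<Gamma>)" using tms_app[OF e *(1,2)] by simp
        \<comment> \<open>The witness for the existential statement at \<beta> is the value of the
          forced witness at \<beta>.\<close>
        show "sat w' (app e \<beta>) (Ex \<rho> A)"
          by (rule sat_ExI[OF wle_trans[OF w *(1)], where \<Theta> = \<Gamma> and t = "x \<cdot> \<beta>"])
            (use t wff_append[OF wf] c''(2) * in \<open>auto simp: c\<close>)
      qed
    qed
  qed
qed simp_all

lemma typed_env_elts:
  assumes "tms w e (elts \<Gamma>)" "w \<sqsubseteq> w'" "tmw w' BT \<beta>"
  shows "typed_sub (ctx w') (env (app e \<beta>)) \<Gamma>"
  using tms_app[OF assms] by (auto simp: typed_sub_def senv_def list_all2_conv_all_nth)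

lemma j_Ball:
  assumes "finite F" "\<And>D. D \<in> F \<Longrightarrow> j (X D) c" "\<And>D c' c''. X D c' \<Longrightarrow> c' \<preceq> c'' \<Longrightarrow> X D c''"
  shows "j (\<lambda>c. \<forall>D \<in> F. X D c) c"
  using assms(1,2)
proof (induction rule: finite_induct)
  case empty
  show ?case by (rule j_ret) simp
next
  case (insert D F)
  have "j (\<lambda>c. X D c \<and> (\<forall>D \<in> F. X D c)) c"
  proof (rule j_conj)
    show "j (X D) c" by (rule insert.prems) simp
    show "j (\<lambda>c. \<forall>D \<in> F. X D c) c" by (rule insert.IH, rule insert.prems) simp
  qed (rule assms(3))
  then show ?case by (rule j_mono) simp
qed

text \<open>Forced hypotheses are jointly true on a cover, where the derivation can be transferred
  at each \<beta> of the cone. This provides the truth conjunct for \<open>ImpI\<close>,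
  \<open>AllI\<close>, \<open>Ind\<close> and \<open>SuccNotZero\<close>, independently of their
  induction hypotheses.\<close>

lemma truth_HA:
  assumes "HA \<Gamma> \<Delta> A" "finite \<Delta>" "\<forall>D \<in> \<Delta>. wff \<Gamma> D" "good \<Gamma> e c" "\<forall>D \<in> \<Delta>. forces D e c"
  shows "j (holds A e) c"
proof -
  have ok: "cond_ok c" "tms (fst c) e (elts \<Gamma>)" using assms(4) unfolding good_def by auto
  have "j (\<lambda>c. \<forall>D \<in> \<Delta>. holds D e c) c"
    by (rule j_Ball[OF assms(2)]) (use truth[OF bspec[OF assms(3)] ok bspec[OF assms(5)]] holds_mono in auto)
  then show ?thesis
  proof (rule j_mono)
    fix c' assume c': "c \<preceq> c'" "\<forall>D \<in> \<Delta>. holds D e c'"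
    obtain w \<alpha> n where c: "c' = (w, \<alpha>, n)" by (cases c')
    have e: "tms w e (elts \<Gamma>)" using tms_cond_le[OF c'(1) ok(2)] by (simp add: c)
    show "holds A e c'" unfolding c holds.simps
    proof (intro allI impI)
      fix w' \<beta> assume *: "w \<sqsubseteq> w'" "tmw w' BT \<beta>" "cone w' \<alpha> n \<beta>"
      show "sat w' (app e \<beta>) A"
        by (rule prv_transfer[OF assms(1,2) typed_env_elts[OF e *(1,2)]]) (use c'(2) * in \<open>auto simp: c\<close>)
    qed
  qed
qed

lemma good_D: "good \<Gamma> e c \<Longrightarrow> cond_ok c" "good \<Gamma> e c \<Longrightarrow> tms (fst c) e (elts \<Gamma>)"
  unfolding good_def by auto

section \<open>Forcing under the substitutions of the rules, and induction\<close>

lemma forces_flift: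
  assumes "wff \<Gamma> D" "cond_ok c" "tms (fst c) (x # e) (elts (\<rho> # \<Gamma>))"
  shows "forces (flift D) (x # e) c \<longleftrightarrow> forces D e c"
  unfolding flift_def
proof (rule forces_subst[OF assms(1)])
  have "agree (\<Gamma> ! i) c (e ! i) (interp (x # e) ((Var \<circ> Suc) i))" if "i < length \<Gamma>" for i
    using agree_interp_Var[OF assms(3), of "Suc i"] that by simp
  then show "subst_ok c (\<rho> # \<Gamma>) \<Gamma> (Var \<circ> Suc) (x # e) e"
    unfolding subst_ok_def using assms(2,3) by (auto simp: typed_sub_def)
qed

lemma forces_inst0:
  assumes "wff (\<rho> # \<Gamma>) A" "typing \<Gamma> t \<rho>" "cond_ok c" "tms (fst c) e (elts \<Gamma>)"
  shows "forces (inst 0 t A) e c \<longleftrightarrow> forces A (interp e t # e) c"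
  unfolding inst0
proof (rule forces_subst[OF assms(1)])
  have t: "tmw (fst c) (BT \<Rrightarrow> \<rho>) (interp e t)" using assms(2,4) by (rule interp_typing)
  have "agree ((\<rho> # \<Gamma>) ! i) c ((interp e t # e) ! i) (interp e (case_nat t Var i))" if "i < length (\<rho> # \<Gamma>)" for i
    using agree_interp_Var[OF assms(4)] agree_refl[OF t] that by (cases i) auto
  then show "subst_ok c \<Gamma> (\<rho> # \<Gamma>) (case_nat t Var) e (interp e t # e)"
    unfolding subst_ok_def using assms t by (auto intro: typed_sub_case typed_sub_Var)
qed

lemma forces_instS:
  assumes "wff (Nat # \<Gamma>) A" "cond_ok c" "tms (fst c) e (elts \<Gamma>)" "tmw (fst c) Nat m"
  shows "forces (inst 1 (Succ \<cdot> Var 0) A) (konst m # e) c \<longleftrightarrow> forces A (konst (Succ \<cdot> m) # e) c"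
  unfolding inst_def
proof (rule forces_subst[OF assms(1)])
  let ?\<sigma> = "case_nat (Succ \<cdot> Var 0) (\<lambda>i. Var (i + 1))"
  let ?e = "konst m # e"
  have m: "tmw (fst c) Nat (Succ \<cdot> m)" using assms(4) by (blast intro: typing.intros)
  have S: "typing (Nat # \<Gamma>) (Succ \<cdot> Var 0) Nat" by (rule typing.intros(5)[OF typing.intros(3) typing_Var0])
  have e: "tms (fst c) ?e (elts (Nat # \<Gamma>))" using assms(3) konst_typing[OF assms(4)] by simp
  have 0: "agree Nat c (konst (Succ \<cdot> m)) (interp ?e (Succ \<cdot> Var 0))"
  proof (rule agree_val[where v = "\<lambda>_. Succ \<cdot> m"])
    fix w' \<beta> assume *: "fst c \<sqsubseteq> w'" "tmw w' BT \<beta>"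
    show "eqv w' Nat (konst (Succ \<cdot> m) \<cdot> \<beta>) (Succ \<cdot> m)"
      by (rule konst_beta[OF tmw_mono[OF *(1) m] *(2)])
    have "eqv w' Nat (interp ?e (Succ \<cdot> Var 0) \<cdot> \<beta>) (Succ \<cdot> (konst m \<cdot> \<beta>))"
      using interp_beta[OF S tms_mono[OF *(1) e] *(2)] by simp
    then show "eqv w' Nat (interp ?e (Succ \<cdot> Var 0) \<cdot> \<beta>) (Succ \<cdot> m)"
      using eqv_App[OF HA.Refl[OF typing.intros(3)] konst_beta[OF tmw_mono[OF *(1) assms(4)] *(2)]]
      by (rule eqv_trans)
  qed
  have "agree ((Nat # \<Gamma>) ! i) c ((konst (Succ \<cdot> m) # e) ! i) (interp ?e (?\<sigma> i))" if "i < length (Nat # \<Gamma>)" for i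
    using agree_interp_Var[OF e, of "i"] that 0 by (cases i) auto
  moreover have "typed_sub (Nat # \<Gamma>) ?\<sigma> (Nat # \<Gamma>)"
    using S by (auto simp: typed_sub_def nth_Cons split: nat.split)
  ultimately show "subst_ok c (Nat # \<Gamma>) (Nat # \<Gamma>) ?\<sigma> ?e (konst (Succ \<cdot> m) # e)"
    unfolding subst_ok_def using e assms(2) konst_typing[OF m] by auto
qed

text \<open>Forced induction at constant elements, by object-level induction on m for the definable
  predicate that \<open>A\<close> is forced at \<open>konst m\<close>. The general case reduces to
  this one on a cover.\<close>

lemma forces_Ind:
  assumes wf: "wff (Nat # \<Gamma>) A" and g: "good \<Gamma> e c"
    and z: "forces (inst 0 Zero A) e c" and s: "forces (All Nat (A \<^bold>\<longrightarrow> inst 1 (Succ \<cdot> Var 0) A)) e c"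
    and m: "tmw (fst c) Nat m"
  shows "forces A (konst m # e) c"
proof -
  obtain w \<alpha> n where c: "c = (w, \<alpha>, n)" by (cases c)
  \<comment> \<open>The induction variable is a number while forcing expects an element, so
    \<open>konst\<close> is inserted in front of the unchanged environment.\<close>
  let ?ss = "konst (Var 0) # map (\<lambda>i. Var (Suc i)) [0..<length \<Gamma>]"
  have e: "tms w e (elts \<Gamma>)" and ok: "cond_ok (w, \<alpha>, n)" using good_D[OF g] by (simp_all add: c)
  have ss: "list_all2 (typing ((Nat # elts \<Gamma>) @ ctx w0)) ?ss (elts (Nat # \<Gamma>))"
  proof -
    have "typing ((Nat # elts \<Gamma>) @ ctx w0) (konst (Var 0)) (BT \<Rrightarrow> Nat)"
      by (simp add: konst_def typing.intros)
    moreover have "list_all2 (typing ((Nat # elts \<Gamma>) @ ctx w0)) (map (\<lambda>i. Var (Suc i)) [0..<length \<Gamma>]) (elts \<Gamma>)"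
      by (auto simp: list_all2_conv_all_nth nth_append)
    ultimately show ?thesis by simp
  qed
  have sub: "map (sub (env (k # e))) ?ss = konst k # e" for k
    using list_all2_lengthD[OF e] by (auto simp: senv_def intro!: nth_equalityI)
  have "forces A (map (sub (env (m # e))) ?ss) (w, \<alpha>, n)"
  proof (rule defin_Ind[OF defin_sub[OF defin_forces[OF wf] ss] ok e])
    show "tmw w Nat m" using m by (simp add: c)
    have Z: "tmw (fst c) Nat Zero" by (rule typing.intros)
    have "forces A (interp e Zero # e) c"
      using z forces_inst0[OF wf typing.intros(2) good_D[OF g]] by blast
    moreover have "forces A (interp e Zero # e) c \<longleftrightarrow> forces A (konst Zero # e) c"
    proof (rule forces_agree[OF wf])
      show "cond_ok c" "tms (fst c) (interp e Zero # e) (elts (Nat # \<Gamma>))" "tms (fst c) (konst Zero # e) (elts (Nat # \<Gamma>))"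
        using good_D[OF g] interp_typing[OF typing.intros(2) good_D(2)[OF g]] konst_typing[OF Z] by simp_all
      show "agree ((Nat # \<Gamma>) ! i) c ((konst Zero # e) ! i) ((interp e Zero # e) ! i)" if "i < length (Nat # \<Gamma>)" for i
        using that good_D(2)[OF g] agree_sym[OF agree_Zero[OF good_D(2)[OF g]]]
        by (cases i) (auto simp: list_all2_conv_all_nth intro!: agree_refl)
    qed
    ultimately show "forces A (map (sub (env (Zero # e))) ?ss) (w, \<alpha>, n)" unfolding sub c by blast
  next
    fix w1 k assume *: "w \<sqsubseteq> w1" "tmw w1 Nat k" "forces A (map (sub (env (k # e))) ?ss) (w1, \<alpha>, n)"
    let ?c = "(w1, \<alpha>, n)"
    have le: "c \<preceq> ?c" unfolding c by (rule cond_le_world[OF ok *(1)])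
    note ok1 = cond_le_cond_ok(2)[OF le]
    have k: "tmw (fst ?c) Nat k" using *(2) by simp
    have "forces (A \<^bold>\<longrightarrow> inst 1 (Succ \<cdot> Var 0) A) (konst k # e) ?c"
      using s le konst_typing[OF k] tame_konst[OF ok1 k] unfolding forces.simps(6) by blast
    then have "forces (inst 1 (Succ \<cdot> Var 0) A) (konst k # e) ?c"
      using *(3) cond_le_refl[OF ok1] unfolding sub forces.simps(5) by blast
    then show "forces A (map (sub (env (Succ \<cdot> k # e))) ?ss) ?c"
      unfolding sub using forces_instS[OF wf ok1 tms_cond_le[OF le good_D(2)[OF g]] k] by blast
  qed
  then show ?thesis unfolding sub c .
qed

lemma agree_holds_Eq:
  assumes "typing \<Gamma> s \<rho>" "typing \<Gamma> t \<rho>" "tms (fst c) e (elts \<Gamma>)" "holds (Eq \<rho> s t) e c"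
  shows "agree \<rho> c (interp e s) (interp e t)"
proof -
  obtain w \<alpha> n where c: "c = (w, \<alpha>, n)" by (cases c)
  show ?thesis unfolding c agree.simps
  proof (intro allI impI)
    fix w' \<beta> assume *: "w \<sqsubseteq> w'" "tmw w' BT \<beta>" "cone w' \<alpha> n \<beta>"
    have e: "tms w' e (elts \<Gamma>)" using tms_mono[OF *(1)] assms(3) by (simp add: c)
    have "eqv w' \<rho> (sub (env (app e \<beta>)) s) (sub (env (app e \<beta>)) t)"
      using assms(4) * by (simp add: c)
    then show "eqv w' \<rho> (interp e s \<cdot> \<beta>) (interp e t \<cdot> \<beta>)"
      using interp_beta[OF assms(1) e *(2)] eqv_sym[OF interp_beta[OF assms(2) e *(2)]] eqv_trans by blast
  qed
qed

section \<open>Soundness of the rules\<close>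

definition forced :: "ty list \<Rightarrow> fm set \<Rightarrow> fm \<Rightarrow> bool" where
  "forced \<Gamma> \<Delta> A \<longleftrightarrow> (finite \<Delta> \<longrightarrow> (\<forall>D \<in> \<Delta>. wff \<Gamma> D) \<longrightarrow>
     (\<forall>e c. good \<Gamma> e c \<longrightarrow> (\<forall>D \<in> \<Delta>. forces D e c) \<longrightarrow> forces A e c))"

lemma forcedI:
  assumes "\<And>e c. finite \<Delta> \<Longrightarrow> \<forall>D \<in> \<Delta>. wff \<Gamma> D \<Longrightarrow> good \<Gamma> e c \<Longrightarrow> \<forall>D \<in> \<Delta>. forces D e c
    \<Longrightarrow> forces A e c"
  shows "forced \<Gamma> \<Delta> A"
  unfolding forced_def using assms by blast

lemma forcedD:
  assumes "forced \<Gamma> \<Delta> A" "finite \<Delta>" "\<forall>D \<in> \<Delta>. wff \<Gamma> D" "good \<Gamma> e c" "\<forall>D \<in> \<Delta>. forces D e c"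
  shows "forces A e c"
  using assms unfolding forced_def by blast

lemma forced_insert:
  assumes "forced \<Gamma> (insert B \<Delta>) A" "finite \<Delta>" "\<forall>D \<in> \<Delta>. wff \<Gamma> D" "wff \<Gamma> B"
    and "good \<Gamma> e c" "\<forall>D \<in> \<Delta>. forces D e c" "c \<preceq> c'" "forces B e c'"
  shows "forces A e c'"
  by (rule forcedD[OF assms(1) _ _ good_mono[OF assms(5,7)]])
    (use assms(2-4,6,8) forces_mono[OF _ assms(7)] in auto)

text \<open>An equation is forced when it is true on a cover, so \<open>truth_HA\<close> alone
  settles reflexivity, extensionality, beta, the recursor equations and
  \<open>SuccInj\<close>.\<close>

lemma forced_Eq:
  assumes "HA \<Gamma> \<Delta> (Eq \<rho> s t)"
  shows "forced \<Gamma> \<Delta> (Eq \<rho> s t)"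
  by (rule forcedI) (unfold forces.simps, rule truth_HA[OF assms])

lemma forced_bind:
  assumes "good \<Gamma> e c" "\<forall>D \<in> \<Delta>. forces D e c" "\<forall>D \<in> \<Delta>. wff \<Gamma> D"
    and "c \<preceq> c'" "tmw (fst c') (BT \<Rrightarrow> \<rho>) x" "tame \<rho> x c'"
  shows "good (\<rho> # \<Gamma>) (x # e) c'" "\<forall>D \<in> flift ` \<Delta>. forces D (x # e) c'"
    "\<forall>D \<in> flift ` \<Delta>. wff (\<rho> # \<Gamma>) D"
proof -
  show g: "good (\<rho> # \<Gamma>) (x # e) c'"
    by (rule good_Cons[OF good_mono[OF assms(1,4)] assms(5,6)])
  show "\<forall>D \<in> flift ` \<Delta>. forces D (x # e) c'"
    using forces_flift[OF bspec[OF assms(3)] good_D[OF g]] forces_mono[OF bspec[OF assms(2)] assms(4)] by simp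
  show "\<forall>D \<in> flift ` \<Delta>. wff (\<rho> # \<Gamma>) D"
    using assms(3) unfolding flift_def by (auto intro!: wff_sub simp: typed_sub_def)
qed

lemma soundness: "HA \<Gamma> \<Delta> A \<Longrightarrow> forced \<Gamma> \<Delta> A"
proof (induction rule: HA.induct)
  case (Hyp A \<Delta> \<Gamma>)
  then show ?case unfolding forced_def by blast
next
  case (AndI \<Gamma> \<Delta> A B)
  then show ?case unfolding forced_def by simp
next
  case (AndE1 \<Gamma> \<Delta> A B)
  then show ?case unfolding forced_def by simp
next
  case (AndE2 \<Gamma> \<Delta> A B)
  then show ?case unfolding forced_def by simp
next
  case (OrI1 \<Gamma> \<Delta> A B)
  show ?case
  proof (rule forcedI)
    fix e c assume *: "finite \<Delta>" "\<forall>D \<in> \<Delta>. wff \<Gamma> D" "good \<Gamma> e c" "\<forall>D \<in> \<Delta>. forces D e c"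
    have "forces A e c" by (rule forcedD[OF OrI1.IH *])
    then have "j (\<lambda>c. forces A e c \<or> forces B e c) c"
      by (intro j_ret disjI1) (rule forces_mono)
    then show "forces (A \<^bold>\<or> B) e c" by simp
  qed
next
  case (OrI2 \<Gamma> \<Delta> B A)
  show ?case
  proof (rule forcedI)
    fix e c assume *: "finite \<Delta>" "\<forall>D \<in> \<Delta>. wff \<Gamma> D" "good \<Gamma> e c" "\<forall>D \<in> \<Delta>. forces D e c"
    have "forces B e c" by (rule forcedD[OF OrI2.IH *])
    then have "j (\<lambda>c. forces A e c \<or> forces B e c) c"
      by (intro j_ret disjI2) (rule forces_mono)
    then show "forces (A \<^bold>\<or> B) e c" by simp
  qed
next
  case (OrE \<Gamma> \<Delta> A B C)
  show ?case
  proof (rule forcedI)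
    fix e c assume *: "finite \<Delta>" "\<forall>D \<in> \<Delta>. wff \<Gamma> D" "good \<Gamma> e c" "\<forall>D \<in> \<Delta>. forces D e c"
    have wf: "wff \<Gamma> A" "wff \<Gamma> B" using HA_wff[OF OrE.hyps(1)] by simp_all
    have "forces (A \<^bold>\<or> B) e c" by (rule forcedD[OF OrE.IH(1) *])
    then have "j (\<lambda>c. forces A e c \<or> forces B e c) c" by simp
    then have "j (forces C e) c"
    proof (rule j_mono)
      fix c' assume c': "c \<preceq> c'" "forces A e c' \<or> forces B e c'"
      from c'(2) show "forces C e c'"
      proof
        assume "forces A e c'"
        then show ?thesis by (rule forced_insert[OF OrE.IH(2) *(1,2) wf(1) *(3,4) c'(1)])
      next
        assume "forces B e c'"
        then show ?thesis by (rule forced_insert[OF OrE.IH(3) *(1,2) wf(2) *(3,4) c'(1)])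
      qed
    qed
    then show "forces C e c" by (rule forces_local)
  qed
next
  case (ImpI \<Gamma> A \<Delta> B)
  show ?case
  proof (rule forcedI)
    fix e c assume *: "finite \<Delta>" "\<forall>D \<in> \<Delta>. wff \<Gamma> D" "good \<Gamma> e c" "\<forall>D \<in> \<Delta>. forces D e c"
    have "forces B e c'" if "c \<preceq> c'" "forces A e c'" for c'
      by (rule forced_insert[OF ImpI.IH *(1,2) ImpI.hyps(1) *(3,4) that])
    moreover have "j (holds (A \<^bold>\<longrightarrow> B) e) c" by (rule truth_HA[OF HA.ImpI[OF ImpI.hyps] *])
    ultimately show "forces (A \<^bold>\<longrightarrow> B) e c" by simp
  qed
next
  case (ImpE \<Gamma> \<Delta> A B)
  show ?case
  proof (rule forcedI)
    fix e c assume *: "finite \<Delta>" "\<forall>D \<in> \<Delta>. wff \<Gamma> D" "good \<Gamma> e c" "\<forall>D \<in> \<Delta>. forces D e c"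
    have "forces (A \<^bold>\<longrightarrow> B) e c" by (rule forcedD[OF ImpE.IH(1) *])
    moreover have "forces A e c" by (rule forcedD[OF ImpE.IH(2) *])
    ultimately show "forces B e c" using cond_le_refl[OF good_D(1)[OF *(3)]] by simp
  qed
next
  case (BotE \<Gamma> \<Delta> A)
  show ?case
  proof (rule forcedI)
    fix e c assume *: "finite \<Delta>" "\<forall>D \<in> \<Delta>. wff \<Gamma> D" "good \<Gamma> e c" "\<forall>D \<in> \<Delta>. forces D e c"
    have "forces Bot e c" by (rule forcedD[OF BotE.IH *])
    then have "j (\<lambda>c. False) c" unfolding forces.simps .
    then have "j (forces A e) c" by (rule j_mono) (erule FalseE)
    then show "forces A e c" by (rule forces_local)
  qed
next
  case (AllI \<rho> \<Gamma> \<Delta> A)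
  show ?case
  proof (rule forcedI)
    fix e c assume *: "finite \<Delta>" "\<forall>D \<in> \<Delta>. wff \<Gamma> D" "good \<Gamma> e c" "\<forall>D \<in> \<Delta>. forces D e c"
    have "forces A (x # e) c'" if x: "c \<preceq> c'" "tmw (fst c') (BT \<Rrightarrow> \<rho>) x" "tame \<rho> x c'" for c' x
    proof -
      note b = forced_bind[OF *(3,4,2) x]
      show ?thesis by (rule forcedD[OF AllI.IH finite_imageI[OF *(1)] b(3,1,2)])
    qed
    moreover have "j (holds (All \<rho> A) e) c" by (rule truth_HA[OF HA.AllI[OF AllI.hyps] *])
    ultimately show "forces (All \<rho> A) e c" by simp
  qed
next
  case (AllE \<Gamma> \<Delta> \<rho> A t)
  have wf: "wff (\<rho> # \<Gamma>) A" using HA_wff[OF AllE.hyps(1)] by simp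
  show ?case
  proof (rule forcedI)
    fix e c assume *: "finite \<Delta>" "\<forall>D \<in> \<Delta>. wff \<Gamma> D" "good \<Gamma> e c" "\<forall>D \<in> \<Delta>. forces D e c"
    have "forces (All \<rho> A) e c" by (rule forcedD[OF AllE.IH *])
    then have "forces A (interp e t # e) c"
      using cond_le_refl[OF good_D(1)[OF *(3)]] good_typed[OF *(3) AllE.hyps(2)]
        fundamental[OF AllE.hyps(2) *(3)] by simp
    then show "forces (inst 0 t A) e c" using forces_inst0[OF wf AllE.hyps(2) good_D[OF *(3)]] by blast
  qed
next
  case (ExI \<rho> \<Gamma> A t \<Delta>)
  show ?case
  proof (rule forcedI)
    fix e c assume *: "finite \<Delta>" "\<forall>D \<in> \<Delta>. wff \<Gamma> D" "good \<Gamma> e c" "\<forall>D \<in> \<Delta>. forces D e c"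
    have "forces (inst 0 t A) e c" by (rule forcedD[OF ExI.IH *])
    then have A: "forces A (interp e t # e) c" using forces_inst0[OF ExI.hyps(1,2) good_D[OF *(3)]] by blast
    show "forces (Ex \<rho> A) e c" unfolding forces.simps
    proof (rule j_ret, intro exI conjI)
      fix c' assume c': "c \<preceq> c'"
      note g = good_mono[OF *(3) c']
      show "tmw (fst c') (BT \<Rrightarrow> \<rho>) (interp e t)" by (rule good_typed[OF g ExI.hyps(2)])
      show "tame \<rho> (interp e t) c'" by (rule fundamental[OF ExI.hyps(2) g])
      show "forces A (interp e t # e) c'" using A c' by (rule forces_mono)
    qed
  qed
next
  case (ExE \<Gamma> \<Delta> \<rho> A C)
  have wf: "wff (\<rho> # \<Gamma>) A" "wff \<Gamma> C"
    using HA_wff[OF ExE.hyps(1)] HA_wff[OF ExE.hyps(2)] wff_flift_inv by auto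
  show ?case
  proof (rule forcedI)
    fix e c assume *: "finite \<Delta>" "\<forall>D \<in> \<Delta>. wff \<Gamma> D" "good \<Gamma> e c" "\<forall>D \<in> \<Delta>. forces D e c"
    have "forces (Ex \<rho> A) e c" by (rule forcedD[OF ExE.IH(1) *])
    then have "j (\<lambda>c. \<exists>x. tmw (fst c) (BT \<Rrightarrow> \<rho>) x \<and> tame \<rho> x c \<and> forces A (x # e) c) c" by simp
    then have "j (forces C e) c"
    proof (rule j_mono)
      fix c' assume c': "c \<preceq> c'" and "\<exists>x. tmw (fst c') (BT \<Rrightarrow> \<rho>) x \<and> tame \<rho> x c' \<and> forces A (x # e) c'"
      then obtain x where x: "tmw (fst c') (BT \<Rrightarrow> \<rho>) x" "tame \<rho> x c'" "forces A (x # e) c'" by blast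
      note b = forced_bind[OF *(3,4,2) c' x(1,2)]
      have "forces (flift C) (x # e) c'"
        by (rule forcedD[OF ExE.IH(2) _ _ b(1)]) (use *(1) wf(1) x(3) b(2,3) in auto)
      then show "forces C e c'" using forces_flift[OF wf(2) good_D[OF b(1)]] by blast
    qed
    then show "forces C e c" by (rule forces_local)
  qed
next
  case (Repl \<rho> \<Gamma> A \<Delta> s t)
  have ty: "typing \<Gamma> s \<rho>" "typing \<Gamma> t \<rho>" using HA_wff[OF Repl.hyps(2)] by simp_all
  show ?case
  proof (rule forcedI)
    fix e c assume *: "finite \<Delta>" "\<forall>D \<in> \<Delta>. wff \<Gamma> D" "good \<Gamma> e c" "\<forall>D \<in> \<Delta>. forces D e c"
    have "forces (inst 0 s A) e c" by (rule forcedD[OF Repl.IH(2) *])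
    then have A: "forces A (interp e s # e) c"
      using forces_inst0[OF Repl.hyps(1) ty(1) good_D[OF *(3)]] by blast
    have "forces (Eq \<rho> s t) e c" by (rule forcedD[OF Repl.IH(1) *])
    then have "j (holds (Eq \<rho> s t) e) c" by simp
    \<comment> \<open>The two interpretations agree only where the equation is true, that is on a
      cover; \<open>forces_local\<close> leads back to \<open>c\<close>.\<close>
    then have "j (forces (inst 0 t A) e) c"
    proof (rule j_mono)
      fix c' assume c': "c \<preceq> c'" and T: "holds (Eq \<rho> s t) e c'"
      note g = good_mono[OF *(3) c']
      have "forces A (interp e s # e) c' \<longleftrightarrow> forces A (interp e t # e) c'"
      proof (rule forces_agree[OF Repl.hyps(1) good_D(1)[OF g]])
        show "tms (fst c') (interp e s # e) (elts (\<rho> # \<Gamma>))" "tms (fst c') (interp e t # e) (elts (\<rho> # \<Gamma>))"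
          using good_typed[OF g ty(1)] good_typed[OF g ty(2)] good_D(2)[OF g] by simp_all
        show "agree ((\<rho> # \<Gamma>) ! i) c' ((interp e t # e) ! i) ((interp e s # e) ! i)" if "i < length (\<rho> # \<Gamma>)" for i
          using that good_D(2)[OF g] agree_sym[OF agree_holds_Eq[OF ty good_D(2)[OF g] T]]
          by (cases i) (auto simp: list_all2_conv_all_nth intro!: agree_refl)
      qed
      then show "forces (inst 0 t A) e c'"
        using forces_mono[OF A c'] forces_inst0[OF Repl.hyps(1) ty(2) good_D[OF g]] by blast
    qed
    then show "forces (inst 0 t A) e c" by (rule forces_local)
  qed
next
  case (SuccNotZero \<Gamma> t \<Delta>)
  show ?case
  proof (rule forcedI)
    fix e c assume *: "finite \<Delta>" "\<forall>D \<in> \<Delta>. wff \<Gamma> D" "good \<Gamma> e c" "\<forall>D \<in> \<Delta>. forces D e c"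
    have "forces Bot e c'" if c': "c \<preceq> c'" "forces (Eq Nat (Succ \<cdot> t) Zero) e c'" for c'
      unfolding forces.simps
    proof (rule j_bind[OF c'(2)[unfolded forces.simps]])
      fix c'' assume c'': "c' \<preceq> c''" "holds (Eq Nat (Succ \<cdot> t) Zero) e c''"
      obtain w \<alpha> n where c: "c'' = (w, \<alpha>, n)" by (cases c'')
      note g = good_mono[OF good_mono[OF *(3) c'(1)] c''(1)]
      have \<alpha>: "tmw w BT \<alpha>" and w: "w \<sqsubseteq> w" using good_D(1)[OF g] by (auto simp: c intro: wle_refl wle_valid)
      \<comment> \<open>The sequence \<alpha> lies in its own cone, so evaluating there makes the
        false equation provable in the world.\<close>
      have "eqv w Nat (Succ \<cdot> sub (env (app e \<alpha>)) t) Zero"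
        using c''(2) w \<alpha> cone_refl[OF \<alpha>] by (simp add: c)
      moreover have "typed_sub (ctx w) (env (app e \<alpha>)) \<Gamma>"
        by (rule typed_env_elts[OF _ w \<alpha>]) (use good_D(2)[OF g] in \<open>simp add: c\<close>)
      ultimately have "prv (fst c'') Bot"
        using HA.ImpE[OF HA.SuccNotZero[OF typing_sub[OF SuccNotZero.hyps]]] by (simp add: c)
      then show "j (\<lambda>c. False) c''" by (rule j_Bot)
    qed
    moreover have "j (holds (\<^bold>\<not> Eq Nat (Succ \<cdot> t) Zero) e) c"
      by (rule truth_HA[OF HA.SuccNotZero[OF SuccNotZero.hyps] *])
    ultimately show "forces (\<^bold>\<not> Eq Nat (Succ \<cdot> t) Zero) e c" unfolding forces.simps(5) by blast
  qed
next
  case (Ind \<Gamma> \<Delta> A)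
  have wf: "wff (Nat # \<Gamma>) A" using HA_wff[OF Ind.hyps(2)] by simp
  show ?case
  proof (rule forcedI)
    fix e c assume *: "finite \<Delta>" "\<forall>D \<in> \<Delta>. wff \<Gamma> D" "good \<Gamma> e c" "\<forall>D \<in> \<Delta>. forces D e c"
    have IH: "forces (inst 0 Zero A) e c" "forces (All Nat (A \<^bold>\<longrightarrow> inst 1 (Succ \<cdot> Var 0) A)) e c"
      by (rule forcedD[OF Ind.IH(1) *], rule forcedD[OF Ind.IH(2) *])
    \<comment> \<open>A tame number is constant on a cover, and there \<open>forces_Ind\<close>
      reaches it.\<close>
    have "forces A (x # e) c'" if x: "c \<preceq> c'" "tmw (fst c') (BT \<Rrightarrow> Nat) x" "tame Nat x c'" for c' x
    proof (rule forces_local, rule j_mono[OF x(3)[unfolded tame.simps]])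
      fix c'' assume c'': "c' \<preceq> c''" and "\<exists>m. tmw (fst c'') Nat m \<and> agree Nat c'' x (konst m)"
      then obtain m where m: "tmw (fst c'') Nat m" "agree Nat c'' x (konst m)" by blast
      have le: "c \<preceq> c''" using x(1) c'' by (rule cond_le_trans)
      note g = good_mono[OF *(3) le]
      have "forces A (konst m # e) c''"
        by (rule forces_Ind[OF wf g forces_mono[OF IH(1) le] forces_mono[OF IH(2) le] m(1)])
      moreover have "forces A (konst m # e) c'' \<longleftrightarrow> forces A (x # e) c''"
      proof (rule forces_agree[OF wf good_D(1)[OF g]])
        show "tms (fst c'') (konst m # e) (elts (Nat # \<Gamma>))" "tms (fst c'') (x # e) (elts (Nat # \<Gamma>))"
          using konst_typing[OF m(1)] tmw_cond_le[OF c'' x(2)] good_D(2)[OF g] by simp_all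
        show "agree ((Nat # \<Gamma>) ! i) c'' ((x # e) ! i) ((konst m # e) ! i)" if "i < length (Nat # \<Gamma>)" for i
          using that good_D(2)[OF g] m(2) by (cases i) (auto simp: list_all2_conv_all_nth intro!: agree_refl)
      qed
      ultimately show "forces A (x # e) c''" by blast
    qed
    moreover have "j (holds (All Nat A) e) c" by (rule truth_HA[OF HA.Ind[OF Ind.hyps] *])
    ultimately show "forces (All Nat A) e c" unfolding forces.simps(6) by blast
  qed
next
  case (Ext \<Gamma> s \<rho> \<tau> t \<Delta>)
  show ?case by (rule forced_Eq[OF HA.Ext[OF Ext.hyps]])
next
  case (SuccInj \<Gamma> \<Delta> s t)
  show ?case by (rule forced_Eq[OF HA.SuccInj[OF SuccInj.hyps]])
next
  case (Beta \<rho> \<Gamma> s \<tau> t \<Delta>)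
  show ?case by (rule forced_Eq[OF HA.Beta[OF Beta.hyps]])
qed (rule forced_Eq, simp add: HA.Refl HA.RecZero HA.RecSucc)+

end

section \<open>Initial segments and cones\<close>

lemma typing_append_tm: "typing [] append_tm (Nat \<Rrightarrow> Nat \<Rrightarrow> Nat)"
  unfolding append_tm_def cons_tm_def nil_tm_def pair_tm_def hd_tm_def tl_tm_def
    fst_tm_def snd_tm_def diag_tm_def triangle_tm_def if_tm_def diff_tm_def pred_tm_def add_tm_def
  by (rule typing.intros typing_Var | simp)+

lemma typing_single_tm: "typing [] single_tm (Nat \<Rrightarrow> Nat)"
  unfolding single_tm_def cons_tm_def nil_tm_def pair_tm_def triangle_tm_def add_tm_def
  by (rule typing.intros typing_Var | simp)+

lemma sub_append_single [simp]: "sub \<sigma> append_tm = append_tm" "sub \<sigma> single_tm = single_tm" "sub \<sigma> nil_tm = nil_tm"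
  using sub_closed typing_append_tm typing_single_tm by (auto simp: nil_tm_def)

lemmas typing_consts = typing_closed[OF typing_append_tm] typing_closed[OF typing_single_tm]
  typing_closed[OF typing_initial] typing_closed[OF typing_add]

lemma ty_initial: "typing \<Gamma> \<alpha> BT \<Longrightarrow> typing \<Gamma> n Nat \<Longrightarrow> typing \<Gamma> (initial_tm \<cdot> \<alpha> \<cdot> n) Nat"
  by (blast intro: typing.intros(5) typing_consts)

lemma ty_append: "typing \<Gamma> a Nat \<Longrightarrow> typing \<Gamma> m Nat \<Longrightarrow> typing \<Gamma> (append_tm \<cdot> a \<cdot> (single_tm \<cdot> m)) Nat"
  by (blast intro: typing.intros(5) typing_consts)

lemma ty_add: "typing \<Gamma> a Nat \<Longrightarrow> typing \<Gamma> b Nat \<Longrightarrow> typing \<Gamma> (add_tm \<cdot> a \<cdot> b) Nat"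
  by (blast intro: typing.intros(5) typing_consts)

lemma ty_Succ: "typing \<Gamma> a Nat \<Longrightarrow> typing \<Gamma> (Succ \<cdot> a) Nat"
  by (blast intro: typing.intros)

lemma ty_Zero: "typing \<Gamma> Zero Nat"
  by (rule typing.intros)

lemma eqv_Lam2:
  assumes "typing (\<rho>2 # \<rho>1 # \<Gamma>) s \<tau>" "typed_sub (ctx w) \<sigma> \<Gamma>" "tmw w \<rho>1 x" "tmw w \<rho>2 y"
  shows "eqv w \<tau> (sub \<sigma> (Lam \<rho>1 (Lam \<rho>2 s)) \<cdot> x \<cdot> y) (sub (case_nat y (case_nat x \<sigma>)) s)"
proof -
  have "eqv w (\<rho>2 \<Rrightarrow> \<tau>) (sub \<sigma> (Lam \<rho>1 (Lam \<rho>2 s)) \<cdot> x) (sub (case_nat x \<sigma>) (Lam \<rho>2 s))"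
    by (rule eqv_Lam[OF typing.intros(6)[OF assms(1)] assms(2,3)])
  from eqv_App[OF this HA.Refl[OF assms(4)]] eqv_Lam[OF assms(1) typed_sub_case[OF assms(3,2)] assms(4)]
  show ?thesis by (rule eqv_trans)
qed

lemma eqv_Succ: "eqv w Nat a b \<Longrightarrow> eqv w Nat (Succ \<cdot> a) (Succ \<cdot> b)"
  by (rule eqv_App[OF HA.Refl[OF typing.intros(3)]])

section \<open>Recursion equations of addition and initial segments\<close>

lemma add_unfold:
  assumes "tmw w Nat a" "tmw w Nat b"
  shows "eqv w Nat (add_tm \<cdot> a \<cdot> b) (Rec Nat \<cdot> a \<cdot> Lam Nat (Lam Nat (Succ \<cdot> Var 0)) \<cdot> b)"
proof -
  have "typing [Nat, Nat] (Rec Nat \<cdot> Var 1 \<cdot> Lam Nat (Lam Nat (Succ \<cdot> Var 0)) \<cdot> Var 0) Nat"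
    by (rule typing.intros(2-6) typing_Var | simp)+
  from eqv_Lam2[OF this, of w Var a b] assms show ?thesis
    by (simp add: add_tm_def typed_sub_def)
qed

lemma add_step_typing: "typing \<Gamma> (Lam Nat (Lam Nat (Succ \<cdot> Var 0))) (Nat \<Rrightarrow> Nat \<Rrightarrow> Nat)"
  by (rule typing.intros(2-6) typing_Var | simp)+

lemma add_Zero: "tmw w Nat a \<Longrightarrow> eqv w Nat (add_tm \<cdot> a \<cdot> Zero) a"
  using add_unfold[OF _ typing.intros(2)] HA.RecZero[OF _ add_step_typing] eqv_trans by blast

lemma add_Succ:
  assumes "tmw w Nat a" "tmw w Nat b"
  shows "eqv w Nat (add_tm \<cdot> a \<cdot> (Succ \<cdot> b)) (Succ \<cdot> (add_tm \<cdot> a \<cdot> b))"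
proof -
  let ?F = "Lam Nat (Lam Nat (Succ \<cdot> Var 0))"
  let ?r = "Rec Nat \<cdot> a \<cdot> ?F \<cdot> b"
  have r: "tmw w Nat ?r" using assms by (blast intro: typing.intros(4,5) add_step_typing)
  have "eqv w Nat (add_tm \<cdot> a \<cdot> (Succ \<cdot> b)) (Rec Nat \<cdot> a \<cdot> ?F \<cdot> (Succ \<cdot> b))"
    by (rule add_unfold[OF assms(1) ty_Succ[OF assms(2)]])
  also have "eqv w Nat (Rec Nat \<cdot> a \<cdot> ?F \<cdot> (Succ \<cdot> b)) (?F \<cdot> b \<cdot> ?r)"
    by (rule HA.RecSucc[OF assms(1) add_step_typing assms(2)])
  also have "eqv w Nat (?F \<cdot> b \<cdot> ?r) (Succ \<cdot> ?r)"
    using eqv_Lam2[of Nat Nat "[]" "Succ \<cdot> Var 0" Nat w Var b ?r] assms(2) r by (simp add: typed_sub_def ty_Succ)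
  also have "eqv w Nat (Succ \<cdot> ?r) (Succ \<cdot> (add_tm \<cdot> a \<cdot> b))"
    by (rule eqv_Succ[OF eqv_sym[OF add_unfold[OF assms]]])
  finally show ?thesis .
qed

text \<open>The step function refers to the environment only through \<alpha>, so \<open>n'\<close>
  is arbitrary. \<open>initial_Succ\<close> thereby has one and the same step function for
  \<open>n\<close> and its successor.\<close>

lemma initial_unfold:
  assumes "tmw w BT \<alpha>" "tmw w Nat n"
  shows "eqv w Nat (initial_tm \<cdot> \<alpha> \<cdot> n) (Rec Nat \<cdot> nil_tm \<cdot>
    sub (env [n', \<alpha>]) (Lam Nat (Lam Nat (append_tm \<cdot> Var 0 \<cdot> (single_tm \<cdot> (Var 3 \<cdot> Var 1))))) \<cdot> n)"
proof -
  have "typing [Nat, BT] (Rec Nat \<cdot> nil_tm \<cdot> Lam Nat (Lam Nat (append_tm \<cdot> Var 0 \<cdot> (single_tm \<cdot> (Var 3 \<cdot> Var 1)))) \<cdot> Var 0) Nat"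
    unfolding nil_tm_def by (rule typing_consts typing.intros(2-6) typing_Var | simp)+
  from eqv_Lam2[OF this, of w Var \<alpha> n] assms show ?thesis
    by (simp add: initial_tm_def typed_sub_def numeral_eq_Suc)
qed

lemma initial_step_typing:
  assumes "tmw w BT \<alpha>" "tmw w Nat n"
  shows "tmw w (Nat \<Rrightarrow> Nat \<Rrightarrow> Nat) (sub (env [n, \<alpha>]) (Lam Nat (Lam Nat (append_tm \<cdot> Var 0 \<cdot> (single_tm \<cdot> (Var 3 \<cdot> Var 1))))))"
proof (rule typing_sub[where \<Gamma> = "[Nat, BT]"])
  show "typing [Nat, BT] (Lam Nat (Lam Nat (append_tm \<cdot> Var 0 \<cdot> (single_tm \<cdot> (Var 3 \<cdot> Var 1))))) (Nat \<Rrightarrow> Nat \<Rrightarrow> Nat)"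
    by (rule typing_consts typing.intros(2-6) typing_Var | simp)+
  show "typed_sub (ctx w) (env [n, \<alpha>]) [Nat, BT]"
    using assms by (auto simp: typed_sub_def nth_Cons senv_def split: nat.split)
qed

lemma initial_Zero: "tmw w BT \<alpha> \<Longrightarrow> eqv w Nat (initial_tm \<cdot> \<alpha> \<cdot> Zero) nil_tm"
  using initial_unfold[OF _ ty_Zero] HA.RecZero[OF ty_Zero initial_step_typing[OF _ ty_Zero]] eqv_trans
  unfolding nil_tm_def by blast

lemma initial_Succ:
  assumes "tmw w BT \<alpha>" "tmw w Nat n"
  shows "eqv w Nat (initial_tm \<cdot> \<alpha> \<cdot> (Succ \<cdot> n)) (append_tm \<cdot> (initial_tm \<cdot> \<alpha> \<cdot> n) \<cdot> (single_tm \<cdot> (\<alpha> \<cdot> n)))"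
proof -
  let ?b = "append_tm \<cdot> Var 0 \<cdot> (single_tm \<cdot> (Var 3 \<cdot> Var 1))"
  let ?F = "sub (env [n, \<alpha>]) (Lam Nat (Lam Nat ?b))"
  let ?r = "Rec Nat \<cdot> nil_tm \<cdot> ?F \<cdot> n"
  note F = initial_step_typing[OF assms]
  have nil: "tmw w Nat nil_tm" unfolding nil_tm_def by (rule ty_Zero)
  have r: "tmw w Nat ?r" using F nil assms by (blast intro: typing.intros(4,5))
  have \<alpha>n: "tmw w Nat (\<alpha> \<cdot> n)" using assms by (rule typing.intros(5))
  have b: "typing [Nat, Nat, Nat, BT] ?b Nat"
    by (rule typing_consts typing.intros(2-6) typing_Var | simp)+
  have "eqv w Nat (initial_tm \<cdot> \<alpha> \<cdot> (Succ \<cdot> n)) (Rec Nat \<cdot> nil_tm \<cdot> ?F \<cdot> (Succ \<cdot> n))"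
    by (rule initial_unfold[OF assms(1) ty_Succ[OF assms(2)]])
  also have "eqv w Nat (Rec Nat \<cdot> nil_tm \<cdot> ?F \<cdot> (Succ \<cdot> n)) (?F \<cdot> n \<cdot> ?r)"
    by (rule HA.RecSucc[OF nil F assms(2)])
  also have "eqv w Nat (?F \<cdot> n \<cdot> ?r) (append_tm \<cdot> ?r \<cdot> (single_tm \<cdot> (\<alpha> \<cdot> n)))"
    using eqv_Lam2[OF b, of w "env [n, \<alpha>]" n ?r] assms r
    by (auto simp: typed_sub_def nth_Cons senv_Cons numeral_eq_Suc split: nat.split)
  also have "eqv w Nat (append_tm \<cdot> ?r \<cdot> (single_tm \<cdot> (\<alpha> \<cdot> n))) (append_tm \<cdot> (initial_tm \<cdot> \<alpha> \<cdot> n) \<cdot> (single_tm \<cdot> (\<alpha> \<cdot> n)))"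
    by (rule eqv_App[OF eqv_App[OF HA.Refl[OF typing_consts(1)] eqv_sym[OF initial_unfold[OF assms]]] HA.Refl])
      (use \<alpha>n in \<open>blast intro: typing.intros(5) typing_consts\<close>)
  finally show ?thesis .
qed

text \<open>The sequence \<beta> with \<open>a\<close> prefixed: a case distinction on the argument,
  programmed as a recursion that returns \<beta> at the predecessor and discards the recursive
  value.\<close>

definition consf :: "tm \<Rightarrow> tm \<Rightarrow> tm" where
  "consf a \<beta> = Lam Nat (Lam BT (Lam Nat (Rec Nat \<cdot> Var 2 \<cdot> Lam Nat (Lam Nat (Var 3 \<cdot> Var 1)) \<cdot> Var 0))) \<cdot> a \<cdot> \<beta>"

lemma consf_body: "typing [Nat, BT, Nat] (Rec Nat \<cdot> Var 2 \<cdot> Lam Nat (Lam Nat (Var 3 \<cdot> Var 1)) \<cdot> Var 0) Nat"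
  by (rule typing.intros(2-6) typing_Var | simp)+

lemma consf_typing: "tmw w Nat a \<Longrightarrow> tmw w BT \<beta> \<Longrightarrow> tmw w BT (consf a \<beta>)"
  unfolding consf_def
  using typing_closed[OF typing.intros(6)[OF typing.intros(6)[OF typing.intros(6)[OF consf_body]]]]
  by (blast intro: typing.intros(5))

lemma consf_unfold:
  assumes "tmw w Nat a" "tmw w BT \<beta>" "tmw w Nat i"
  shows "eqv w Nat (consf a \<beta> \<cdot> i) (Rec Nat \<cdot> a \<cdot> sub (env [i, \<beta>, a]) (Lam Nat (Lam Nat (Var 3 \<cdot> Var 1))) \<cdot> i)"
proof -
  have ts: "typed_sub (ctx w) (case_nat \<beta> (case_nat a Var)) [BT, Nat]"
    using assms by (auto simp: typed_sub_def nth_Cons split: nat.split)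
  let ?b = "Rec Nat \<cdot> Var 2 \<cdot> Lam Nat (Lam Nat (Var 3 \<cdot> Var 1)) \<cdot> Var 0"
  have "eqv w BT (consf a \<beta>) (sub (case_nat \<beta> (case_nat a Var)) (Lam Nat ?b))"
    using eqv_Lam2[OF typing.intros(6)[OF consf_body], of w Var a \<beta>] assms
    by (simp add: consf_def typed_sub_def del: sub.simps(6))
  from eqv_App[OF this HA.Refl[OF assms(3)]] eqv_Lam[OF consf_body ts assms(3)]
  have "eqv w Nat (consf a \<beta> \<cdot> i) (sub (case_nat i (case_nat \<beta> (case_nat a Var))) ?b)"
    by (rule eqv_trans)
  moreover have "case_nat i (case_nat \<beta> (case_nat a Var)) = env [i, \<beta>, a]"
    using senv_Cons[of _ 0] senv_Nil by metis
  ultimately show ?thesis by (simp add: numeral_eq_Suc)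
qed

lemma consf_step:
  assumes "tmw w Nat a" "tmw w BT \<beta>" "tmw w Nat i"
  shows "tmw w (Nat \<Rrightarrow> Nat \<Rrightarrow> Nat) (sub (env [i, \<beta>, a]) (Lam Nat (Lam Nat (Var 3 \<cdot> Var 1))))"
    and "tmw w Nat x \<Longrightarrow> tmw w Nat y \<Longrightarrow>
      eqv w Nat (sub (env [i, \<beta>, a]) (Lam Nat (Lam Nat (Var 3 \<cdot> Var 1))) \<cdot> x \<cdot> y) (\<beta> \<cdot> x)"
proof -
  have ts: "typed_sub (ctx w) (env [i, \<beta>, a]) [Nat, BT, Nat]"
    using assms by (auto simp: typed_sub_def nth_Cons senv_def split: nat.split)
  have b: "typing [Nat, Nat, Nat, BT, Nat] (Var 3 \<cdot> Var 1) Nat"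
    by (rule typing.intros(2-6) typing_Var | simp)+
  show "tmw w (Nat \<Rrightarrow> Nat \<Rrightarrow> Nat) (sub (env [i, \<beta>, a]) (Lam Nat (Lam Nat (Var 3 \<cdot> Var 1))))"
    by (rule typing_sub[OF typing.intros(6)[OF typing.intros(6)[OF b]] ts])
  show "eqv w Nat (sub (env [i, \<beta>, a]) (Lam Nat (Lam Nat (Var 3 \<cdot> Var 1))) \<cdot> x \<cdot> y) (\<beta> \<cdot> x)"
    if "tmw w Nat x" "tmw w Nat y"
    using eqv_Lam2[OF b ts that] by (simp add: senv_Cons numeral_eq_Suc)
qed

lemma consf_Zero:
  assumes "tmw w Nat a" "tmw w BT \<beta>"
  shows "eqv w Nat (consf a \<beta> \<cdot> Zero) a"
  using consf_unfold[OF assms ty_Zero] HA.RecZero[OF assms(1) consf_step(1)[OF assms ty_Zero]]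
  by (rule eqv_trans)

lemma consf_Succ:
  assumes "tmw w Nat a" "tmw w BT \<beta>" "tmw w Nat i"
  shows "eqv w Nat (consf a \<beta> \<cdot> (Succ \<cdot> i)) (\<beta> \<cdot> i)"
proof -
  note S = ty_Succ[OF assms(3)]
  note F = consf_step(1)[OF assms(1,2) S]
  have "tmw w Nat (Rec Nat \<cdot> a \<cdot> sub (env [Succ \<cdot> i, \<beta>, a]) (Lam Nat (Lam Nat (Var 3 \<cdot> Var 1))) \<cdot> i)"
    using assms F by (blast intro: typing.intros(4,5))
  from eqv_trans[OF consf_unfold[OF assms(1,2) S] HA.RecSucc[OF assms(1) F assms(3)]]
    consf_step(2)[OF assms(1,2) S assms(3) this]
  show ?thesis by (rule eqv_trans)
qed

definition tailf :: "tm \<Rightarrow> tm" where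
  "tailf \<alpha> = Lam Nat (ren Suc \<alpha> \<cdot> (Succ \<cdot> Var 0))"

lemma tailf_body: "typing \<Gamma> \<alpha> BT \<Longrightarrow> typing (Nat # \<Gamma>) (ren Suc \<alpha> \<cdot> (Succ \<cdot> Var 0)) Nat"
  by (rule typing.intros(5)[OF typing_ren_Suc ty_Succ[OF typing_Var0]])

lemma tailf_typing: "typing \<Gamma> \<alpha> BT \<Longrightarrow> typing \<Gamma> (tailf \<alpha>) BT"
  unfolding tailf_def by (rule typing.intros(6)[OF tailf_body])

lemma tailf_beta: "tmw w BT \<alpha> \<Longrightarrow> tmw w Nat i \<Longrightarrow> eqv w Nat (tailf \<alpha> \<cdot> i) (\<alpha> \<cdot> (Succ \<cdot> i))"
  using HA.Beta[OF tailf_body, of "ctx w" \<alpha> i "hyps w"] by (simp add: tailf_def)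

section \<open>Cones and the lengths of initial segments\<close>

context bar begin

lemma eqv_absurd:
  assumes "tmw w Nat t" "eqv w Nat Zero (Succ \<cdot> t)" "wff (ctx w) C"
  shows "prv w C"
  using prv_Bot[OF HA.ImpE[OF HA.SuccNotZero[OF assms(1)] eqv_sym[OF assms(2)]] assms(3)] .

text \<open>\<open>add_tm\<close> recurses on its second argument, so equations in the first one,
  here and in \<open>Succ_add\<close>, need induction.\<close>

lemma zero_add:
  assumes "w0 \<sqsubseteq> w" "tmw w Nat m"
  shows "eqv w Nat (add_tm \<cdot> Zero \<cdot> m) m"
proof -
  let ?A = "Eq Nat (add_tm \<cdot> Zero \<cdot> Var 0) (Var 0)"
  have "sat w (m # []) ?A"
  proof (rule sat_Ind[OF assms(1), where \<Theta> = "[]"])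
    show "wf [Nat] ?A" by (simp add: ty_add ty_Zero)
    show "sat w [Zero] ?A" by (simp add: add_Zero ty_Zero)
    fix w' k assume *: "w \<sqsubseteq> w'" "tmw w' Nat k" "sat w' [k] ?A"
    show "sat w' [Succ \<cdot> k] ?A"
      using eqv_trans[OF add_Succ[OF ty_Zero *(2)] eqv_Succ] *(3) by simp
  qed (use assms in auto)
  then show ?thesis by simp
qed

lemma Succ_add:
  assumes "w0 \<sqsubseteq> w" "tmw w Nat k" "tmw w Nat i"
  shows "eqv w Nat (add_tm \<cdot> (Succ \<cdot> k) \<cdot> i) (Succ \<cdot> (add_tm \<cdot> k \<cdot> i))"
proof -
  let ?A = "Eq Nat (add_tm \<cdot> (Succ \<cdot> Var 1) \<cdot> Var 0) (Succ \<cdot> (add_tm \<cdot> Var 1 \<cdot> Var 0))"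
  have "sat w (i # [k]) ?A"
  proof (rule sat_Ind[OF assms(1), where \<Theta> = "[Nat]"])
    show "wf [Nat, Nat] ?A" by (simp add: ty_add ty_Succ)
    show "sat w [Zero, k] ?A"
      using eqv_trans[OF add_Zero[OF ty_Succ[OF assms(2)]] eqv_Succ[OF eqv_sym[OF add_Zero[OF assms(2)]]]] by simp
    fix w' j assume *: "w \<sqsubseteq> w'" "tmw w' Nat j" "sat w' [j, k] ?A"
    note k = tmw_mono[OF *(1) assms(2)]
    have "eqv w' Nat (add_tm \<cdot> (Succ \<cdot> k) \<cdot> j) (Succ \<cdot> (add_tm \<cdot> k \<cdot> j))" using *(3) by simp
    also have "eqv w' Nat (Succ \<cdot> (add_tm \<cdot> k \<cdot> j)) (add_tm \<cdot> k \<cdot> (Succ \<cdot> j))"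
      by (rule eqv_sym[OF add_Succ[OF k *(2)]])
    finally show "sat w' [Succ \<cdot> j, k] ?A"
      using eqv_trans[OF add_Succ[OF ty_Succ[OF k] *(2)] eqv_Succ] by simp
  qed (use assms in auto)
  then show ?thesis by simp
qed

lemma cone_val:
  assumes "cone w \<alpha> n \<beta>" "valid w" "tmw w Nat i" "tmw w Nat k" "eqv w Nat n (Succ \<cdot> (add_tm \<cdot> k \<cdot> i))"
  shows "eqv w Nat (\<beta> \<cdot> i) (\<alpha> \<cdot> i)"
  using assms wle_refl unfolding cone_def by blast

text \<open>For the index n below n + 1 the witness k is zero.\<close>

lemma cone_last:
  assumes "cone w \<alpha> (Succ \<cdot> n) \<beta>" "w0 \<sqsubseteq> w" "tmw w Nat n"
  shows "eqv w Nat (\<beta> \<cdot> n) (\<alpha> \<cdot> n)"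
  by (rule cone_val[OF assms(1) wle_valid(2)[OF assms(2)] assms(3) ty_Zero
      eqv_Succ[OF eqv_sym[OF zero_add[OF assms(2,3)]]]])

text \<open>A witness k for i < n becomes the witness k + 1 for i < n + 1.\<close>

lemma cone_Succ_weaken:
  assumes "cone w \<alpha> (Succ \<cdot> n) \<beta>" "w0 \<sqsubseteq> w"
  shows "cone w \<alpha> n \<beta>"
  unfolding cone_def
proof (intro allI impI)
  fix w' i k assume *: "w \<sqsubseteq> w'" "tmw w' Nat i" "tmw w' Nat k" "eqv w' Nat n (Succ \<cdot> (add_tm \<cdot> k \<cdot> i))"
  have "eqv w' Nat (Succ \<cdot> n) (Succ \<cdot> (add_tm \<cdot> (Succ \<cdot> k) \<cdot> i))"
    using eqv_trans[OF *(4) eqv_sym[OF Succ_add[OF wle_trans[OF assms(2) *(1)] *(3,2)]]] by (rule eqv_Succ)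
  then show "eqv w' Nat (\<beta> \<cdot> i) (\<alpha> \<cdot> i)"
    using assms(1) *(1,2) ty_Succ[OF *(3)] unfolding cone_def by blast
qed

lemma cone_trans: "cone w \<alpha> n \<beta> \<Longrightarrow> cone w \<beta> n \<gamma> \<Longrightarrow> cone w \<alpha> n \<gamma>"
  unfolding cone_def using eqv_trans by blast

lemma ext_Succ:
  assumes "w0 \<sqsubseteq> w" "cone w \<alpha> n \<beta>"
  shows "ext w \<alpha> n \<beta> (Succ \<cdot> n)"
  unfolding ext_def
proof (intro allI impI)
  fix w' \<gamma> assume *: "w \<sqsubseteq> w'" "tmw w' BT \<gamma>" "cone w' \<beta> (Succ \<cdot> n) \<gamma>"
  show "cone w' \<alpha> n \<gamma>"
    by (rule cone_trans[OF cone_mono[OF *(1) assms(2)] cone_Succ_weaken[OF *(3) wle_trans[OF assms(1) *(1)]]])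
qed


text \<open>The induction is on the implication from agreement to equality, because agreement below
  n + 1 must first be weakened to agreement below n; \<open>cone_last\<close> then equates the
  appended values.\<close>

lemma initial_cong:
  assumes "w0 \<sqsubseteq> w" "tmw w BT \<alpha>" "tmw w BT \<beta>" "tmw w Nat n" "cone w \<alpha> n \<beta>"
  shows "eqv w Nat (initial_tm \<cdot> \<alpha> \<cdot> n) (initial_tm \<cdot> \<beta> \<cdot> n)"
proof -
  let ?C = "fsub (senv 3 [Var 1, Var 2, Var 0]) cone_fm"
  let ?E = "Eq Nat (initial_tm \<cdot> Var 2 \<cdot> Var 0) (initial_tm \<cdot> Var 1 \<cdot> Var 0)"
  have wf: "wf [Nat, BT, BT] ?C"
    using wf_reindex[OF wf_cone[of "[]"], of "[Nat, BT, BT]" 3 "[]" "[Var 1, Var 2, Var 0]" "[BT, BT, Nat]"] by simp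
  have wf': "wf [Nat, BT, BT] (?C \<^bold>\<longrightarrow> ?E)" using wf by (simp add: ty_initial)
  have sat: "sat w' [k, \<beta>, \<alpha>] (?C \<^bold>\<longrightarrow> ?E) \<longleftrightarrow> (\<forall>w''. w' \<sqsubseteq> w'' \<longrightarrow> cone w'' \<alpha> k \<beta> \<longrightarrow>
      eqv w'' Nat (initial_tm \<cdot> \<alpha> \<cdot> k) (initial_tm \<cdot> \<beta> \<cdot> k))"
    if w': "w \<sqsubseteq> w'" "tmw w' Nat k" for w' k
  proof -
    have ts: "tms w' [k, \<beta>, \<alpha>] [Nat, BT, BT]" using w' assms(2,3) tmw_mono[OF w'(1)] by simp
    have "sat w'' [k, \<beta>, \<alpha>] ?C \<longleftrightarrow> cone w'' \<alpha> k \<beta>" if w'': "w' \<sqsubseteq> w''" for w''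
    proof -
      have "fsub (env [k, \<beta>, \<alpha>]) ?C = fsub (env [\<beta>, \<alpha>, k]) cone_fm"
        using fsub_reindex[of "[k, \<beta>, \<alpha>]" 3 "[]" "[Var 1, Var 2, Var 0]"] by simp
      then show ?thesis
        using sat_cone[OF wle_trans[OF assms(1) wle_trans[OF w'(1) w'']], of \<beta> \<alpha> k "[]" "[]"] tms_mono[OF w'' ts]
        by simp
    qed
    then show ?thesis unfolding sat_Imp[OF wle_trans[OF assms(1) w'(1)] ts wf] by simp
  qed
  have ww: "w \<sqsubseteq> w" using assms(1) wle_valid wle_refl by blast
  have "sat w (n # [\<beta>, \<alpha>]) (?C \<^bold>\<longrightarrow> ?E)"
  proof (rule sat_Ind[OF assms(1) _ wf' _ _ assms(4)])
    show "tms w [\<beta>, \<alpha>] [BT, BT]" using assms by simp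
    show "sat w [Zero, \<beta>, \<alpha>] (?C \<^bold>\<longrightarrow> ?E)" unfolding sat[OF ww ty_Zero]
      using eqv_trans[OF initial_Zero eqv_sym[OF initial_Zero]] assms(2,3) tmw_mono by blast
    fix w' k assume *: "w \<sqsubseteq> w'" "tmw w' Nat k" "sat w' [k, \<beta>, \<alpha>] (?C \<^bold>\<longrightarrow> ?E)"
    show "sat w' [Succ \<cdot> k, \<beta>, \<alpha>] (?C \<^bold>\<longrightarrow> ?E)" unfolding sat[OF *(1) ty_Succ[OF *(2)]]
    proof (intro allI impI)
      fix w1 assume w1: "w' \<sqsubseteq> w1" "cone w1 \<alpha> (Succ \<cdot> k) \<beta>"
      have le: "w \<sqsubseteq> w1" "w0 \<sqsubseteq> w1" using *(1) w1(1) assms(1) wle_trans by blast+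
      note t = tmw_mono[OF le(1) assms(2)] tmw_mono[OF le(1) assms(3)] tmw_mono[OF w1(1) *(2)]
      have IH: "eqv w1 Nat (initial_tm \<cdot> \<alpha> \<cdot> k) (initial_tm \<cdot> \<beta> \<cdot> k)"
        using *(3) w1(1) cone_Succ_weaken[OF w1(2) le(2)] unfolding sat[OF *(1,2)] by blast
      have "eqv w1 Nat (append_tm \<cdot> (initial_tm \<cdot> \<alpha> \<cdot> k) \<cdot> (single_tm \<cdot> (\<alpha> \<cdot> k)))
          (append_tm \<cdot> (initial_tm \<cdot> \<beta> \<cdot> k) \<cdot> (single_tm \<cdot> (\<beta> \<cdot> k)))"
        by (rule eqv_App[OF eqv_App[OF HA.Refl IH] eqv_App[OF HA.Refl eqv_sym[OF cone_last[OF w1(2) le(2) t(3)]]]])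
          (rule typing_consts)+
      then show "eqv w1 Nat (initial_tm \<cdot> \<alpha> \<cdot> (Succ \<cdot> k)) (initial_tm \<cdot> \<beta> \<cdot> (Succ \<cdot> k))"
        using initial_Succ[OF t(1,3)] initial_Succ[OF t(2,3)] eqv_trans eqv_sym by blast
    qed
  qed
  then show ?thesis unfolding sat[OF ww assms(4)] using ww assms(5) by blast
qed

text \<open>The free variables are \<alpha>, m, n at indices 0, 1, 2, and the bound sequence agrees
  with \<alpha> below n and takes the value m at n.\<close>

definition update_fm :: fm where
  "update_fm = Ex BT (fsub (senv 4 [Var 0, Var 1, Var 3]) cone_fm \<^bold>\<and> Eq Nat (Var 0 \<cdot> Var 3) (Var 2))"

lemma wf_update: "wf [BT, BT, Nat, Nat] (fsub (senv 4 [Var 0, Var 1, Var 3]) cone_fm \<^bold>\<and> Eq Nat (Var 0 \<cdot> Var 3) (Var 2))"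
proof -
  have "typing ([BT, BT, Nat, Nat] @ ctx w0) (Var 0 \<cdot> Var 3) Nat"
    by (rule typing.intros(5)[of _ _ Nat]) simp_all
  then show ?thesis
    using wf_reindex[OF wf_cone[of "[]"], of "[BT, BT, Nat, Nat]" 4 "[]" "[Var 0, Var 1, Var 3]" "[BT, BT, Nat]"] by simp
qed

lemma sat_update_body:
  assumes "w0 \<sqsubseteq> w" "tmw w BT \<beta>" "tmw w BT \<alpha>" "tmw w Nat m" "tmw w Nat n"
  shows "sat w [\<beta>, \<alpha>, m, n] (fsub (senv 4 [Var 0, Var 1, Var 3]) cone_fm \<^bold>\<and> Eq Nat (Var 0 \<cdot> Var 3) (Var 2))
    \<longleftrightarrow> cone w \<alpha> n \<beta> \<and> eqv w Nat (\<beta> \<cdot> n) m"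
proof -
  have "fsub (env [\<beta>, \<alpha>, m, n]) (fsub (senv 4 [Var 0, Var 1, Var 3]) cone_fm) = fsub (env [\<beta>, \<alpha>, n]) cone_fm"
    using fsub_reindex[of "[\<beta>, \<alpha>, m, n]" 4 "[]" "[Var 0, Var 1, Var 3]"] by simp
  then show ?thesis unfolding sat_And using sat_cone[OF assms(1-3,5), of "[]" "[]"] by simp
qed

lemma sat_update_I:
  assumes "w0 \<sqsubseteq> w" "tmw w BT \<beta>" "tmw w BT \<alpha>" "tmw w Nat m" "tmw w Nat n" "cone w \<alpha> n \<beta>" "eqv w Nat (\<beta> \<cdot> n) m"
  shows "sat w [\<alpha>, m, n] update_fm"
  unfolding update_fm_def
  by (rule sat_ExI[OF assms(1) _ wf_update assms(2)]) (use assms in \<open>simp_all only: sat_update_body, simp_all\<close>)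

text \<open>Below zero there is nothing to agree with, since zero would be a successor; hence
  prefixing m to \<alpha> is a correct update.\<close>

lemma update_Zero:
  assumes "w0 \<sqsubseteq> w" "tmw w BT \<alpha>" "tmw w Nat m"
  shows "sat w [\<alpha>, m, Zero] update_fm"
proof (rule sat_update_I[OF assms(1) _ assms(2,3) ty_Zero])
  show "tmw w BT (consf m \<alpha>)" using assms by (simp add: consf_typing)
  show "cone w \<alpha> Zero (consf m \<alpha>)" unfolding cone_def
  proof (intro allI impI)
    fix w' i k assume *: "w \<sqsubseteq> w'" "tmw w' Nat i" "tmw w' Nat k" "eqv w' Nat Zero (Succ \<cdot> (add_tm \<cdot> k \<cdot> i))"
    have "typing (ctx w') (consf m \<alpha> \<cdot> i) Nat" "typing (ctx w') (\<alpha> \<cdot> i) Nat"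
      using *(2) tmw_mono[OF *(1) assms(2)] tmw_mono[OF *(1) assms(3)] consf_typing
      by (blast intro: typing.intros(5))+
    then show "eqv w' Nat (consf m \<alpha> \<cdot> i) (\<alpha> \<cdot> i)"
      by (intro eqv_absurd[OF ty_add[OF *(3,2)] *(4)]) simp
  qed
  show "eqv w Nat (consf m \<alpha> \<cdot> Zero) m" by (rule consf_Zero[OF assms(3,2)])
qed

text \<open>A case distinction on the index i, obtained from object-level induction: at zero by
  \<open>consf_Zero\<close>, at a successor by passing to \<open>tailf \<alpha>\<close> with the
  same witness k.\<close>

lemma cone_consf:
  assumes "w0 \<sqsubseteq> w" "tmw w BT \<alpha>" "tmw w BT \<beta>" "tmw w Nat n" "cone w (tailf \<alpha>) n \<beta>"
  shows "cone w \<alpha> (Succ \<cdot> n) (consf (\<alpha> \<cdot> Zero) \<beta>)"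
  unfolding cone_def
proof (intro allI impI)
  fix w' i k assume *: "w \<sqsubseteq> w'" "tmw w' Nat i" "tmw w' Nat k" "eqv w' Nat (Succ \<cdot> n) (Succ \<cdot> (add_tm \<cdot> k \<cdot> i))"
  have w': "w0 \<sqsubseteq> w'" using assms(1) *(1) by (rule wle_trans)
  note t = tmw_mono[OF *(1) assms(2)] tmw_mono[OF *(1) assms(3)] tmw_mono[OF *(1) assms(4)]
  let ?b = "consf (\<alpha> \<cdot> Zero) \<beta>"
  have a0: "tmw w'' Nat (\<alpha> \<cdot> Zero)" if "tmw w'' BT \<alpha>" for w'' using that ty_Zero by (rule typing.intros(5))
  note b = consf_typing[OF a0[OF t(1)] t(2)]
  let ?C = "Eq Nat (Succ \<cdot> Var 1) (Succ \<cdot> (add_tm \<cdot> Var 2 \<cdot> Var 0))"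
  let ?E = "Eq Nat (Var 3 \<cdot> Var 0) (Var 4 \<cdot> Var 0)"
  let ?ts = "[n, k, ?b, \<alpha>]" and ?\<Theta> = "[Nat, Nat, BT, BT]"
  have wf: "wf (Nat # ?\<Theta>) ?C" by (simp add: ty_Succ ty_add)
  have "typing ((Nat # ?\<Theta>) @ ctx w0) (Var 3 \<cdot> Var 0) Nat" "typing ((Nat # ?\<Theta>) @ ctx w0) (Var 4 \<cdot> Var 0) Nat"
    by (rule typing.intros(5)[of _ _ Nat]; simp)+
  then have wf': "wf (Nat # ?\<Theta>) (?C \<^bold>\<longrightarrow> ?E)" using wf by simp
  have ts: "tms w' ?ts ?\<Theta>" using t *(3) b by simp
  have sat: "sat w'' (x # ?ts) (?C \<^bold>\<longrightarrow> ?E) \<longleftrightarrow> (\<forall>w3. w'' \<sqsubseteq> w3 \<longrightarrow>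
      eqv w3 Nat (Succ \<cdot> n) (Succ \<cdot> (add_tm \<cdot> k \<cdot> x)) \<longrightarrow> eqv w3 Nat (?b \<cdot> x) (\<alpha> \<cdot> x))"
    if w'': "w' \<sqsubseteq> w''" "tmw w'' Nat x" for w'' x
    unfolding sat_Imp[OF wle_trans[OF w' w''(1)] _ wf, of "x # ?ts", simplified list_all2_Cons, OF conjI[OF w''(2) tms_mono[OF w''(1) ts, simplified list_all2_Cons]]]
    by (simp add: numeral_eq_Suc)
  have ww: "w' \<sqsubseteq> w'" using *(1) wle_valid wle_refl by blast
  have "sat w' (i # ?ts) (?C \<^bold>\<longrightarrow> ?E)"
  proof (rule sat_Ind[OF w' ts wf' _ _ *(2)])
    show "sat w' (Zero # ?ts) (?C \<^bold>\<longrightarrow> ?E)" unfolding sat[OF ww ty_Zero]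
      using consf_Zero[OF a0] tmw_mono t by blast
    fix w1 x assume x: "w' \<sqsubseteq> w1" "tmw w1 Nat x"
    show "sat w1 (Succ \<cdot> x # ?ts) (?C \<^bold>\<longrightarrow> ?E)" unfolding sat[OF x(1) ty_Succ[OF x(2)]]
    proof (intro allI impI)
      fix w2 assume w2: "w1 \<sqsubseteq> w2" "eqv w2 Nat (Succ \<cdot> n) (Succ \<cdot> (add_tm \<cdot> k \<cdot> (Succ \<cdot> x)))"
      have le: "w' \<sqsubseteq> w2" "w \<sqsubseteq> w2" using x(1) w2(1) *(1) wle_trans by blast+
      note t2 = tmw_mono[OF le(1) t(1)] tmw_mono[OF le(1) t(2)] tmw_mono[OF le(1) *(3)] tmw_mono[OF w2(1) x(2)]
      have "eqv w2 Nat n (Succ \<cdot> (add_tm \<cdot> k \<cdot> x))"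
        by (rule eqv_trans[OF HA.SuccInj[OF w2(2)] add_Succ[OF t2(3,4)]])
      from cone_val[OF cone_mono[OF le(2) assms(5)] wle_valid(2)[OF le(1)] t2(4,3) this]
      have "eqv w2 Nat (\<beta> \<cdot> x) (tailf \<alpha> \<cdot> x)" .
      from eqv_trans[OF consf_Succ[OF a0[OF t2(1)] t2(2,4)] eqv_trans[OF this tailf_beta[OF t2(1,4)]]]
      show "eqv w2 Nat (?b \<cdot> (Succ \<cdot> x)) (\<alpha> \<cdot> (Succ \<cdot> x))" .
    qed
  qed
  then show "eqv w' Nat (?b \<cdot> i) (\<alpha> \<cdot> i)" unfolding sat[OF ww *(2)] using ww *(4) by blast
qed

lemma update_Succ:
  assumes "w0 \<sqsubseteq> w" "tmw w BT \<alpha>" "tmw w Nat m" "tmw w Nat n" "sat w [tailf \<alpha>, m, n] update_fm"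
  shows "sat w [\<alpha>, m, Succ \<cdot> n] update_fm"
proof (rule sat_ExE[OF wle_valid(2)[OF assms(1)] assms(5)[unfolded update_fm_def]])
  have "wf [BT, Nat, Nat] update_fm" using wf_update unfolding update_fm_def by simp
  then show "wff (ctx w) (fsub (env [\<alpha>, m, Succ \<cdot> n]) update_fm)"
    by (rule wff_env[OF assms(1), rotated]) (use assms in \<open>simp add: ty_Succ\<close>)
  fix w' \<beta> assume w': "w \<sqsubseteq> w'" "tmw w' BT \<beta>"
    and "sat w' [\<beta>, tailf \<alpha>, m, n] (fsub (senv 4 [Var 0, Var 1, Var 3]) cone_fm \<^bold>\<and> Eq Nat (Var 0 \<cdot> Var 3) (Var 2))"
  note le = wle_trans[OF assms(1) w'(1)]
  note t = tmw_mono[OF w'(1) assms(2)] tmw_mono[OF w'(1) assms(3)] tmw_mono[OF w'(1) assms(4)]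
  have \<beta>: "cone w' (tailf \<alpha>) n \<beta>" "eqv w' Nat (\<beta> \<cdot> n) m"
    using \<open>sat w' [\<beta>, tailf \<alpha>, m, n] _\<close> sat_update_body[OF le w'(2) tailf_typing[OF t(1)] t(2,3)] by blast+
  have a0: "tmw w' Nat (\<alpha> \<cdot> Zero)" using t(1) ty_Zero by (rule typing.intros(5))
  show "sat w' [\<alpha>, m, Succ \<cdot> n] update_fm"
    by (rule sat_update_I[OF le consf_typing[OF a0 w'(2)] t(1,2) ty_Succ[OF t(3)] cone_consf[OF le t(1) w'(2) t(3) \<beta>(1)]
        eqv_trans[OF consf_Succ[OF a0 w'(2) t(3)] \<beta>(2)]])
qed

text \<open>Induction on n with \<alpha> and m bound inside the formula, because the step updates
  \<open>tailf \<alpha>\<close> and then prefixes the value of \<alpha> at zero. Updating by shifts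
  avoids programming an equality test on numbers.\<close>

lemma update_exists:
  assumes "w0 \<sqsubseteq> w" "tmw w BT \<alpha>" "tmw w Nat m" "tmw w Nat n"
  shows "sat w [\<alpha>, m, n] update_fm"
proof -
  let ?A = "All Nat (All BT update_fm)"
  have wf: "wf [BT, Nat, Nat] update_fm" using wf_update unfolding update_fm_def by simp
  have sat: "sat w' [k] ?A \<longleftrightarrow> (\<forall>w1 m. w' \<sqsubseteq> w1 \<longrightarrow> tmw w1 Nat m \<longrightarrow>
      (\<forall>w2 \<alpha>. w1 \<sqsubseteq> w2 \<longrightarrow> tmw w2 BT \<alpha> \<longrightarrow> sat w2 [\<alpha>, m, k] update_fm))"
    if w': "w0 \<sqsubseteq> w'" "tmw w' Nat k" for w' k
  proof -
    have "sat w' [k] ?A \<longleftrightarrow> (\<forall>w1 m. w' \<sqsubseteq> w1 \<longrightarrow> tmw w1 Nat m \<longrightarrow> sat w1 [m, k] (All BT update_fm))"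
      by (rule sat_All[OF w'(1), where \<Theta> = "[Nat]"]) (use w' wf in simp_all)
    moreover have "sat w1 [m, k] (All BT update_fm) \<longleftrightarrow>
        (\<forall>w2 \<alpha>. w1 \<sqsubseteq> w2 \<longrightarrow> tmw w2 BT \<alpha> \<longrightarrow> sat w2 [\<alpha>, m, k] update_fm)"
      if "w' \<sqsubseteq> w1" "tmw w1 Nat m" for w1 m
      by (rule sat_All[OF wle_trans[OF w'(1) that(1)], where \<Theta> = "[Nat, Nat]"])
        (use tmw_mono[OF that(1) w'(2)] that(2) wf in simp_all)
    ultimately show ?thesis by simp
  qed
  have "sat w (n # []) ?A"
  proof (rule sat_Ind[OF assms(1), where \<Theta> = "[]"])
    show "tms w [] []" "wf [Nat] ?A" "tmw w Nat n" using wf assms by simp_all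
    show "sat w [Zero] ?A" unfolding sat[OF assms(1) ty_Zero]
      using update_Zero assms(1) wle_trans tmw_mono by blast
    fix w' k assume *: "w \<sqsubseteq> w'" "tmw w' Nat k" "sat w' [k] ?A"
    note w' = wle_trans[OF assms(1) *(1)]
    show "sat w' [Succ \<cdot> k] ?A" unfolding sat[OF w' ty_Succ[OF *(2)]]
    proof (intro allI impI)
      fix w1 m w2 \<alpha> assume 1: "w' \<sqsubseteq> w1" "tmw w1 Nat m" "w1 \<sqsubseteq> w2" "tmw w2 BT \<alpha>"
      note w2 = wle_trans[OF 1(1,3)]
      have "sat w2 [tailf \<alpha>, m, k] update_fm"
        using *(3) 1 tailf_typing[OF 1(4)] unfolding sat[OF w' *(2)] by blast
      then show "sat w2 [\<alpha>, m, Succ \<cdot> k] update_fm"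
        by (rule update_Succ[OF wle_trans[OF w' w2] 1(4) tmw_mono[OF 1(3,2)] tmw_mono[OF w2 *(2)]])
    qed
  qed
  moreover have "w \<sqsubseteq> w" using assms(1) wle_valid wle_refl by blast
  ultimately show ?thesis using assms(2,3) unfolding sat[OF assms(1,4)] by blast
qed

lemma cone_exists:
  assumes "w0 \<sqsubseteq> w" "tmw w BT \<alpha>" "tmw w Nat m" "tmw w Nat n" "wff (ctx w) C"
    and "\<And>w' \<beta>. w \<sqsubseteq> w' \<Longrightarrow> tmw w' BT \<beta> \<Longrightarrow> cone w' \<alpha> n \<beta> \<Longrightarrow> eqv w' Nat (\<beta> \<cdot> n) m \<Longrightarrow> prv w' C"
  shows "prv w C"
proof (rule sat_ExE[OF wle_valid(2)[OF assms(1)] update_exists[OF assms(1-4), unfolded update_fm_def] assms(5)])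
  fix w' \<beta> assume w': "w \<sqsubseteq> w'" "tmw w' BT \<beta>"
    and "sat w' [\<beta>, \<alpha>, m, n] (fsub (senv 4 [Var 0, Var 1, Var 3]) cone_fm \<^bold>\<and> Eq Nat (Var 0 \<cdot> Var 3) (Var 2))"
  then show "prv w' C"
    using assms(6)[OF w'] sat_update_body[OF wle_trans[OF assms(1) w'(1)] w'(2), of \<alpha> m n]
      tmw_mono[OF w'(1)] assms(2-4) by blast
qed

end

section \<open>The generic sequence\<close>

locale bar_inductive = bar +
  assumes Q_hereditary: "prv w0 (All Nat (All Nat (inst 2 (append_tm \<cdot> Var 1 \<cdot> (single_tm \<cdot> Var 0)) Q) \<^bold>\<longrightarrow> Q))"
begin

lemma sat_eqv_single:
  assumes "w0 \<sqsubseteq> w" "wf [\<rho>] A" "eqv w \<rho> a b" "sat w [a] A"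
  shows "sat w [b] A"
  by (rule sat_eqv[OF assms(1) _ _ assms(2) _ assms(4)]) (use assms(3) eqv_typed[OF assms(3)] in auto)

lemma Q_inductive:
  assumes "w0 \<sqsubseteq> w" "tmw w Nat a"
    and "\<And>w' m. w \<sqsubseteq> w' \<Longrightarrow> tmw w' Nat m \<Longrightarrow> sat w' [append_tm \<cdot> a \<cdot> (single_tm \<cdot> m)] Q"
  shows "sat w [a] Q"
proof -
  let ?s = "append_tm \<cdot> Var 1 \<cdot> (single_tm \<cdot> Var 0)"
  let ?I = "fsub (senv 2 [?s]) Q"
  have s: "typing ([Nat, Nat] @ [] @ ctx w0) ?s Nat"
    by (rule ty_append) simp_all
  have wf: "wf [Nat, Nat] ?I"
    using wf_reindex[of "[Nat]" Q "[Nat, Nat]" 2 "[]" "[?s]" "[Nat]"] Q s by simp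
  then have wf': "wf [Nat] (All Nat ?I)" "wf [Nat] (All Nat ?I \<^bold>\<longrightarrow> Q)" using Q by simp_all
  have "sat w0 [] (All Nat (All Nat ?I \<^bold>\<longrightarrow> Q))" using Q_hereditary by (simp add: inst_senv)
  then have "sat w [a] (All Nat ?I \<^bold>\<longrightarrow> Q)"
    using sat_All[OF wle_refl[OF w0] _ wf'(2), of "[]"] assms(1,2) by simp
  moreover have "sat w [a] (All Nat ?I)"
  proof -
    have "sat w [a] (All Nat ?I) \<longleftrightarrow> (\<forall>w' m. w \<sqsubseteq> w' \<longrightarrow> tmw w' Nat m \<longrightarrow> sat w' [m, a] ?I)"
      by (rule sat_All[OF assms(1) _ wf]) (use assms(2) in simp)
    moreover have "sat w' [m, a] ?I" if "w \<sqsubseteq> w'" "tmw w' Nat m" for w' m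
      using assms(3)[OF that] fsub_reindex[of "[m, a]" 2 "[]" "[?s]"] by simp
    ultimately show ?thesis by blast
  qed
  moreover have "w \<sqsubseteq> w" using assms(1) wle_valid wle_refl by blast
  ultimately show ?thesis using sat_Imp[OF assms(1) _ wf'(1), of "[a]"] assms(2) by simp
qed

text \<open>To apply the inductivity of Q, each code a * <m> must be met as an initial segment:
  \<open>cone_exists\<close> supplies \<beta> in the cone with value m at n, and by
  \<open>initial_cong\<close> its segment of length n + 1 is a * <m>.\<close>

lemma Qbar_step:
  assumes "cond_ok (w, \<alpha>, n)"
    and "\<And>w' \<beta>. w \<sqsubseteq> w' \<Longrightarrow> tmw w' BT \<beta> \<Longrightarrow> cone w' \<alpha> n \<beta> \<Longrightarrow> Qbar (w', \<beta>, Succ \<cdot> n)"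
  shows "Qbar (w, \<alpha>, n)"
  unfolding Qbar.simps
proof (rule Q_inductive)
  show w: "w0 \<sqsubseteq> w" and "tmw w Nat (initial_tm \<cdot> \<alpha> \<cdot> n)" using assms(1) by (simp_all add: ty_initial)
  fix w' m assume w': "w \<sqsubseteq> w'" "tmw w' Nat m"
  note le = wle_trans[OF w w'(1)]
  have t: "tmw w' BT \<alpha>" "tmw w' Nat n" using assms(1) tmw_mono[OF w'(1)] by simp_all
  let ?a = "append_tm \<cdot> (initial_tm \<cdot> \<alpha> \<cdot> n) \<cdot> (single_tm \<cdot> m)"
  note a = ty_append[OF ty_initial[OF t] w'(2)]
  have Q': "wf [Nat] Q" using Q by simp
  show "sat w' [?a] Q"
  proof (rule cone_exists[OF le t(1) w'(2) t(2)])
    show "wff (ctx w') (fsub (env [?a]) Q)"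
      by (rule wff_env[OF le _ Q']) (use a in simp)
    fix w2 \<beta> assume *: "w' \<sqsubseteq> w2" "tmw w2 BT \<beta>" "cone w2 \<alpha> n \<beta>" "eqv w2 Nat (\<beta> \<cdot> n) m"
    note le2 = wle_trans[OF le *(1)] wle_trans[OF w'(1) *(1)]
    note t2 = tmw_mono[OF *(1) t(1)] tmw_mono[OF *(1) t(2)]
    have "eqv w2 Nat (initial_tm \<cdot> \<beta> \<cdot> (Succ \<cdot> n)) (append_tm \<cdot> (initial_tm \<cdot> \<beta> \<cdot> n) \<cdot> (single_tm \<cdot> (\<beta> \<cdot> n)))"
      by (rule initial_Succ[OF *(2) t2(2)])
    also have "eqv w2 Nat (append_tm \<cdot> (initial_tm \<cdot> \<beta> \<cdot> n) \<cdot> (single_tm \<cdot> (\<beta> \<cdot> n))) ?a"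
      by (rule eqv_App[OF eqv_App[OF HA.Refl eqv_sym[OF initial_cong[OF le2(1) t2(1) *(2) t2(2) *(3)]]]
            eqv_App[OF HA.Refl *(4)]]) (rule typing_consts)+
    finally have e: "eqv w2 Nat (initial_tm \<cdot> \<beta> \<cdot> (Succ \<cdot> n)) ?a" .
    have "Qbar (w2, \<beta>, Succ \<cdot> n)" by (rule assms(2)[OF le2(2) *(2,3)])
    then show "sat w2 [?a] Q" unfolding Qbar.simps by (rule sat_eqv_single[OF le2(1) Q' e])
  qed
qed

section \<open>Covering by long conditions, and the generic sequence\<close>

fun longer :: "tm \<Rightarrow> cond \<Rightarrow> bool" where
  "longer m (w, \<alpha>, n) \<longleftrightarrow> (\<exists>k. tmw w Nat k \<and> eqv w Nat n (add_tm \<cdot> k \<cdot> m))"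

lemma defin_longer: "defin [Nat] (\<lambda>ts. j (longer (hd ts)))"
proof -
  let ?A = "Eq Nat (Var 1) (add_tm \<cdot> Var 2 \<cdot> Var 3)"
  have "defin [Nat, Nat] (\<lambda>ts (w, \<alpha>, n). eqv w Nat n (add_tm \<cdot> (ts ! 0) \<cdot> (ts ! 1)))"
  proof (rule definI[of _ ?A])
    show "wf [BT, Nat, Nat, Nat] ?A" by (simp add: ty_add)
    fix w \<alpha> n ts assume "tms w ts [Nat, Nat]"
    then obtain k m where "ts = [k, m]" by (auto simp: list_all2_Cons2)
    then show "(case (w, \<alpha>, n) of (w, \<alpha>, n) \<Rightarrow> eqv w Nat n (add_tm \<cdot> (ts ! 0) \<cdot> (ts ! 1))) \<longleftrightarrow> sat w (\<alpha> # n # ts) ?A"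
      by (simp add: numeral_eq_Suc)
  qed
  from defin_jex[OF this] show ?thesis
  proof (rule defin_cong)
    fix c :: cond and ts assume "tms (fst c) ts [Nat]"
    then obtain m where ts: "ts = [m]" by (auto simp: list_all2_Cons2)
    show "j (longer (hd ts)) c \<longleftrightarrow> j (\<lambda>c. \<exists>x. tmw (fst c) Nat x \<and>
        (case c of (w, \<alpha>, n) \<Rightarrow> eqv w Nat n (add_tm \<cdot> ((x # ts) ! 0) \<cdot> ((x # ts) ! 1)))) c"
      unfolding ts by (rule j_cong) (auto split: prod.split)
  qed
qed

text \<open>Here the inductivity of Q becomes a covering property: if all one-step prolongations of
  a condition satisfy Q, so does the condition, hence under \<open>j\<close> length may be increased
  by one.\<close>

lemma longer_Succ:
  assumes "j (longer m) c" "tmw (fst c) Nat m"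
  shows "j (longer (Succ \<cdot> m)) c"
  unfolding j_def
proof (intro allI impI)
  fix c1 assume c1: "c \<preceq> c1" "\<forall>c2. c1 \<preceq> c2 \<longrightarrow> longer (Succ \<cdot> m) c2 \<longrightarrow> Qbar c2"
  show "Qbar c1"
  proof (rule j_D[OF j_up[OF assms(1) c1(1)] cond_le_cond_ok(2)[OF c1(1)]])
    fix c2 assume c2: "c1 \<preceq> c2" "longer m c2"
    obtain w \<alpha> n where c: "c2 = (w, \<alpha>, n)" by (cases c2)
    obtain k where k: "tmw w Nat k" "eqv w Nat n (add_tm \<cdot> k \<cdot> m)" using c2(2) by (auto simp: c)
    have m: "tmw w Nat m" using tmw_cond_le[OF cond_le_trans[OF c1(1) c2(1)] assms(2)] by (simp add: c)
    have ok: "cond_ok (w, \<alpha>, n)" using cond_le_cond_ok(2)[OF c2(1)] by (simp add: c)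
    show "Qbar c2" unfolding c
    proof (rule Qbar_step[OF ok])
      fix w' \<beta> assume *: "w \<sqsubseteq> w'" "tmw w' BT \<beta>" "cone w' \<alpha> n \<beta>"
      have w': "w0 \<sqsubseteq> w'" using ok *(1) wle_trans by auto
      have le: "(w, \<alpha>, n) \<preceq> (w', \<beta>, Succ \<cdot> n)"
        using ok * w' ext_Succ[OF w' *(3)] tmw_mono[OF *(1)] by (simp add: ty_Succ)
      have "longer (Succ \<cdot> m) (w', \<beta>, Succ \<cdot> n)"
        using tmw_mono[OF *(1) k(1)] eqv_trans[OF eqv_Succ[OF prv_mono[OF *(1) k(2)]]
            eqv_sym[OF add_Succ[OF tmw_mono[OF *(1) k(1)] tmw_mono[OF *(1) m]]]] by auto
      then show "Qbar (w', \<beta>, Succ \<cdot> n)" using c1(2) cond_le_trans[OF c2(1)[unfolded c] le] by blast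
    qed
  qed
qed

text \<open>Again an induction inside the theory, since \<open>m\<close> is a term; at zero, every
  length n equals n + 0.\<close>

lemma cover:
  assumes "cond_ok c" "tmw (fst c) Nat m"
  shows "j (longer m) c"
proof -
  obtain w \<alpha> n where c: "c = (w, \<alpha>, n)" by (cases c)
  have "j (longer (hd (m # []))) (w, \<alpha>, n)"
  proof (rule defin_Ind[OF defin_longer])
    show "cond_ok (w, \<alpha>, n)" "tms w [] []" "tmw w Nat m" using assms c by simp_all
    show "j (longer (hd [Zero])) (w, \<alpha>, n)"
    proof (rule j_ret)
      fix c' assume c': "(w, \<alpha>, n) \<preceq> c'"
      obtain w' \<alpha>' n' where c2: "c' = (w', \<alpha>', n')" by (cases c')
      have "tmw w' Nat n'" using cond_le_cond_ok(2)[OF c'] by (simp add: c2)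
      then show "longer (hd [Zero]) c'" using eqv_sym[OF add_Zero] by (auto simp: c2)
    qed
    fix w' k assume "tmw w' Nat k" "j (longer (hd [k])) (w', \<alpha>, n)"
    then show "j (longer (hd [Succ \<cdot> k])) (w', \<alpha>, n)" using longer_Succ[of k "(w', \<alpha>, n)"] by simp
  qed
  then show ?thesis by (simp add: c)
qed

definition generic :: tm where
  "generic = Lam BT (Var 0)"

lemma generic_typing: "typing \<Gamma> generic (BT \<Rrightarrow> BT)"
  unfolding generic_def by (rule typing.intros(6)[OF typing_Var0])

lemma generic_beta: "tmw w BT \<beta> \<Longrightarrow> eqv w BT (generic \<cdot> \<beta>) \<beta>"
  using HA.Beta[OF typing_Var0, of "ctx w" \<beta> BT "hyps w"] by (simp add: generic_def)

text \<open>On a cover the argument is a constant m, and a condition of length greater than m fixes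
  the value of the generic sequence at m to that of \<alpha>.\<close>

lemma tame_generic:
  assumes "cond_ok c"
  shows "tame BT generic c"
  unfolding tame.simps(2)
proof (intro allI impI)
  fix c' x assume c': "c \<preceq> c'" and x: "tmw (fst c') (BT \<Rrightarrow> Nat) x" "tame Nat x c'"
  show "tame Nat (sapp generic x) c'" unfolding tame.simps
  proof (rule j_bind[OF x(2)[unfolded tame.simps]])
    fix c1 assume c1: "c' \<preceq> c1" and "\<exists>m. tmw (fst c1) Nat m \<and> agree Nat c1 x (konst m)"
    then obtain m where m: "tmw (fst c1) Nat m" "agree Nat c1 x (konst m)" by blast
    show "j (\<lambda>c. \<exists>m. tmw (fst c) Nat m \<and> agree Nat c (sapp generic x) (konst m)) c1"
    \<comment> \<open>The value at m is determined only from length m + 1 on.\<close>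
    proof (rule j_mono[OF cover[OF cond_le_cond_ok(2)[OF c1] ty_Succ[OF m(1)]]])
      fix c2 assume c2: "c1 \<preceq> c2" "longer (Succ \<cdot> m) c2"
      obtain w \<alpha> n where c: "c2 = (w, \<alpha>, n)" by (cases c2)
      obtain k where k: "tmw w Nat k" "eqv w Nat n (add_tm \<cdot> k \<cdot> (Succ \<cdot> m))" using c2(2) by (auto simp: c)
      have tm: "tmw w Nat m" using tmw_cond_le[OF c2(1) m(1)] by (simp add: c)
      have tx: "tmw w (BT \<Rrightarrow> Nat) x" using tmw_cond_le[OF cond_le_trans[OF c1 c2(1)] x(1)] by (simp add: c)
      have \<alpha>: "tmw w BT \<alpha>" using cond_le_cond_ok(2)[OF c2(1)] by (simp add: c)
      have n: "eqv w Nat n (Succ \<cdot> (add_tm \<cdot> k \<cdot> m))" by (rule eqv_trans[OF k(2) add_Succ[OF k(1) tm]])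
      have am: "tmw w Nat (\<alpha> \<cdot> m)" using \<alpha> tm by (rule typing.intros(5))
      have "agree Nat c2 (sapp generic x) (konst (\<alpha> \<cdot> m))" unfolding c agree.simps
      proof (intro allI impI)
        fix w' \<beta> assume *: "w \<sqsubseteq> w'" "tmw w' BT \<beta>" "cone w' \<alpha> n \<beta>"
        have "eqv w' Nat (x \<cdot> \<beta>) (konst m \<cdot> \<beta>)"
          using agree_mono[OF m(2) c2(1)] * by (simp add: c)
        also have "eqv w' Nat (konst m \<cdot> \<beta>) m" by (rule konst_beta[OF tmw_mono[OF *(1) tm] *(2)])
        finally have xm: "eqv w' Nat (x \<cdot> \<beta>) m" .
        have "eqv w' Nat (sapp generic x \<cdot> \<beta>) (generic \<cdot> \<beta> \<cdot> (x \<cdot> \<beta>))"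
          by (rule sapp_beta[OF generic_typing tmw_mono[OF *(1) tx] *(2)])
        also have "eqv w' Nat (generic \<cdot> \<beta> \<cdot> (x \<cdot> \<beta>)) (\<beta> \<cdot> m)"
          by (rule eqv_App[OF generic_beta[OF *(2)] xm])
        also have "eqv w' Nat (\<beta> \<cdot> m) (\<alpha> \<cdot> m)"
          by (rule cone_val[OF *(3) wle_valid(2)[OF *(1)] tmw_mono[OF *(1) tm] tmw_mono[OF *(1) k(1)] prv_mono[OF *(1) n]])
        also have "eqv w' Nat (\<alpha> \<cdot> m) (konst (\<alpha> \<cdot> m) \<cdot> \<beta>)"
          by (rule eqv_sym[OF konst_beta[OF tmw_mono[OF *(1) am] *(2)]])
        finally show "eqv w' Nat (sapp generic x \<cdot> \<beta>) (konst (\<alpha> \<cdot> m) \<cdot> \<beta>)" .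
      qed
      then show "\<exists>m. tmw (fst c2) Nat m \<and> agree Nat c2 (sapp generic x) (konst m)" using am by (auto simp: c)
    qed
  qed
qed

text \<open>The bar is met at some length m while the condition has length k + m. Monotonicity of P,
  applied once per added value in an induction on k, bridges the gap.\<close>

lemma monotone_prefix:
  assumes P: "wf [Nat] P" and mono: "\<And>w a b. w0 \<sqsubseteq> w \<Longrightarrow> tmw w Nat a \<Longrightarrow> tmw w Nat b \<Longrightarrow> sat w [a] P \<Longrightarrow> sat w [append_tm \<cdot> a \<cdot> b] P"
    and w: "w0 \<sqsubseteq> w" and t: "tmw w BT \<alpha>" "tmw w Nat m" "tmw w Nat k" and m: "sat w [initial_tm \<cdot> \<alpha> \<cdot> m] P"
  shows "sat w [initial_tm \<cdot> \<alpha> \<cdot> (add_tm \<cdot> k \<cdot> m)] P"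
proof -
  let ?s = "initial_tm \<cdot> Var 1 \<cdot> (add_tm \<cdot> Var 0 \<cdot> Var 2)"
  let ?A = "fsub (senv 3 [?s]) P"
  have re: "fsub (env [x, \<alpha>, m]) ?A = fsub (env [initial_tm \<cdot> \<alpha> \<cdot> (add_tm \<cdot> x \<cdot> m)]) P" for x
    using fsub_reindex[of "[x, \<alpha>, m]" 3 "[]" "[?s]"] by (simp add: numeral_eq_Suc)
  have s: "typing ([Nat, BT, Nat] @ [] @ ctx w0) ?s Nat"
    by (rule ty_initial[OF _ ty_add]) simp_all
  have "sat w (k # [\<alpha>, m]) ?A"
  proof (rule sat_Ind[OF w, where \<Theta> = "[BT, Nat]"])
    show "tms w [\<alpha>, m] [BT, Nat]" "tmw w Nat k" using t by simp_all
    show "wf [Nat, BT, Nat] ?A"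
      using wf_reindex[OF P, of "[Nat, BT, Nat]" 3 "[]" "[?s]" "[Nat]"] s by simp
    have "eqv w Nat (initial_tm \<cdot> \<alpha> \<cdot> m) (initial_tm \<cdot> \<alpha> \<cdot> (add_tm \<cdot> Zero \<cdot> m))"
      by (rule eqv_App[OF HA.Refl eqv_sym[OF zero_add[OF w t(2)]]])
        (use t(1) in \<open>blast intro: typing.intros(5) typing_consts\<close>)
    then show "sat w [Zero, \<alpha>, m] ?A" unfolding re by (rule sat_eqv_single[OF w P _ m])
    fix w' x assume *: "w \<sqsubseteq> w'" "tmw w' Nat x" "sat w' [x, \<alpha>, m] ?A"
    note w' = wle_trans[OF w *(1)]
    note t' = tmw_mono[OF *(1) t(1)] tmw_mono[OF *(1) t(2)]
    note a = ty_add[OF *(2) t'(2)]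
    have ax: "tmw w' Nat (\<alpha> \<cdot> (add_tm \<cdot> x \<cdot> m))" using t'(1) a by (rule typing.intros(5))
    have "sat w' [append_tm \<cdot> (initial_tm \<cdot> \<alpha> \<cdot> (add_tm \<cdot> x \<cdot> m)) \<cdot> (single_tm \<cdot> (\<alpha> \<cdot> (add_tm \<cdot> x \<cdot> m)))] P"
      by (rule mono[OF w' ty_initial[OF t'(1) a] _ *(3)[unfolded re]])
        (use ax in \<open>blast intro: typing.intros(5) typing_consts\<close>)
    moreover have "eqv w' Nat (initial_tm \<cdot> \<alpha> \<cdot> (Succ \<cdot> (add_tm \<cdot> x \<cdot> m))) (initial_tm \<cdot> \<alpha> \<cdot> (add_tm \<cdot> (Succ \<cdot> x) \<cdot> m))"
      by (rule eqv_App[OF HA.Refl eqv_sym[OF Succ_add[OF w' *(2) t'(2)]]])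
        (use t'(1) in \<open>blast intro: typing.intros(5) typing_consts\<close>)
    ultimately show "sat w' [Succ \<cdot> x, \<alpha>, m] ?A" unfolding re
      using sat_eqv_single[OF w' P eqv_trans[OF eqv_sym[OF initial_Succ[OF t'(1) a]]]] by blast
  qed
  then show ?thesis unfolding re .
qed

lemma bar_induction:
  assumes P: "wff [Nat] P"
    and bar: "HA [] {} (All BT (Ex Nat (inst 2 (initial_tm \<cdot> Var 1 \<cdot> Var 0) P)))"
    and mono: "\<And>w a b. w0 \<sqsubseteq> w \<Longrightarrow> tmw w Nat a \<Longrightarrow> tmw w Nat b \<Longrightarrow> sat w [a] P \<Longrightarrow> sat w [append_tm \<cdot> a \<cdot> b] P"
    and PQ: "\<And>w a. w0 \<sqsubseteq> w \<Longrightarrow> tmw w Nat a \<Longrightarrow> sat w [a] P \<Longrightarrow> sat w [a] Q"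
  shows "sat w0 [nil_tm] Q"
proof -
  \<comment> \<open>The root condition has length zero, so its cone contains every sequence and the
    choice of the constant zero sequence is immaterial.\<close>
  let ?z = "Lam Nat Zero"
  let ?c0 = "(w0, ?z, Zero)"
  let ?s = "initial_tm \<cdot> Var 1 \<cdot> Var 0"
  let ?B = "inst 2 ?s P"
  have z: "tmw w0 BT ?z" by (intro typing.intros)
  have ok: "cond_ok ?c0" using z ty_Zero wle_refl[OF w0] by simp
  have wfP: "wf [Nat] P" using wff_append[OF P] by simp
  have wfB: "wff [Nat, BT] ?B" using HA_wff[OF bar] by simp
  have B: "fsub (env [a, b]) ?B = fsub (env [initial_tm \<cdot> b \<cdot> a]) P" for a b
    using fsub_reindex[of "[a, b]" 2 "[]" "[?s]"] by (simp add: inst_senv)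
  have "good [] [] ?c0" using ok by (simp add: good_def)
  then have "forces (All BT (Ex Nat ?B)) [] ?c0"
    using forcedD[OF soundness[OF bar]] by simp
  then have "forces (Ex Nat ?B) [generic] ?c0"
    using cond_le_refl[OF ok] tame_generic[OF ok] generic_typing by simp
  then have "j (\<lambda>c. \<exists>x. tmw (fst c) (BT \<Rrightarrow> Nat) x \<and> tame Nat x c \<and> forces ?B [x, generic] c) ?c0" by simp
  then have "j Qbar ?c0"
  proof (rule j_bind)
    fix c1 assume c1: "?c0 \<preceq> c1" and "\<exists>x. tmw (fst c1) (BT \<Rrightarrow> Nat) x \<and> tame Nat x c1 \<and> forces ?B [x, generic] c1"
    then obtain x where x: "tmw (fst c1) (BT \<Rrightarrow> Nat) x" "tame Nat x c1" "forces ?B [x, generic] c1" by blast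
    have e: "tms (fst c1) [x, generic] (elts [Nat, BT])" using x(1) generic_typing by simp
    show "j Qbar c1"
    proof (rule j_bind[OF truth[OF wfB cond_le_cond_ok(2)[OF c1] e x(3)]])
      fix c2 assume c2: "c1 \<preceq> c2" "holds ?B [x, generic] c2"
      show "j Qbar c2"
      proof (rule j_bind[OF tame_mono[OF x(2) c2(1), unfolded tame.simps]])
        fix c3 assume c3: "c2 \<preceq> c3" and "\<exists>m. tmw (fst c3) Nat m \<and> agree Nat c3 x (konst m)"
        then obtain m where m: "tmw (fst c3) Nat m" "agree Nat c3 x (konst m)" by blast
        show "j Qbar c3"
        \<comment> \<open>At length at least m, the initial segment on which P is known is a prefix
          of the condition.\<close>
        proof (rule j_mono[OF cover[OF cond_le_cond_ok(2)[OF c3] m(1)]])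
          fix c4 assume c4: "c3 \<preceq> c4" "longer m c4"
          obtain w \<alpha> n where c: "c4 = (w, \<alpha>, n)" by (cases c4)
          obtain k where k: "tmw w Nat k" "eqv w Nat n (add_tm \<cdot> k \<cdot> m)" using c4(2) by (auto simp: c)
          have w: "w0 \<sqsubseteq> w" "w \<sqsubseteq> w" and t: "tmw w BT \<alpha>" "tmw w Nat n"
            using cond_le_cond_ok(2)[OF c4(1)] by (auto simp: c intro: wle_refl wle_valid)
          have tm: "tmw w Nat m" using tmw_cond_le[OF c4(1) m(1)] by (simp add: c)
          \<comment> \<open>The cone contains \<alpha> itself, and there the generic sequence takes
            the value \<alpha>.\<close>
          have "sat w (app [x, generic] \<alpha>) ?B"
            using holds_mono[OF holds_mono[OF c2(2) c3] c4(1)] w(2) t(1) cone_refl[OF t(1)] by (simp add: c)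
          then have 1: "sat w [initial_tm \<cdot> (generic \<cdot> \<alpha>) \<cdot> (x \<cdot> \<alpha>)] P" unfolding list.map B .
          have "eqv w Nat (x \<cdot> \<alpha>) (konst m \<cdot> \<alpha>)"
            using agree_mono[OF m(2) c4(1)] w(2) t(1) cone_refl[OF t(1)] by (simp add: c)
          then have "eqv w Nat (x \<cdot> \<alpha>) m" using konst_beta[OF tm t(1)] by (rule eqv_trans)
          then have 2: "eqv w Nat (initial_tm \<cdot> (generic \<cdot> \<alpha>) \<cdot> (x \<cdot> \<alpha>)) (initial_tm \<cdot> \<alpha> \<cdot> m)"
            by (rule eqv_App[OF eqv_App[OF HA.Refl[OF typing_consts(3)] generic_beta[OF t(1)]]])
          have "sat w [initial_tm \<cdot> \<alpha> \<cdot> m] P"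
            by (rule sat_eqv_single[OF w(1) wfP 2 1])
          from monotone_prefix[OF wfP mono w(1) t(1) tm k(1) this]
          have 3: "sat w [initial_tm \<cdot> \<alpha> \<cdot> (add_tm \<cdot> k \<cdot> m)] P" by simp
          have 4: "eqv w Nat (initial_tm \<cdot> \<alpha> \<cdot> (add_tm \<cdot> k \<cdot> m)) (initial_tm \<cdot> \<alpha> \<cdot> n)"
            by (rule eqv_App[OF HA.Refl eqv_sym[OF k(2)]])
              (use t(1) in \<open>blast intro: typing.intros(5) typing_consts\<close>)
          have "sat w [initial_tm \<cdot> \<alpha> \<cdot> n] P"
            by (rule sat_eqv_single[OF w(1) wfP 4 3])
          then show "Qbar c4" using PQ[OF w(1) ty_initial[OF t]] by (simp add: c)
        qed
      qed
    qed
  qed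
  \<comment> \<open>For X equal to \<open>Qbar\<close> the inner implication of the nucleus is
    trivial.\<close>
  then have "Qbar ?c0" by (rule j_D[OF _ ok])
  then have 5: "sat w0 [initial_tm \<cdot> ?z \<cdot> Zero] Q" by simp
  have 6: "eqv w0 Nat (initial_tm \<cdot> ?z \<cdot> Zero) nil_tm" by (rule initial_Zero[OF z])
  have "wf [Nat] Q" using Q by simp
  then show ?thesis by (rule sat_eqv_single[OF wle_refl[OF w0] _ 6 5])
qed

end

theorem theorem6p2:
  fixes P Q :: fm and \<Gamma> :: "ty list"
  assumes "wff [Nat] P"
    and "HA [] {}
      (All (Nat \<Rrightarrow> Nat) (Ex Nat (inst 2 (initial_tm \<cdot> Var 1 \<cdot> Var 0) P))
       \<^bold>\<and> All Nat (All Nat (inst 2 (Var 1) P \<^bold>\<longrightarrow> inst 2 (append_tm \<cdot> Var 1 \<cdot> Var 0) P))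
       \<^bold>\<and> All Nat (P \<^bold>\<or> \<^bold>\<not> P))"
    and "wff (Nat # \<Gamma>) Q"
  shows "HA \<Gamma> {}
      (All Nat (P \<^bold>\<longrightarrow> Q)
       \<^bold>\<and> All Nat (All Nat (inst 2 (append_tm \<cdot> Var 1 \<cdot> (single_tm \<cdot> Var 0)) Q) \<^bold>\<longrightarrow> Q)
       \<^bold>\<longrightarrow> inst 0 nil_tm Q)"
proof (rule HA.ImpI)
  let ?PQ = "All Nat (P \<^bold>\<longrightarrow> Q)"
  let ?s = "append_tm \<cdot> Var 1 \<cdot> (single_tm \<cdot> Var 0)"
  let ?I = "All Nat (All Nat (inst 2 ?s Q) \<^bold>\<longrightarrow> Q)"
  \<comment> \<open>The premise of the implication becomes the single hypothesis of the base world;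
    the parameters of \<open>Q\<close> form its context.\<close>
  let ?w = "World \<Gamma> {?PQ \<^bold>\<and> ?I}"
  have "list_all2 (typing ([Nat, Nat] @ \<Gamma>)) [?s] [Nat]" by (simp add: ty_append)
  from wff_sub[OF _ typed_sub_senv[OF _ this, of 2], of Q]
  have "wff (Nat # Nat # \<Gamma>) (inst 2 ?s Q)" using assms(3) by (simp add: inst_senv)
  moreover have P: "wff (Nat # \<Gamma>) P" using wff_append[OF assms(1), of \<Gamma>] by simp
  ultimately show wf: "wff \<Gamma> (?PQ \<^bold>\<and> ?I)" using assms(3) by simp
  have H: "prv ?w (?PQ \<^bold>\<and> ?I)" using wf by (simp add: HA.Hyp)
  have v: "valid ?w" using wf by (simp add: valid_def)
  interpret bar_inductive ?w Q
    using v assms(3) HA.AndE2[OF H] by unfold_locales simp_all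
  note hyp = HA.AndE1[OF HA.AndE2[OF assms(2)]]
  have "sat ?w [nil_tm] Q"
  proof (rule bar_induction[OF assms(1) HA.AndE1[OF assms(2)]])
    fix w a assume *: "?w \<sqsubseteq> w" "tmw w Nat a" "sat w [a] P"
    from prv_AllE[OF HA.AndE1[OF H] *(1,2)] have "prv w (inst 0 a P \<^bold>\<longrightarrow> inst 0 a Q)" by simp
    then show "sat w [a] Q" using HA.ImpE *(3) by (simp add: inst_senv)
  next
    fix w a b assume *: "?w \<sqsubseteq> w" "tmw w Nat a" "tmw w Nat b" "sat w [a] P"
    let ?t = "append_tm \<cdot> Var 1 \<cdot> Var 0"
    \<comment> \<open>Monotonicity of P is derivable without hypotheses or parameters, hence
      available at every world.\<close>
    have M: "prv w (All Nat (All Nat (inst 2 (Var 1) P \<^bold>\<longrightarrow> inst 2 ?t P)))"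
      using prv_transfer[OF hyp, of w Var] by (simp add: typed_sub_def)
    from HA.AllE[OF HA.AllE[OF M *(2), unfolded inst0 fsub.simps(6)] *(3)]
    have "prv w (fsub (env [b, a]) (inst 2 (Var 1) P) \<^bold>\<longrightarrow> fsub (env [b, a]) (inst 2 ?t P))"
      by (simp add: inst0_up senv_Cons case_nat_Var)
    moreover have "fsub (env [b, a]) (inst 2 (Var 1) P) = fsub (env [a]) P"
        "fsub (env [b, a]) (inst 2 ?t P) = fsub (env [append_tm \<cdot> a \<cdot> b]) P"
      using fsub_reindex[of "[b, a]" 2 "[]" "[Var 1]"] fsub_reindex[of "[b, a]" 2 "[]" "[?t]"]
      by (simp_all add: inst_senv)
    ultimately show "sat w [append_tm \<cdot> a \<cdot> b] P" using HA.ImpE *(4) by simp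
  qed
  then show "HA \<Gamma> {?PQ \<^bold>\<and> ?I} (inst 0 nil_tm Q)" by (simp add: inst_senv)
qed

end
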